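(* Let $Z$ be a spectrally positive Lévy process with unbounded variation which drifts to $+\infty$, let $Z^{\uparrow}$ be $Z$ conditioned to stay positive (starting from $0$), and let $I(Z^{\uparrow}) := \int_0^{+\infty}e^{-Z^{\uparrow}(t)}\,dt$. Then $I(Z^{\uparrow})$ is almost surely finite and admits some finite exponential moments, i.e. there exists $\lambda>0$ such that $\mathbb{E}\left[e^{\lambda I(Z^{\uparrow})}\right]<+\infty$.
   Context: A spectrally positive Lévy process is a real-valued càdlàg Lévy process $Z$ with $Z(0)=0$ and no negative jumps; $Z$ drifts to $+\infty$ if $Z(t)\to+\infty$ a.s. Write $Z_x := x+Z$. For $x>0$, $Z^{\uparrow}_x$ denotes the process $Z_x$ conditioned (in the usual sense, on an event of positive probability) on $\{\inf_{[0,+\infty[}Z_x>0\}$. $Z^{\uparrow}=Z^{\uparrow}_0$ is the limit in distribution of $Z^{\uparrow}_x$ as $x\to0+$, a Markov process started from $0$ with the same transition laws on $]0,+\infty[$; it is well defined because $Z$ has unbounded variation and hence is regular for $]0,+\infty[$. *)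

theory Defs
  imports "HOL-Probability.Probability"
begin

text \<open>
  Paths are functions \<open>real \<Rightarrow> real\<close> of which only the values at times \<open>t \<ge> 0\<close> are
  meaningful, and processes are curried families \<open>X :: real \<Rightarrow> 'a \<Rightarrow> real\<close>, \<open>X t \<omega>\<close>.
\<close>

definition cadlag :: "(real \<Rightarrow> real) \<Rightarrow> bool" where
  "cadlag f \<longleftrightarrow>
     (\<forall>t\<ge>0. (f \<longlongrightarrow> f t) (at_right t)) \<and>
     (\<forall>t>0. \<exists>l. (f \<longlongrightarrow> l) (at_left t))"

definition no_negative_jumps :: "(real \<Rightarrow> real) \<Rightarrow> bool" where
  "no_negative_jumps f \<longleftrightarrow> (\<forall>t>0. Lim (at_left t) f \<le> f t)"

definition bounded_variation_upto :: "real \<Rightarrow> (real \<Rightarrow> real) \<Rightarrow> bool" where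
  "bounded_variation_upto T f \<longleftrightarrow>
     (\<exists>B. \<forall>n (s :: nat \<Rightarrow> real).
        mono_on {..n} s \<and> s ` {..n} \<subseteq> {0..T} \<longrightarrow>
        (\<Sum>i<n. \<bar>f (s (Suc i)) - f (s i)\<bar>) \<le> B)"

definition cadlag_process :: "'a measure \<Rightarrow> (real \<Rightarrow> 'a \<Rightarrow> real) \<Rightarrow> bool" where
  "cadlag_process M X \<longleftrightarrow>
     prob_space M \<and>
     (\<forall>t\<ge>0. X t \<in> borel_measurable M) \<and>
     (\<forall>\<omega>\<in>space M. cadlag (\<lambda>t. X t \<omega>))"

definition levy_process :: "'a measure \<Rightarrow> (real \<Rightarrow> 'a \<Rightarrow> real) \<Rightarrow> bool" where
  "levy_process M Z \<longleftrightarrow>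
     cadlag_process M Z \<and>
     (AE \<omega> in M. Z 0 \<omega> = 0) \<and>
     (\<forall>n (s :: nat \<Rightarrow> real). 0 \<le> s 0 \<and> mono_on {..n} s \<longrightarrow>
        prob_space.indep_vars M (\<lambda>_. borel) (\<lambda>i \<omega>. Z (s (Suc i)) \<omega> - Z (s i) \<omega>) {..<n}) \<and>
     (\<forall>s\<ge>0. \<forall>h\<ge>0. distr M borel (\<lambda>\<omega>. Z (s + h) \<omega> - Z s \<omega>) = distr M borel (Z h))"

definition spectrally_positive_levy_process ::
    "'a measure \<Rightarrow> (real \<Rightarrow> 'a \<Rightarrow> real) \<Rightarrow> bool" where
  "spectrally_positive_levy_process M Z \<longleftrightarrow>
     levy_process M Z \<and> (AE \<omega> in M. no_negative_jumps (\<lambda>t. Z t \<omega>))"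

definition unbounded_variation :: "'a measure \<Rightarrow> (real \<Rightarrow> 'a \<Rightarrow> real) \<Rightarrow> bool" where
  "unbounded_variation M Z \<longleftrightarrow>
     (AE \<omega> in M. \<forall>T>0. \<not> bounded_variation_upto T (\<lambda>t. Z t \<omega>))"

definition drifts_to_infinity :: "'a measure \<Rightarrow> (real \<Rightarrow> 'a \<Rightarrow> real) \<Rightarrow> bool" where
  "drifts_to_infinity M Z \<longleftrightarrow> (AE \<omega> in M. filterlim (\<lambda>t. Z t \<omega>) at_top at_top)"

text \<open>
  The space of cadlag paths on \<open>[0, \<infinity>)\<close> (extended by \<^const>\<open>undefined\<close> to negative times), with
  the sigma-algebra generated by the coordinates, which is the Borel sigma-algebra of the
  Skorokhod topology.
\<close>

definition path_space :: "(real \<Rightarrow> real) measure" where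
  "path_space = restrict_space (PiM {0..} (\<lambda>_. borel)) {f. cadlag f}"

definition process_law :: "'a measure \<Rightarrow> (real \<Rightarrow> 'a \<Rightarrow> real) \<Rightarrow> (real \<Rightarrow> real) measure" where
  "process_law M X = distr M path_space (\<lambda>\<omega>. \<lambda>t\<in>{0..}. X t \<omega>)"

text \<open>
  Convergence of a sequence in the Skorokhod \<open>J\<^sub>1\<close> topology. The time changes are the
  increasing bijections of \<open>[0, \<infinity>)\<close>; these are automatically continuous and fix \<open>0\<close>.
\<close>

definition skorokhod_tendsto :: "(nat \<Rightarrow> real \<Rightarrow> real) \<Rightarrow> (real \<Rightarrow> real) \<Rightarrow> bool" where
  "skorokhod_tendsto f g \<longleftrightarrow>
     (\<exists>\<tau> :: nat \<Rightarrow> real \<Rightarrow> real.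
        (\<forall>n. strict_mono_on {0..} (\<tau> n) \<and> bij_betw (\<tau> n) {0..} {0..}) \<and>
        uniform_limit {0..} \<tau> (\<lambda>t. t) sequentially \<and>
        (\<forall>T. uniform_limit {0..T} (\<lambda>n t. f n (\<tau> n t)) g sequentially))"

text \<open>Since \<open>J\<^sub>1\<close> is metrizable, continuity is the same as sequential continuity.\<close>

definition skorokhod_continuous :: "((real \<Rightarrow> real) \<Rightarrow> real) \<Rightarrow> bool" where
  "skorokhod_continuous \<Phi> \<longleftrightarrow>
     (\<forall>f g. range f \<subseteq> space path_space \<and> g \<in> space path_space \<and> skorokhod_tendsto f g \<longrightarrow>
        (\<lambda>n. \<Phi> (f n)) \<longlonglongrightarrow> \<Phi> g)"

text \<open>
  Convergence in distribution on the Skorokhod space, for laws indexed by a parameter that runs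
  along a filter. Continuous functionals are Borel, so the measurability requirement excludes
  none of them.
\<close>

definition converges_in_distribution ::
    "('i \<Rightarrow> (real \<Rightarrow> real) measure) \<Rightarrow> (real \<Rightarrow> real) measure \<Rightarrow> 'i filter \<Rightarrow> bool" where
  "converges_in_distribution \<mu> \<nu> F \<longleftrightarrow>
     (\<forall>\<Phi>. \<Phi> \<in> borel_measurable path_space \<and> bounded (\<Phi> ` space path_space) \<and>
          skorokhod_continuous \<Phi> \<longrightarrow>
        ((\<lambda>i. \<integral>f. \<Phi> f \<partial>\<mu> i) \<longlongrightarrow> (\<integral>f. \<Phi> f \<partial>\<nu>)) F)"

text \<open>
  The law of \<open>x + Z\<close> conditioned on having a positive infimum over \<open>[0, \<infinity>)\<close>. The infimum is
  taken in \<^typ>\<open>ereal\<close> so that it is \<open>-\<infinity>\<close> on paths that are not bounded below.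
\<close>

definition conditioned_law ::
    "'a measure \<Rightarrow> (real \<Rightarrow> 'a \<Rightarrow> real) \<Rightarrow> real \<Rightarrow> (real \<Rightarrow> real) measure" where
  "conditioned_law M Z x =
     process_law
       (uniform_measure M {\<omega>\<in>space M. (INF t\<in>{0..}. ereal (x + Z t \<omega>)) > 0})
       (\<lambda>t \<omega>. x + Z t \<omega>)"

text \<open>
  \<open>Y\<close>, defined on a probability space \<open>N\<close>, is a version of \<open>Z\<close> conditioned to stay positive and
  started from \<open>0\<close>. The limit determines the law of \<open>Y\<close>, hence also that \<open>Y\<close> starts from \<open>0\<close>
  and its Markov property.
\<close>

definition conditioned_to_stay_positive ::
    "'a measure \<Rightarrow> (real \<Rightarrow> 'a \<Rightarrow> real) \<Rightarrow> 'b measure \<Rightarrow> (real \<Rightarrow> 'b \<Rightarrow> real) \<Rightarrow> bool" where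
  "conditioned_to_stay_positive M Z N Y \<longleftrightarrow>
     cadlag_process N Y \<and>
     converges_in_distribution (conditioned_law M Z) (process_law N Y) (at_right 0)"

definition exp_functional :: "(real \<Rightarrow> real) \<Rightarrow> ennreal" where
  "exp_functional f = (\<integral>\<^sup>+t\<in>{0..}. ennreal (exp (- f t)) \<partial>lborel)"

end

theory Submission
  imports Defs
begin

text \<open>
  Write \<open>h(y)\<close> for the probability that \<open>y + Z\<close> stays positive. Since \<open>Z\<close> has no negative jumps, first
  passage downwards has no overshoot, so \<open>P(inf Z < -x)\<close> over a finite horizon is submultiplicative in
  \<open>x\<close>, while over the infinite horizon it is supermultiplicative. Hence the probability of staying
  positive up to a fixed time is at most \<open>K h(y)\<close>, uniformly in small \<open>y\<close>, and together with the drift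
  this gives a delay \<open>T\<close> after which the process conditioned to stay positive has left the level
  \<open>[a, a + 1)\<close> of its starting point for good with probability at least \<open>1/2\<close>. So the expected time
  spent in each level is at most \<open>2 T\<close> and the expectation of the exponential functional is bounded
  uniformly in the starting point. Khasminskii's argument turns this into a uniform exponential moment,
  which passes to the weak limit through bounded continuous truncations of the functional.

  Everything up to the passage to the limit uses dyadic times only, so that the path space is a countable
  product and every functional is measurable.
\<close>

section \<open>The Markov property at dyadic times\<close>

text \<open>The conditioned process is never constructed. With h(x) = \<open>pr (stays x)\<close>, a
  bound c under the conditioned law is stated as: the unconditioned expectation over the event
  \<open>stays x\<close> is at most c h(x). Doob's transform then reduces to cutting
  \<open>stays x\<close> at a time t into an event of the past and the event of staying positive
  from \<open>x + f t\<close>. The obstacle is that h(x) may tend to 0 as x does, so every estimate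
  may lose only a fixed multiple of h(x). The two product inequalities suffice because each fixes a
  linear rate. With a = P(inf Z < -1), supermultiplicativity and Bernoulli's inequality give 1 -
  P(inf Z < -1/n) \<ge> (1 - a)/n, whereas submultiplicativity over a finite horizon bounds the
  corresponding quantity by L/n; the ratio stays bounded. This comparison matters only in the lowest
  level, since h(y) \<ge> h(1) for y \<ge> 1. All discrete bounds are independent of the mesh and of
  the number of grid points, so that Fatou's lemma leads back to continuous time.\<close>

definition dyadics :: "real set" where
  "dyadics = {real i / 2 ^ k | i k. True}"

lemma countable_dyadics [simp]: "countable dyadics"
proof -
  have "dyadics = (\<lambda>(i, k). real i / 2 ^ k) ` (UNIV :: (nat \<times> nat) set)"
    by (auto simp: dyadics_def image_def)
  also have "countable \<dots>" by (intro countable_image) auto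
  finally show ?thesis .
qed

lemma dyadics_I [simp, intro]: "real i / 2 ^ k \<in> dyadics"
  by (auto simp: dyadics_def)

lemma dyadics_of_nat [simp, intro]: "real i \<in> dyadics"
  using dyadics_I[of i 0] by simp

lemma dyadics_0 [simp]: "0 \<in> dyadics"
  using dyadics_of_nat[of 0] by simp

lemma dyadics_nonneg [simp]: "q \<in> dyadics \<Longrightarrow> 0 \<le> q"
  by (auto simp: dyadics_def)

text \<open>Refining puts finitely many times on one grid, so that a finite-dimensional event
  becomes a condition on partial sums of grid increments.\<close>

lemma dyadics_common_level:
  assumes "finite J" "J \<subseteq> dyadics"
  shows "\<exists>K. \<forall>q\<in>J. \<exists>i. q = real i / 2 ^ K"
  using assms
proof (induction rule: finite_induct)
  case (insert p J)
  then obtain K where K: "\<forall>q\<in>J. \<exists>i. q = real i / 2 ^ K" by auto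
  obtain i k where p: "p = real i / 2 ^ k" using insert.prems by (auto simp: dyadics_def)
  have lift: "real i / 2 ^ k = real (i * 2 ^ l) / 2 ^ (k + l)" for i k l
    by (simp add: power_add)
  have "\<exists>i. q = real i / 2 ^ (K + k)" if q: "q \<in> insert p J" for q
  proof (cases "q = p")
    case True
    then show ?thesis using p lift[of i k K] by (metis add.commute)
  next
    case False
    then obtain i' where "q = real i' / 2 ^ K" using q K by auto
    then show ?thesis using lift[of i' K k] by metis
  qed
  then show ?case by blast
qed auto

lemma dyadics_add: 
  assumes "p \<in> dyadics" "q \<in> dyadics" shows "p + q \<in> dyadics"
proof -
  obtain K where K: "\<forall>r\<in>{p, q}. \<exists>i. r = real i / 2 ^ K"
    using dyadics_common_level[of "{p, q}"] assms by auto
  then obtain i j where "p = real i / 2 ^ K" "q = real j / 2 ^ K" by auto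
  then have "p + q = real (i + j) / 2 ^ K" by (simp add: add_divide_distrib)
  then show ?thesis by (metis dyadics_I)
qed

lemma dyadics_diff: 
  assumes "p \<in> dyadics" "q \<in> dyadics" "q \<le> p" shows "p - q \<in> dyadics"
proof -
  obtain K where K: "\<forall>r\<in>{p, q}. \<exists>i. r = real i / 2 ^ K"
    using dyadics_common_level[of "{p, q}"] assms by auto
  then obtain i j where ij: "p = real i / 2 ^ K" "q = real j / 2 ^ K" by auto
  then have "j \<le> i" using assms(3) by (simp add: divide_le_cancel)
  then have "p - q = real (i - j) / 2 ^ K" using ij by (simp add: diff_divide_distrib of_nat_diff)
  then show ?thesis by (metis dyadics_I)
qed

section \<open>Paths at dyadic times and their concatenation\<close>

abbreviation dyadic_paths :: "(real \<Rightarrow> real) measure" where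
  "dyadic_paths \<equiv> PiM dyadics (\<lambda>_. borel)"

definition dyadic_path :: "(real \<Rightarrow> 'a \<Rightarrow> real) \<Rightarrow> 'a \<Rightarrow> real \<Rightarrow> real" where
  "dyadic_path Z \<omega> = (\<lambda>t\<in>dyadics. Z t \<omega>)"

text \<open>Joins the path \<open>g\<close> to the end of \<open>f\<close> at time \<open>t\<close>.
  It allows the Markov property to be stated without a filtration: the process has the law of two
  independent copies of itself spliced together.\<close>

definition splice :: "real \<Rightarrow> (real \<Rightarrow> real) \<Rightarrow> (real \<Rightarrow> real) \<Rightarrow> real \<Rightarrow> real" where
  "splice t f g = (\<lambda>s\<in>dyadics. if s \<le> t then f s else f t + g (s - t))"

lemma dyadic_path_apply [simp]: "q \<in> dyadics \<Longrightarrow> dyadic_path Z \<omega> q = Z q \<omega>"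
  by (simp add: dyadic_path_def)

lemma measurable_dyadic_path:
  assumes "\<And>t. t \<in> dyadics \<Longrightarrow> Z t \<in> borel_measurable M"
  shows "dyadic_path Z \<in> M \<rightarrow>\<^sub>M dyadic_paths"
  unfolding dyadic_path_def[abs_def] using assms by (intro measurable_restrict) auto

lemma measurable_splice:
  assumes "t \<in> dyadics"
  shows "(\<lambda>(f, g). splice t f g) \<in> dyadic_paths \<Otimes>\<^sub>M dyadic_paths \<rightarrow>\<^sub>M dyadic_paths"
proof -
  have "(\<lambda>x. splice t (fst x) (snd x)) \<in> dyadic_paths \<Otimes>\<^sub>M dyadic_paths \<rightarrow>\<^sub>M dyadic_paths"
    unfolding splice_def
  proof (rule measurable_restrict)
    fix s assume s: "s \<in> dyadics"
    show "(\<lambda>x. if s \<le> t then fst x s else fst x t + snd x (s - t))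
            \<in> borel_measurable (dyadic_paths \<Otimes>\<^sub>M dyadic_paths)"
    proof (cases "s \<le> t")
      case True
      have "(\<lambda>x. fst x s) \<in> borel_measurable (dyadic_paths \<Otimes>\<^sub>M dyadic_paths)"
        using s by measurable
      then show ?thesis using True by simp
    next
      case False
      then have d: "s - t \<in> dyadics" using assms s by (intro dyadics_diff) auto
      have "(\<lambda>x. fst x t + snd x (s - t)) \<in> borel_measurable (dyadic_paths \<Otimes>\<^sub>M dyadic_paths)"
        using assms d by measurable
      then show ?thesis using False by simp
    qed
  qed
  then show ?thesis by (simp add: case_prod_beta')
qed

section \<open>The Markov property of a Levy process on the dyadics\<close>

lemma levy_grid_increments:
  fixes Z :: "real \<Rightarrow> 'a \<Rightarrow> real"
  assumes "levy_process M Z" "0 \<le> d"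
  shows "distr M (PiM {..<n} (\<lambda>_. borel)) (\<lambda>\<omega>. \<lambda>i\<in>{..<n}. Z (real (Suc i) * d) \<omega> - Z (real i * d) \<omega>)
     = PiM {..<n} (\<lambda>_. distr M borel (Z d))"
proof -
  interpret prob_space M using assms by (simp add: levy_process_def cadlag_process_def)
  have meas: "Z t \<in> borel_measurable M" if "0 \<le> t" for t
    using assms that by (simp add: levy_process_def cadlag_process_def)
  let ?D = "\<lambda>i \<omega>. Z (real (Suc i) * d) \<omega> - Z (real i * d) \<omega>"
  let ?s = "\<lambda>i::nat. real i * d"
  have "mono_on {..n} ?s" using assms(2) by (auto intro!: mono_onI mult_right_mono)
  moreover have "0 \<le> ?s 0 \<and> mono_on {..n} ?s \<longrightarrow> indep_vars (\<lambda>_. borel) ?D {..<n}"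
  proof -
    have "\<forall>n (s :: nat \<Rightarrow> real). 0 \<le> s 0 \<and> mono_on {..n} s \<longrightarrow>
        indep_vars (\<lambda>_. borel) (\<lambda>i \<omega>. Z (s (Suc i)) \<omega> - Z (s i) \<omega>) {..<n}"
      using assms(1) unfolding levy_process_def by (elim conjE)
    from this[THEN spec, of n, THEN spec, of ?s] show ?thesis .
  qed
  ultimately have iv: "indep_vars (\<lambda>_. borel) ?D {..<n}" by simp
  have rv: "\<And>i. random_variable borel (?D i)" using assms(2) by (intro borel_measurable_diff meas) auto
  have law: "distr M borel (?D i) = distr M borel (Z d)" for i
  proof -
    have "distr M borel (\<lambda>\<omega>. Z (real i * d + d) \<omega> - Z (real i * d) \<omega>) = distr M borel (Z d)"
      using assms unfolding levy_process_def by simp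
    then show ?thesis by (simp add: algebra_simps)
  qed
  have "distr M (PiM {..<n} (\<lambda>_. borel)) (\<lambda>\<omega>. \<lambda>i\<in>{..<n}. ?D i \<omega>) = PiM {..<n} (\<lambda>i. distr M borel (?D i))"
  proof (cases "n = 0")
    case True
    interpret Di: prob_space "distr M borel (?D i)" for i by (intro prob_space_distr rv)
    interpret product_sigma_finite "\<lambda>i. distr M borel (?D i)" by standard
    have "distr M (PiM {} (\<lambda>_. borel)) (\<lambda>\<omega>. \<lambda>i\<in>{}. ?D i \<omega>) = PiM {} (\<lambda>i. distr M borel (?D i))"
    proof (rule PiM_eqI)
      have m: "(\<lambda>\<omega>. \<lambda>i\<in>{}. ?D i \<omega>) \<in> M \<rightarrow>\<^sub>M PiM {} (\<lambda>_. borel)" by (rule measurable_restrict) simp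
      show "emeasure (distr M (PiM {} (\<lambda>_. borel)) (\<lambda>\<omega>. \<lambda>i\<in>{}. ?D i \<omega>)) (Pi\<^sub>E {} A) =
          (\<Prod>i\<in>{}. emeasure (distr M borel (?D i)) (A i))" for A
        by (subst emeasure_distr[OF m]) (simp_all add: emeasure_space_1 sets_PiM_empty restrict_def vimage_def)
    qed (simp_all add: sets_PiM_empty)
    then show ?thesis using True by simp
  next
    case False
    then show ?thesis using iv rv by (subst (asm) indep_vars_iff_distr_eq_PiM) auto
  qed
  also have "\<dots> = PiM {..<n} (\<lambda>_. distr M borel (Z d))" by (simp only: law)
  finally show ?thesis .
qed

text \<open>On a grid containing \<open>t\<close>, splicing two independent copies takes the first
  \<open>p\<close> increments from one copy and the following ones from the other. These are again
  independent with the same law, so both sides integrate against the same law on path space.\<close>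

lemma levy_markov_splice:
  fixes Z :: "real \<Rightarrow> 'a \<Rightarrow> real"
  assumes levy: "levy_process M Z" and Z0: "\<And>\<omega>. \<omega> \<in> space M \<Longrightarrow> Z 0 \<omega> = 0"
    and t: "t \<in> dyadics" and \<Psi>: "\<Psi> \<in> borel_measurable dyadic_paths"
  shows "(\<integral>\<^sup>+\<omega>. \<Psi> (dyadic_path Z \<omega>) \<partial>M)
    = (\<integral>\<^sup>+\<omega>. \<integral>\<^sup>+\<omega>'. \<Psi> (splice t (dyadic_path Z \<omega>) (dyadic_path Z \<omega>')) \<partial>M \<partial>M)"
proof -
  interpret prob_space M using assms by (simp add: levy_process_def cadlag_process_def)
  interpret MM: pair_prob_space M M ..
  have meas: "Z s \<in> borel_measurable M" if "0 \<le> s" for s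
    using levy that by (simp add: levy_process_def cadlag_process_def)
  have pm[measurable]: "dyadic_path Z \<in> M \<rightarrow>\<^sub>M dyadic_paths"
    by (rule measurable_dyadic_path) (simp add: meas)
  define W where "W = (\<lambda>(\<omega>, \<omega>'). splice t (dyadic_path Z \<omega>) (dyadic_path Z \<omega>'))"
  have Wm[measurable]: "W \<in> M \<Otimes>\<^sub>M M \<rightarrow>\<^sub>M dyadic_paths"
  proof -
    have "(\<lambda>x. (\<lambda>(f, g). splice t f g) (dyadic_path Z (fst x), dyadic_path Z (snd x)))
      \<in> M \<Otimes>\<^sub>M M \<rightarrow>\<^sub>M dyadic_paths"
      by (rule measurable_compose[OF _ measurable_splice[OF t]]) measurable
    then show ?thesis by (simp add: W_def case_prod_beta')
  qed
  have eq: "distr M dyadic_paths (dyadic_path Z) = distr (M \<Otimes>\<^sub>M M) dyadic_paths W"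
  \<comment> \<open>Laws on the product agree as soon as they agree on cylinders over finite sets
    \<open>J\<close> of times.\<close>
  proof (rule measure_eqI_PiM_infinite)
    show "finite_measure (distr M dyadic_paths (dyadic_path Z))"
      by (rule finite_measure_distr) simp
    fix A J assume J: "finite J" "J \<subseteq> dyadics" and A: "\<And>i. i \<in> J \<Longrightarrow> A i \<in> sets (borel :: real measure)"
    \<comment> \<open>\<open>t\<close> is added to \<open>J\<close> so that the junction is itself a
      grid point.\<close>
    obtain K where "\<forall>q\<in>insert t J. \<exists>i. q = real i / 2 ^ K"
      using dyadics_common_level[of "insert t J"] J t by auto
    then obtain ix where ix: "\<And>q. q \<in> insert t J \<Longrightarrow> q = real (ix q) / 2 ^ K"
      by metis
    define d :: real where "d = 1 / 2 ^ K"
    have d: "0 \<le> d" by (simp add: d_def)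
    have ix': "real (ix q) * d = q" if "q \<in> insert t J" for q
      using ix[OF that, symmetric] by (simp add: d_def)
    define n where "n = Max (ix ` insert t J)"
    have n: "ix q \<le> n" if "q \<in> insert t J" for q
      unfolding n_def using J that by (intro Max_ge) auto
    define p where "p = ix t"
    have tp: "real p * d = t" using ix' p_def by auto
    have pn: "p \<le> n" using n p_def by auto
    define D where "D = (\<lambda>i \<omega>. Z (real (Suc i) * d) \<omega> - Z (real i * d) \<omega>)"
    have Dm[measurable]: "D i \<in> borel_measurable M" for i
      unfolding D_def using d by (intro borel_measurable_diff meas) auto
    \<comment> \<open>The grid increments of the spliced path: after index \<open>p\<close> they
      come from the second copy, counted again from 0.\<close>
    define X where "X = (\<lambda>x::'a \<times> 'a. \<lambda>i\<in>{..<n}. if i < p then D i (fst x) else D (i - p) (snd x))"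
    have Xm[measurable]: "X \<in> M \<Otimes>\<^sub>M M \<rightarrow>\<^sub>M PiM {..<n} (\<lambda>_. borel)"
      unfolding X_def by (rule measurable_restrict) measurable
    let ?\<nu> = "distr M borel (Z d)"
    interpret nu: prob_space ?\<nu> using d by (intro prob_space_distr meas)
    have law1: "distr M (PiM {..<m} (\<lambda>_. borel)) (\<lambda>\<omega>. \<lambda>i\<in>{..<m}. D i \<omega>) = PiM {..<m} (\<lambda>_. ?\<nu>)" for m
      unfolding D_def by (rule levy_grid_increments[OF levy d])
    interpret nup: product_sigma_finite "\<lambda>_::nat. ?\<nu>" by standard
    have box: "emeasure M {\<omega>\<in>space M. \<forall>i<m. D i \<omega> \<in> B i} = (\<Prod>i<m. emeasure ?\<nu> (B i))"
      if "\<And>i. i < m \<Longrightarrow> B i \<in> sets borel" for m B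
    proof -
      have "(\<Prod>i<m. emeasure ?\<nu> (B i)) = emeasure (PiM {..<m} (\<lambda>_. ?\<nu>)) (Pi\<^sub>E {..<m} B)"
        using that by (subst nup.emeasure_PiM) auto
      also have "\<dots> = emeasure M ((\<lambda>\<omega>. \<lambda>i\<in>{..<m}. D i \<omega>) -` Pi\<^sub>E {..<m} B \<inter> space M)"
        unfolding law1[symmetric] using that by (intro emeasure_distr sets_PiM_I_finite) auto
      also have "(\<lambda>\<omega>. \<lambda>i\<in>{..<m}. D i \<omega>) -` Pi\<^sub>E {..<m} B \<inter> space M = {\<omega>\<in>space M. \<forall>i<m. D i \<omega> \<in> B i}"
        by (simp add: vimage_def restrict_PiE_iff Int_def conj_commute Ball_def Pi_def)
      finally show ?thesis by simp
    qed
    have boxm: "{\<omega>\<in>space M. \<forall>i<m. D i \<omega> \<in> B i} \<in> sets M"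
      if B: "\<And>i. i < m \<Longrightarrow> B i \<in> sets borel" for m B
    proof -
      have "{\<omega>\<in>space M. D i \<omega> \<in> B i} \<in> sets M" if i: "i \<in> {..<m}" for i
      proof -
        have "D i -` B i \<inter> space M \<in> sets M" by (rule measurable_sets[OF Dm]) (use B i in simp)
        moreover have "D i -` B i \<inter> space M = {\<omega>\<in>space M. D i \<omega> \<in> B i}" by blast
        ultimately show ?thesis by (simp only:)
      qed
      then have "{\<omega>\<in>space M. \<forall>i\<in>{..<m}. D i \<omega> \<in> B i} \<in> sets M"
        by (rule sets.sets_Collect_finite_All[OF _ finite_lessThan])
      then show ?thesis by (simp only: Ball_def lessThan_iff)
    qed
    have law2: "distr (M \<Otimes>\<^sub>M M) (PiM {..<n} (\<lambda>_. borel)) X = PiM {..<n} (\<lambda>_. ?\<nu>)"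
    proof (rule nup.PiM_eqI)
      fix B assume B: "\<And>i. i \<in> {..<n} \<Longrightarrow> B i \<in> sets ?\<nu>"
      have "emeasure (distr (M \<Otimes>\<^sub>M M) (PiM {..<n} (\<lambda>_. borel)) X) (Pi\<^sub>E {..<n} B)
         = emeasure (M \<Otimes>\<^sub>M M) (X -` Pi\<^sub>E {..<n} B \<inter> space (M \<Otimes>\<^sub>M M))"
        using B by (intro emeasure_distr Xm sets_PiM_I_finite) auto
      also have "X -` Pi\<^sub>E {..<n} B \<inter> space (M \<Otimes>\<^sub>M M) =
         {\<omega>\<in>space M. \<forall>i<p. D i \<omega> \<in> B i} \<times> {\<omega>\<in>space M. \<forall>i<n - p. D i \<omega> \<in> B (p + i)}" (is "?L = ?R")
      proof (intro set_eqI iffI)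
        have XB: "X x \<in> Pi\<^sub>E {..<n} B \<longleftrightarrow> (\<forall>i<n. (if i < p then D i (fst x) else D (i - p) (snd x)) \<in> B i)" for x
          by (simp only: X_def restrict_PiE_iff Ball_def lessThan_iff)
        fix x assume "x \<in> ?L"
        then have *: "x \<in> space (M \<Otimes>\<^sub>M M)" "\<And>i. i < n \<Longrightarrow> (if i < p then D i (fst x) else D (i - p) (snd x)) \<in> B i"
          by (auto simp: XB)
        have "D i (fst x) \<in> B i" if "i < p" for i using *(2)[of i] that pn by auto
        moreover have "D i (snd x) \<in> B (p + i)" if "i < n - p" for i using *(2)[of "p + i"] that pn by auto
        ultimately show "x \<in> ?R" using *(1) by (cases x) (auto simp: space_pair_measure)
      next
        have XB: "X x \<in> Pi\<^sub>E {..<n} B \<longleftrightarrow> (\<forall>i<n. (if i < p then D i (fst x) else D (i - p) (snd x)) \<in> B i)" for x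
          by (simp only: X_def restrict_PiE_iff Ball_def lessThan_iff)
        fix x assume "x \<in> ?R"
        then have *: "x \<in> space (M \<Otimes>\<^sub>M M)" "\<And>i. i < p \<Longrightarrow> D i (fst x) \<in> B i" 
          "\<And>i. i < n - p \<Longrightarrow> D i (snd x) \<in> B (p + i)"
          by (auto simp: space_pair_measure)
        have "D (i - p) (snd x) \<in> B i" if "i < n" "\<not> i < p" for i
          using *(3)[of "i - p"] that by auto
        then show "x \<in> ?L" using *(1,2) by (simp add: XB)
      qed
      also have "emeasure (M \<Otimes>\<^sub>M M) ?R = (\<Prod>i<p. emeasure ?\<nu> (B i)) * (\<Prod>i<n-p. emeasure ?\<nu> (B (p + i)))"
      proof (subst emeasure_pair_measure_Times)
        show "{\<omega>\<in>space M. \<forall>i<p. D i \<omega> \<in> B i} \<in> sets M"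
          using B pn by (intro boxm) auto
        show "{\<omega>\<in>space M. \<forall>i<n - p. D i \<omega> \<in> B (p + i)} \<in> sets M"
          using B pn by (intro boxm) auto
      qed (use B pn in \<open>simp add: box\<close>)
      also have "\<dots> = (\<Prod>i\<in>{..<n}. emeasure ?\<nu> (B i))"
      proof -
        have "(\<Prod>i<n-p. emeasure ?\<nu> (B (p + i))) = (\<Prod>i\<in>{p..<n}. emeasure ?\<nu> (B i))"
          using pn by (intro prod.reindex_bij_witness[of _ "\<lambda>i. i - p" "\<lambda>i. p + i"]) auto
        moreover have "{..<n} = {..<p} \<union> {p..<n}" using pn by auto
        ultimately show ?thesis by (simp add: prod.union_disjoint ivl_disj_int)
      qed
      finally show "emeasure (distr (M \<Otimes>\<^sub>M M) (PiM {..<n} (\<lambda>_. borel)) X) (Pi\<^sub>E {..<n} B)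
         = (\<Prod>i\<in>{..<n}. emeasure ?\<nu> (B i))" .
    qed (auto intro!: sets_PiM_cong)
    \<comment> \<open>The cylinder event in terms of the increments; the same \<open>S\<close>
      serves the original and the spliced path, which reduces the claim to equality of the laws of
      the increments.\<close>
    define S where "S = {v \<in> space (PiM {..<n} (\<lambda>_. borel :: real measure)). \<forall>q\<in>J. (\<Sum>l<ix q. v l) \<in> A q}"
    have Sm: "S \<in> sets (PiM {..<n} (\<lambda>_. borel))"
    proof -
      have "{v \<in> space (PiM {..<n} (\<lambda>_. borel :: real measure)). (\<Sum>l<ix q. v l) \<in> A q} \<in> sets (PiM {..<n} (\<lambda>_. borel))"
        if q: "q \<in> J" for q
      proof -
        have "(\<lambda>v. \<Sum>l<ix q. v l) \<in> borel_measurable (PiM {..<n} (\<lambda>_. borel :: real measure))"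
          using n[of q] q by (intro borel_measurable_sum measurable_component_singleton) auto
        from measurable_sets[OF this A[OF q]] show ?thesis
          by (simp only: vimage_def Int_def mem_Collect_eq conj_commute)
      qed
      then show ?thesis unfolding S_def by (rule sets.sets_Collect_finite_All[OF _ J(1)])
    qed
    have tele: "(\<Sum>l<i. D l \<omega>) = Z (real i * d) \<omega>" if "\<omega> \<in> space M" for i \<omega>
      unfolding D_def by (subst sum_lessThan_telescope) (simp add: Z0 that)
    have emb_iff: "f \<in> prod_emb dyadics (\<lambda>_. borel) J (Pi\<^sub>E J A) \<longleftrightarrow> (\<forall>q\<in>J. f q \<in> A q)"
      if "f \<in> extensional dyadics" for f
      using that by (simp add: prod_emb_def PiE_def Pi_def Ball_def)
    have e1: "dyadic_path Z -` prod_emb dyadics (\<lambda>_. borel) J (Pi\<^sub>E J A) \<inter> space M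
       = (\<lambda>\<omega>. \<lambda>i\<in>{..<n}. D i \<omega>) -` S \<inter> space M"
    proof -
      have "dyadic_path Z \<omega> \<in> prod_emb dyadics (\<lambda>_. borel) J (Pi\<^sub>E J A) \<longleftrightarrow> (\<lambda>i\<in>{..<n}. D i \<omega>) \<in> S"
        if w: "\<omega> \<in> space M" for \<omega>
      proof -
        have "dyadic_path Z \<omega> \<in> prod_emb dyadics (\<lambda>_. borel) J (Pi\<^sub>E J A) \<longleftrightarrow> (\<forall>q\<in>J. Z q \<omega> \<in> A q)"
          by (subst emb_iff) (use J in \<open>auto simp: dyadic_path_def\<close>)
        also have "\<dots> \<longleftrightarrow> (\<forall>q\<in>J. (\<Sum>l<ix q. D l \<omega>) \<in> A q)"
          by (intro ball_cong refl) (simp add: tele[OF w] ix')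
        also have "\<dots> \<longleftrightarrow> (\<lambda>i\<in>{..<n}. D i \<omega>) \<in> S"
        proof -
          have "(\<Sum>l<ix q. (\<lambda>i\<in>{..<n}. D i \<omega>) l) = (\<Sum>l<ix q. D l \<omega>)" if "q \<in> J" for q
            using n[of q] that by (intro sum.cong) auto
          moreover have "(\<lambda>i\<in>{..<n}. D i \<omega>) \<in> space (PiM {..<n} (\<lambda>_. borel))" by (simp add: space_PiM)
          ultimately show ?thesis by (simp only: S_def mem_Collect_eq simp_thms cong: ball_cong)
        qed
        finally show ?thesis .
      qed
      then show ?thesis by auto
    qed
    have e2: "W -` prod_emb dyadics (\<lambda>_. borel) J (Pi\<^sub>E J A) \<inter> space (M \<Otimes>\<^sub>M M)
       = X -` S \<inter> space (M \<Otimes>\<^sub>M M)"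
    proof -
      have "W x \<in> prod_emb dyadics (\<lambda>_. borel) J (Pi\<^sub>E J A) \<longleftrightarrow> X x \<in> S"
        if w: "x \<in> space (M \<Otimes>\<^sub>M M)" for x
      proof -
        have w': "fst x \<in> space M" "snd x \<in> space M" using w by (auto simp: space_pair_measure)
        have Wq: "W x q = (\<Sum>l<ix q. X x l)" if q: "q \<in> J" for q
        proof (cases "q \<le> t")
          case True
          have "d > 0" by (simp add: d_def)
          then have le: "ix q \<le> p" using True ix'[of q] tp q by (metis mult_le_cancel_right_pos of_nat_le_iff insertI2)
          have "(\<Sum>l<ix q. X x l) = (\<Sum>l<ix q. D l (fst x))"
            using le pn by (intro sum.cong) (auto simp: X_def)
          then show ?thesis using tele[OF w'(1), of "ix q"] ix'[of q] q J True
            by (auto simp: W_def splice_def case_prod_beta' t)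
        next
          case False
          have dp: "d > 0" by (simp add: d_def)
          then have gt: "p < ix q" using False ix'[of q] tp q by (metis mult_le_cancel_right_pos of_nat_le_iff insertI2 not_le)
          have sp: "{..<ix q} = {..<p} \<union> {p..<ix q}" using gt by auto
          have "(\<Sum>l<ix q. X x l) = (\<Sum>l<p. X x l) + (\<Sum>l\<in>{p..<ix q}. X x l)"
            unfolding sp by (rule sum.union_disjoint) auto
          also have "(\<Sum>l<p. X x l) = (\<Sum>l<p. D l (fst x))"
            using pn by (intro sum.cong) (auto simp: X_def)
          also have "(\<Sum>l\<in>{p..<ix q}. X x l) = (\<Sum>l<ix q - p. D l (snd x))"
            using n[of q] q by (intro sum.reindex_bij_witness[of _ "\<lambda>i. p + i" "\<lambda>i. i - p"]) (auto simp: X_def)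
          also have "real (ix q - p) * d = q - t" 
            using gt ix'[of q] tp q by (simp add: of_nat_diff algebra_simps)
          then have "(\<Sum>l<ix q - p. D l (snd x)) = Z (q - t) (snd x)"
            using tele[OF w'(2), of "ix q - p"] by simp
          also have "(\<Sum>l<p. D l (fst x)) = Z t (fst x)" using tele[OF w'(1), of p] tp by simp
          finally show ?thesis using q J False dyadics_diff[of q t] t
            by (auto simp: W_def splice_def case_prod_beta')
        qed
        have "W x \<in> prod_emb dyadics (\<lambda>_. borel) J (Pi\<^sub>E J A) \<longleftrightarrow> (\<forall>q\<in>J. W x q \<in> A q)"
        proof -
          have "W x \<in> extensional dyadics" by (simp add: W_def splice_def case_prod_beta')
          then show ?thesis by (rule emb_iff)
        qed
        also have "\<dots> \<longleftrightarrow> X x \<in> S" 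
        proof -
          have "X x \<in> space (PiM {..<n} (\<lambda>_. borel))" by (simp add: X_def space_PiM)
          then show ?thesis using Wq by (simp add: S_def)
        qed
        finally show ?thesis .
      qed
      then show ?thesis by auto
    qed
    have emb: "prod_emb dyadics (\<lambda>_. borel) J (Pi\<^sub>E J A) \<in> sets dyadic_paths"
      using J A by (intro sets_PiM_I) auto
    have "emeasure (distr M dyadic_paths (dyadic_path Z)) (prod_emb dyadics (\<lambda>_. borel) J (Pi\<^sub>E J A))
       = emeasure (distr M (PiM {..<n} (\<lambda>_. borel)) (\<lambda>\<omega>. \<lambda>i\<in>{..<n}. D i \<omega>)) S"
      using emb e1 Sm by (simp add: emeasure_distr)
    also have "\<dots> = emeasure (distr (M \<Otimes>\<^sub>M M) (PiM {..<n} (\<lambda>_. borel)) X) S"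
      by (simp only: law1 law2)
    also have "\<dots> = emeasure (distr (M \<Otimes>\<^sub>M M) dyadic_paths W) (prod_emb dyadics (\<lambda>_. borel) J (Pi\<^sub>E J A))"
      using emb e2 Sm by (simp add: emeasure_distr)
    finally show "emeasure (distr M dyadic_paths (dyadic_path Z)) (prod_emb dyadics (\<lambda>_. borel) J (Pi\<^sub>E J A))
       = emeasure (distr (M \<Otimes>\<^sub>M M) dyadic_paths W) (prod_emb dyadics (\<lambda>_. borel) J (Pi\<^sub>E J A))" .
  qed simp_all
  have "(\<integral>\<^sup>+\<omega>. \<Psi> (dyadic_path Z \<omega>) \<partial>M) = (\<integral>\<^sup>+f. \<Psi> f \<partial>distr M dyadic_paths (dyadic_path Z))"
    using \<Psi> by (simp add: nn_integral_distr)
  also have "\<dots> = (\<integral>\<^sup>+x. \<Psi> (W x) \<partial>(M \<Otimes>\<^sub>M M))"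
    unfolding eq using \<Psi> by (simp add: nn_integral_distr)
  also have "\<dots> = (\<integral>\<^sup>+\<omega>. \<integral>\<^sup>+\<omega>'. \<Psi> (W (\<omega>, \<omega>')) \<partial>M \<partial>M)"
    by (rule nn_integral_fst[symmetric]) (use \<Psi> in measurable)
  finally show ?thesis by (simp add: W_def)
qed

section \<open>Paths staying positive\<close>

lemma borel_measurable_of_bool:
  assumes "Measurable.pred M P"
  shows "(\<lambda>x. of_bool (P x) :: ennreal) \<in> borel_measurable M"
  unfolding of_bool_def using assms by measurable

text \<open>The increments after time \<open>t\<close>, restarted at 0; it recovers the second path
  from a splice.\<close>

definition shift :: "real \<Rightarrow> (real \<Rightarrow> real) \<Rightarrow> real \<Rightarrow> real" where
  "shift t f = (\<lambda>s\<in>dyadics. f (t + s) - f t)"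

text \<open>Positivity of the infimum, not just of all values: a uniform margin
  \<open>1 / real (Suc n)\<close> survives the passage from dyadic to real times, and the countable
  quantifiers make the event measurable.\<close>

definition stays :: "real \<Rightarrow> (real \<Rightarrow> real) \<Rightarrow> bool" where
  "stays y f \<longleftrightarrow> (\<exists>n. \<forall>q\<in>dyadics. 1 / real (Suc n) \<le> y + f q)"

definition stays_until :: "real \<Rightarrow> real \<Rightarrow> (real \<Rightarrow> real) \<Rightarrow> bool" where
  "stays_until t y f \<longleftrightarrow> (\<exists>n. \<forall>q\<in>dyadics. q \<le> t \<longrightarrow> 1 / real (Suc n) \<le> y + f q)"

lemma shift_splice:
  assumes "t \<in> dyadics" "g \<in> extensional dyadics" "g 0 = 0"
  shows "shift t (splice t f g) = g"
proof
  fix s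
  consider "s \<notin> dyadics" | "s = 0" | "s \<in> dyadics" "0 < s"
    by (metis dyadics_nonneg less_eq_real_def)
  then show "shift t (splice t f g) s = g s"
    using assms by cases (auto simp: shift_def splice_def dyadics_add extensional_def)
qed

lemma shift_apply [simp]: "s \<in> dyadics \<Longrightarrow> shift t f s = f (t + s) - f t"
  by (simp add: shift_def)

lemma pred_stays [measurable]: "Measurable.pred dyadic_paths (stays y)"
  unfolding stays_def
  by (intro pred_intros_countable pred_intros_countable_bounded countable_dyadics) measurable

lemma pred_stays_until [measurable]: "Measurable.pred dyadic_paths (stays_until t y)"
  unfolding stays_until_def
  by (intro pred_intros_countable pred_intros_countable_bounded countable_dyadics) measurable

lemma stays_untilD:
  assumes "stays_until t y f" "q \<in> dyadics" "q \<le> t" shows "0 < y + f q"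
proof -
  obtain n where "1 / real (Suc n) \<le> y + f q" using assms by (auto simp: stays_until_def)
  moreover have "0 < 1 / real (Suc n)" by simp
  ultimately show ?thesis by linarith
qed

lemma staysD:
  assumes "stays y f" "q \<in> dyadics" shows "0 < y + f q"
proof -
  obtain n where "1 / real (Suc n) \<le> y + f q" using assms by (auto simp: stays_def)
  moreover have "0 < 1 / real (Suc n)" by simp
  ultimately show ?thesis by linarith
qed

lemma stays_mono: "stays x f \<Longrightarrow> x \<le> y \<Longrightarrow> stays y f"
  unfolding stays_def by (meson add_right_mono order_trans)

lemma stays_imp_stays_until: "stays y f \<Longrightarrow> stays_until t y f"
  by (auto simp: stays_def stays_until_def)

text \<open>The margins of the two pieces combine into the smaller one. This factorization is what
  allows the Markov property to act on the conditioning event.\<close>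

lemma stays_split:
  assumes t: "t \<in> dyadics"
  shows "stays x f \<longleftrightarrow> stays_until t x f \<and> stays (x + f t) (shift t f)"
proof
  assume s: "stays x f"
  then obtain n where n: "\<forall>q\<in>dyadics. 1 / real (Suc n) \<le> x + f q" by (auto simp: stays_def)
  have "stays (x + f t) (shift t f)"
    unfolding stays_def using n dyadics_add[OF t] by (intro exI[of _ n]) (auto simp: algebra_simps)
  then show "stays_until t x f \<and> stays (x + f t) (shift t f)"
    using s stays_imp_stays_until by blast
next
  assume "stays_until t x f \<and> stays (x + f t) (shift t f)"
  then obtain n m where n: "\<forall>q\<in>dyadics. q \<le> t \<longrightarrow> 1 / real (Suc n) \<le> x + f q"
    and m: "\<forall>q\<in>dyadics. 1 / real (Suc m) \<le> x + f t + shift t f q"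
    by (auto simp: stays_def stays_until_def)
  have "1 / real (Suc (max n m)) \<le> x + f q" if q: "q \<in> dyadics" for q
  proof (cases "q \<le> t")
    case True
    have "1 / real (Suc (max n m)) \<le> 1 / real (Suc n)" by (intro divide_left_mono) auto
    also have "\<dots> \<le> x + f q" using n q True by blast
    finally show ?thesis .
  next
    case False
    have d: "q - t \<in> dyadics" using False t q by (intro dyadics_diff) auto
    have "1 / real (Suc (max n m)) \<le> 1 / real (Suc m)" by (intro divide_left_mono) auto
    also have "\<dots> \<le> x + f t + shift t f (q - t)" using m d by blast
    also have "\<dots> = x + f q" using d by simp
    finally show ?thesis .
  qed
  then show "stays x f" unfolding stays_def by blast
qed

lemma stays_until_cong:
  assumes "\<And>q. q \<in> dyadics \<Longrightarrow> q \<le> t \<Longrightarrow> f q = g q"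
  shows "stays_until t x f = stays_until t x g"
  unfolding stays_until_def using assms by (metis (no_types, lifting))

text \<open>Failure only gives values of \<open>y + f q\<close> that are arbitrarily small or
  negative, so strict passage is claimed below half the starting height.\<close>

lemma not_stays_imp_below:
  assumes "\<not> stays y f" "0 < y" shows "\<exists>q\<in>dyadics. f q < - (y / 2)"
proof -
  obtain n where n: "1 / real (Suc n) < y / 2" using assms(2) nat_approx_posE[of "y/2"] by auto
  obtain q where "q \<in> dyadics" "y + f q < 1 / real (Suc n)"
    using assms(1) unfolding stays_def by (meson not_le)
  then show ?thesis using n by (intro bexI[of _ q]) auto
qed

text \<open>The interface between continuous and discrete time. \<open>Z\<close> starts from 0 at
  every sample point so that path identities hold without exceptional sets, and
  \<open>small_drops\<close> is the trace of the absence of negative jumps on fine grids.\<close>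

locale dyadic_levy = prob_space M for M :: "'a measure" +
  fixes Z :: "real \<Rightarrow> 'a \<Rightarrow> real"
  assumes Z_measurable: "\<And>t. t \<in> dyadics \<Longrightarrow> Z t \<in> borel_measurable M"
    and Z_0: "\<And>\<omega>. \<omega> \<in> space M \<Longrightarrow> Z 0 \<omega> = 0"
    and markov: "\<And>t \<Psi>. t \<in> dyadics \<Longrightarrow> \<Psi> \<in> borel_measurable dyadic_paths \<Longrightarrow>
      (\<integral>\<^sup>+\<omega>. \<Psi> (dyadic_path Z \<omega>) \<partial>M)
        = (\<integral>\<^sup>+\<omega>. \<integral>\<^sup>+\<omega>'. \<Psi> (splice t (dyadic_path Z \<omega>) (dyadic_path Z \<omega>')) \<partial>M \<partial>M)"
    and drift: "AE \<omega> in M. \<forall>c. \<exists>n::nat. \<forall>q\<in>dyadics. real n \<le> q \<longrightarrow> c \<le> Z q \<omega>"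
    and bounded_below: "AE \<omega> in M. \<exists>c. \<forall>q\<in>dyadics. c \<le> Z q \<omega>"
    and small_drops: "\<And>e N. 0 < e \<Longrightarrow> AE \<omega> in M. \<forall>\<^sub>F k in sequentially.
      \<forall>j<N * 2 ^ k. Z (real j / 2 ^ k) \<omega> - e \<le> Z (real (Suc j) / 2 ^ k) \<omega>"
begin

section \<open>Expectations of path functionals and restarting at a fixed time\<close>

definition EE :: "((real \<Rightarrow> real) \<Rightarrow> ennreal) \<Rightarrow> ennreal" where
  "EE F = (\<integral>\<^sup>+\<omega>. F (dyadic_path Z \<omega>) \<partial>M)"

definition pr :: "((real \<Rightarrow> real) \<Rightarrow> bool) \<Rightarrow> real" where
  "pr P = prob {\<omega> \<in> space M. P (dyadic_path Z \<omega>)}"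

lemma path_measurable [measurable]: "dyadic_path Z \<in> M \<rightarrow>\<^sub>M dyadic_paths"
  by (rule measurable_dyadic_path) (rule Z_measurable)

lemma EE_mono: "(\<And>\<omega>. \<omega> \<in> space M \<Longrightarrow> F (dyadic_path Z \<omega>) \<le> G (dyadic_path Z \<omega>)) \<Longrightarrow> EE F \<le> EE G"
  unfolding EE_def by (rule nn_integral_mono)

lemma EE_cong: "(\<And>\<omega>. \<omega> \<in> space M \<Longrightarrow> F (dyadic_path Z \<omega>) = G (dyadic_path Z \<omega>)) \<Longrightarrow> EE F = EE G"
  unfolding EE_def by (rule nn_integral_cong)

lemma EE_cmult: "F \<in> borel_measurable dyadic_paths \<Longrightarrow> EE (\<lambda>f. c * F f) = c * EE F"
  unfolding EE_def by (intro nn_integral_cmult measurable_compose[OF path_measurable])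

lemma EE_sum: "(\<And>i. i \<in> I \<Longrightarrow> F i \<in> borel_measurable dyadic_paths) \<Longrightarrow>
    EE (\<lambda>f. \<Sum>i\<in>I. F i f) = (\<Sum>i\<in>I. EE (F i))"
  unfolding EE_def by (intro nn_integral_sum measurable_compose[OF path_measurable])

lemma EE_suminf: "(\<And>i. F i \<in> borel_measurable dyadic_paths) \<Longrightarrow>
    EE (\<lambda>f. \<Sum>i. F i f) = (\<Sum>i. EE (F i))"
  unfolding EE_def by (intro nn_integral_suminf measurable_compose[OF path_measurable])

lemma EE_add: "F \<in> borel_measurable dyadic_paths \<Longrightarrow> G \<in> borel_measurable dyadic_paths \<Longrightarrow>
    EE (\<lambda>f. F f + G f) = EE F + EE G"
  unfolding EE_def by (intro nn_integral_add measurable_compose[OF path_measurable])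

lemma event: "Measurable.pred dyadic_paths P \<Longrightarrow> {\<omega> \<in> space M. P (dyadic_path Z \<omega>)} \<in> sets M"
  using measurable_compose[OF path_measurable, of P] by (simp add: pred_def)

lemma EE_of_bool:
  assumes "Measurable.pred dyadic_paths P"
  shows "EE (\<lambda>f. of_bool (P f)) = ennreal (pr P)"
proof -
  have "EE (\<lambda>f. of_bool (P f)) = (\<integral>\<^sup>+\<omega>. indicator {\<omega> \<in> space M. P (dyadic_path Z \<omega>)} \<omega> \<partial>M)"
    unfolding EE_def by (intro nn_integral_cong) (auto simp: indicator_def)
  also have "\<dots> = emeasure M {\<omega> \<in> space M. P (dyadic_path Z \<omega>)}"
    by (intro nn_integral_indicator event assms)
  finally show ?thesis by (simp add: emeasure_eq_measure pr_def)
qed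

lemma pr_mono:
  assumes "Measurable.pred dyadic_paths Q"
    and "\<And>\<omega>. \<omega> \<in> space M \<Longrightarrow> P (dyadic_path Z \<omega>) \<Longrightarrow> Q (dyadic_path Z \<omega>)"
  shows "pr P \<le> pr Q"
  unfolding pr_def using assms(2) by (intro finite_measure_mono event assms(1)) auto

lemma pr_le_add:
  assumes "Measurable.pred dyadic_paths P" "Measurable.pred dyadic_paths Q"
    and "\<And>\<omega>. \<omega> \<in> space M \<Longrightarrow> R (dyadic_path Z \<omega>) \<Longrightarrow> P (dyadic_path Z \<omega>) \<or> Q (dyadic_path Z \<omega>)"
  shows "pr R \<le> pr P + pr Q"
proof -
  have "pr R \<le> prob ({\<omega> \<in> space M. P (dyadic_path Z \<omega>)} \<union> {\<omega> \<in> space M. Q (dyadic_path Z \<omega>)})"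
    unfolding pr_def using assms by (intro finite_measure_mono sets.Un event) auto
  also have "\<dots> \<le> pr P + pr Q"
    unfolding pr_def by (intro measure_Un_le event assms)
  finally show ?thesis .
qed

lemma pr_nonneg [simp]: "0 \<le> pr P" and pr_le_1 [simp]: "pr P \<le> 1"
  by (simp_all add: pr_def)

lemma pr_not: "Measurable.pred dyadic_paths P \<Longrightarrow> pr (\<lambda>f. \<not> P f) = 1 - pr P"
  unfolding pr_def by (rule prob_neg) (rule event)

text \<open>Dominated convergence for indicators that are eventually constant along almost every
  path; limits in the mesh, the horizon and the level are all taken this way.\<close>

lemma pr_tendsto:
  assumes "\<And>k. Measurable.pred dyadic_paths (P k)" "Measurable.pred dyadic_paths Q"
    and ae: "AE \<omega> in M. \<forall>\<^sub>F k in sequentially. P k (dyadic_path Z \<omega>) = Q (dyadic_path Z \<omega>)"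
  shows "(\<lambda>k. pr (P k)) \<longlonglongrightarrow> pr Q"
proof -
  let ?A = "\<lambda>P. {\<omega> \<in> space M. P (dyadic_path Z \<omega>)}"
  note ev = event[OF assms(1)] event[OF assms(2)]
  have "(\<lambda>k. integral\<^sup>L M (indicator (?A (P k)) :: 'a \<Rightarrow> real)) \<longlonglongrightarrow> integral\<^sup>L M (indicator (?A Q) :: 'a \<Rightarrow> real)"
  proof (rule integral_dominated_convergence[where w = "\<lambda>_. 1"])
    show "AE \<omega> in M. (\<lambda>k. indicator (?A (P k)) \<omega> :: real) \<longlonglongrightarrow> indicator (?A Q) \<omega>"
      using ae
    proof eventually_elim
      case (elim \<omega>)
      show ?case
        by (rule tendsto_eventually) (use elim in eventually_elim, auto simp: indicator_def)
    qed
  qed (use ev in \<open>auto simp: indicator_def\<close>)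
  then show ?thesis using ev by (simp add: pr_def)
qed

text \<open>The working form of the Markov property: a factor \<open>c\<close> of the past times a
  functional of the restarted increments, which may depend on the present position. That
  \<open>c\<close> belongs to the past is expressed by \<open>past\<close>, as invariance under
  changes of the path after \<open>t\<close>.\<close>

lemma restart:
  assumes t: "t \<in> dyadics" and \<Phi>: "\<Phi> \<in> borel_measurable dyadic_paths"
    and eq: "\<And>f. \<Phi> f = c f * \<Psi> (f t) (shift t f)"
    and past: "\<And>f g. (\<And>q. q \<in> dyadics \<Longrightarrow> q \<le> t \<Longrightarrow> f q = g q) \<Longrightarrow> c f = c g"
    and \<Psi>: "\<And>y. \<Psi> y \<in> borel_measurable dyadic_paths"
  shows "EE \<Phi> = EE (\<lambda>f. c f * EE (\<Psi> (f t)))"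
proof -
  have "EE \<Phi> = EE (\<lambda>f. EE (\<lambda>g. \<Phi> (splice t f g)))"
    unfolding EE_def by (rule markov[OF t \<Phi>])
  also have "\<dots> = EE (\<lambda>f. c f * EE (\<Psi> (f t)))"
  proof (rule EE_cong)
    fix \<omega> assume "\<omega> \<in> space M"
    let ?f = "dyadic_path Z \<omega>"
    have "EE (\<lambda>g. \<Phi> (splice t ?f g)) = EE (\<lambda>g. c ?f * \<Psi> (?f t) g)"
    proof (rule EE_cong)
      fix \<omega>' assume w: "\<omega>' \<in> space M"
      let ?g = "dyadic_path Z \<omega>'"
      have "shift t (splice t ?f ?g) = ?g"
        using t w by (intro shift_splice) (auto simp: dyadic_path_def Z_0)
      moreover have "splice t ?f ?g t = ?f t" using t by (simp add: splice_def)
      moreover have "c (splice t ?f ?g) = c ?f" by (rule past) (simp add: splice_def)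
      ultimately show "\<Phi> (splice t ?f ?g) = c ?f * \<Psi> (?f t) ?g" by (simp add: eq)
    qed
    also have "\<dots> = c ?f * EE (\<Psi> (?f t))" by (rule EE_cmult) (rule \<Psi>)
    finally show "EE (\<lambda>g. \<Phi> (splice t ?f g)) = c ?f * EE (\<Psi> (?f t))" .
  qed
  finally show ?thesis .
qed

text \<open>The special case of \<open>restart\<close> in which the later functional ignores the
  present position, i.e. independence of the past and the later increments.\<close>

lemma pr_indep_shift:
  assumes t: "t \<in> dyadics" and C: "Measurable.pred dyadic_paths C" and B: "Measurable.pred dyadic_paths B"
    and CB: "Measurable.pred dyadic_paths (\<lambda>f. B (shift t f))"
    and past: "\<And>f g. (\<And>q. q \<in> dyadics \<Longrightarrow> q \<le> t \<Longrightarrow> f q = g q) \<Longrightarrow> C f = C g"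
  shows "pr (\<lambda>f. C f \<and> B (shift t f)) = pr C * pr B"
proof -
  have "ennreal (pr (\<lambda>f. C f \<and> B (shift t f))) = EE (\<lambda>f. of_bool (C f \<and> B (shift t f)))"
    using C CB by (intro EE_of_bool[symmetric]) measurable
  also have "\<dots> = EE (\<lambda>f. of_bool (C f) * EE (\<lambda>g. of_bool (B g)))"
  proof (rule restart[OF t])
    show "(\<lambda>f. of_bool (C f \<and> B (shift t f)) :: ennreal) \<in> borel_measurable dyadic_paths"
      using C CB by (intro borel_measurable_of_bool) measurable
    show "(of_bool (C f) :: ennreal) = of_bool (C g)"
      if "\<And>q. q \<in> dyadics \<Longrightarrow> q \<le> t \<Longrightarrow> f q = g q" for f g
      using past[OF that] by simp
  qed (use B in \<open>simp_all add: borel_measurable_of_bool of_bool_conj\<close>)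
  also have "\<dots> = EE (\<lambda>f. EE (\<lambda>g. of_bool (B g)) * of_bool (C f))" by (simp add: mult.commute)
  also have "\<dots> = EE (\<lambda>g. of_bool (B g)) * EE (\<lambda>f. of_bool (C f))"
    by (intro EE_cmult borel_measurable_of_bool C)
  also have "\<dots> = ennreal (pr C * pr B)"
    by (simp add: EE_of_bool C B ennreal_mult mult.commute)
  finally show ?thesis by simp
qed

end

section \<open>Passage below a level\<close>

lemma pred_Bex_dyadics:
  assumes "\<And>q. q \<in> dyadics \<Longrightarrow> Measurable.pred M (P q)"
  shows "Measurable.pred M (\<lambda>x. \<exists>q\<in>dyadics. P q x)"
proof -
  have "{x \<in> space M. \<exists>q\<in>dyadics. P q x} = (\<Union>q\<in>dyadics. {x \<in> space M. P q x})" by auto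
  also have "\<dots> \<in> sets M"
    using assms unfolding pred_def by (intro sets.countable_UN' countable_dyadics) auto
  finally show ?thesis unfolding pred_def .
qed

definition dips :: "real \<Rightarrow> (real \<Rightarrow> real) \<Rightarrow> bool" where
  "dips x f \<longleftrightarrow> (\<exists>q\<in>dyadics. f q < - x)"

definition dips_until :: "real \<Rightarrow> real \<Rightarrow> (real \<Rightarrow> real) \<Rightarrow> bool" where
  "dips_until t x f \<longleftrightarrow> (\<exists>q\<in>dyadics. q \<le> t \<and> f q < - x)"

text \<open>The event that the grid passage time below \<open>- x\<close> equals \<open>j\<close>.
  These events are disjoint in \<open>j\<close> and decided by time \<open>real j / 2 ^ k\<close>,
  so a restart at the passage time reduces to restarts at fixed times.\<close>

definition first_dip :: "nat \<Rightarrow> real \<Rightarrow> nat \<Rightarrow> (real \<Rightarrow> real) \<Rightarrow> bool" where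
  "first_dip k x j f \<longleftrightarrow> f (real j / 2 ^ k) < - x \<and> (\<forall>i<j. - x \<le> f (real i / 2 ^ k))"

lemma pred_dips [measurable]: "Measurable.pred dyadic_paths (dips x)"
  unfolding dips_def by (intro pred_Bex_dyadics) measurable

lemma pred_dips_until [measurable]: "Measurable.pred dyadic_paths (dips_until t x)"
  unfolding dips_until_def by (intro pred_Bex_dyadics) measurable

lemma pred_first_dip [measurable]: "Measurable.pred dyadic_paths (first_dip k x j)"
  unfolding first_dip_def by (intro pred_intros_logic pred_intros_countable) measurable

lemma pred_dips_shift:
  assumes t: "t \<in> dyadics" 
  shows "Measurable.pred dyadic_paths (\<lambda>f. dips x (shift t f))"
    "Measurable.pred dyadic_paths (\<lambda>f. dips_until s x (shift t f))"
proof -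
  have [measurable]: "(\<lambda>f. shift t f q) \<in> borel_measurable dyadic_paths" if "q \<in> dyadics" for q
    using t that by (simp add: dyadics_add measurable_component_singleton)
  show "Measurable.pred dyadic_paths (\<lambda>f. dips x (shift t f))"
    "Measurable.pred dyadic_paths (\<lambda>f. dips_until s x (shift t f))"
    unfolding dips_def dips_until_def
    by (intro pred_Bex_dyadics; measurable)+
qed

lemma ex_first_dip_iff: "(\<exists>j\<le>n. first_dip k x j f) \<longleftrightarrow> (\<exists>j\<le>n. f (real j / 2 ^ k) < - x)"
proof
  assume "\<exists>j\<le>n. f (real j / 2 ^ k) < - x"
  then obtain j where j: "j \<le> n" "f (real j / 2 ^ k) < - x" by blast
  define i where "i = (LEAST j. f (real j / 2 ^ k) < - x)"
  have "f (real i / 2 ^ k) < - x" unfolding i_def by (rule LeastI) (rule j(2))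
  moreover have "i \<le> j" unfolding i_def by (rule Least_le) (rule j(2))
  moreover have "- x \<le> f (real l / 2 ^ k)" if "l < i" for l
    using not_less_Least[of l "\<lambda>j. f (real j / 2 ^ k) < - x"] that by (simp add: i_def not_less)
  ultimately show "\<exists>j\<le>n. first_dip k x j f" using j(1) by (auto simp: first_dip_def intro!: exI[of _ i])
qed (auto simp: first_dip_def)

lemma first_dip_unique: "first_dip k x i f \<Longrightarrow> first_dip k x j f \<Longrightarrow> i = j"
  unfolding first_dip_def by (metis not_le nat_neq_iff)

lemma first_dip_cong:
  assumes "\<And>q. q \<in> dyadics \<Longrightarrow> q \<le> real j / 2 ^ k \<Longrightarrow> f q = g q"
  shows "first_dip k x j f = first_dip k x j g"
proof -
  have "f (real i / 2 ^ k) = g (real i / 2 ^ k)" if "i \<le> j" for i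
    using that by (intro assms) (auto simp: divide_right_mono)
  then show ?thesis unfolding first_dip_def by (metis less_imp_le_nat order_refl)
qed

lemma dips_mono: "dips y f \<Longrightarrow> x \<le> y \<Longrightarrow> dips x f"
  unfolding dips_def by (meson le_imp_neg_le less_le_trans)

lemma dips_until_mono: "dips_until t y f \<Longrightarrow> x \<le> y \<Longrightarrow> dips_until t x f"
  unfolding dips_until_def by (meson le_imp_neg_le less_le_trans)

lemma level_refine:
  assumes "k \<le> K" shows "\<exists>i. real j / 2 ^ k = real i / 2 ^ K"
proof
  have "real (j * 2 ^ (K - k)) / 2 ^ K = real j * (2 ^ (K - k) / 2 ^ K)" by simp
  also have "(2::real) ^ (K - k) / 2 ^ K = 1 / 2 ^ k" using assms by (simp add: power_diff)
  finally show "real j / 2 ^ k = real (j * 2 ^ (K - k)) / 2 ^ K" by simp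
qed

context dyadic_levy
begin

section \<open>Restarting at the grid passage time, and product inequalities for passage
  probabilities\<close>

lemma pr_sum:
  assumes "finite I" and meas: "\<And>i. i \<in> I \<Longrightarrow> Measurable.pred dyadic_paths (P i)"
    and disj: "\<And>i j f. i \<in> I \<Longrightarrow> j \<in> I \<Longrightarrow> P i f \<Longrightarrow> P j f \<Longrightarrow> i = j"
  shows "pr (\<lambda>f. \<exists>i\<in>I. P i f) = (\<Sum>i\<in>I. pr (P i))"
proof -
  have "prob (\<Union>i\<in>I. {\<omega> \<in> space M. P i (dyadic_path Z \<omega>)}) = (\<Sum>i\<in>I. prob {\<omega> \<in> space M. P i (dyadic_path Z \<omega>)})"
    using assms by (intro finite_measure_finite_Union) (auto simp: disjoint_family_on_def event)
  also have "(\<Union>i\<in>I. {\<omega> \<in> space M. P i (dyadic_path Z \<omega>)}) = {\<omega> \<in> space M. \<exists>i\<in>I. P i (dyadic_path Z \<omega>)}"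
    by auto
  finally show ?thesis by (simp add: pr_def)
qed

text \<open>The strong Markov property at the grid passage time: after splitting by the value
  \<open>j\<close> of that time, each term factorizes by independence of increments, always with the
  same second factor.\<close>

lemma pr_first_dip_restart:
  assumes B: "Measurable.pred dyadic_paths B"
    and CB: "\<And>j. Measurable.pred dyadic_paths (\<lambda>f. B (shift (real j / 2 ^ k) f))"
  shows "pr (\<lambda>f. \<exists>j\<in>{..n}. first_dip k x j f \<and> B (shift (real j / 2 ^ k) f)) =
    pr (\<lambda>f. \<exists>j\<le>n. f (real j / 2 ^ k) < - x) * pr B"
proof -
  have "pr (\<lambda>f. \<exists>j\<in>{..n}. first_dip k x j f \<and> B (shift (real j / 2 ^ k) f)) =
      (\<Sum>j\<le>n. pr (\<lambda>f. first_dip k x j f \<and> B (shift (real j / 2 ^ k) f)))"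
    using CB by (intro pr_sum pred_intros_logic) (auto dest: first_dip_unique)
  also have "\<dots> = (\<Sum>j\<le>n. pr (first_dip k x j) * pr B)"
    by (intro sum.cong refl pr_indep_shift B CB first_dip_cong) auto
  also have "\<dots> = (\<Sum>j\<le>n. pr (first_dip k x j)) * pr B" by (simp add: sum_distrib_right)
  also have "(\<Sum>j\<le>n. pr (first_dip k x j)) = pr (\<lambda>f. \<exists>j\<in>{..n}. first_dip k x j f)"
    by (intro pr_sum[symmetric]) (auto dest: first_dip_unique)
  also have "(\<lambda>f. \<exists>j\<in>{..n}. first_dip k x j f) = (\<lambda>f. \<exists>j\<le>n. f (real j / 2 ^ k) < - x)"
    using ex_first_dip_iff by (auto simp: fun_eq_iff Bex_def)
  finally show ?thesis .
qed

lemma pr_dips_until_tendsto: "(\<lambda>n. pr (dips_until (real n) x)) \<longlonglongrightarrow> pr (dips x)"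
proof (rule pr_tendsto)
  show "AE \<omega> in M. \<forall>\<^sub>F n in sequentially. dips_until (real n) x (dyadic_path Z \<omega>) = dips x (dyadic_path Z \<omega>)"
  proof (rule AE_I2)
    fix \<omega>
    let ?f = "dyadic_path Z \<omega>"
    show "\<forall>\<^sub>F n in sequentially. dips_until (real n) x ?f = dips x ?f"
    proof (cases "dips x ?f")
      case True
      then obtain q where q: "q \<in> dyadics" "?f q < - x" by (auto simp: dips_def)
      have "\<forall>\<^sub>F n in sequentially. q \<le> real n" by real_asymp
      then show ?thesis by eventually_elim (use q True in \<open>auto simp: dips_until_def\<close>)
    qed (auto simp: dips_def dips_until_def)
  qed
qed auto

text \<open>Dyadic grids are nested, so a dyadic time at which the path is below \<open>- x\<close>
  is seen by every sufficiently fine grid.\<close>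

lemma pr_grid_dips_tendsto:
  "(\<lambda>k. pr (\<lambda>f. \<exists>j\<le>n * 2 ^ k. f (real j / 2 ^ k) < - x)) \<longlonglongrightarrow> pr (dips_until (real n) x)"
proof (rule pr_tendsto)
  show "AE \<omega> in M. \<forall>\<^sub>F k in sequentially. (\<exists>j\<le>n * 2 ^ k. dyadic_path Z \<omega> (real j / 2 ^ k) < - x)
      = dips_until (real n) x (dyadic_path Z \<omega>)"
  proof (rule AE_I2)
    fix \<omega>
    let ?f = "dyadic_path Z \<omega>"
    have le: "real j / 2 ^ k \<le> real n" if "j \<le> n * 2 ^ k" for j k
    proof -
      have "real j \<le> real (n * 2 ^ k)" using that by (simp only: of_nat_le_iff)
      then show ?thesis by (simp add: divide_le_eq)
    qed
    have ge: "j \<le> n * 2 ^ k" if "real j / 2 ^ k \<le> real n" for j k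
    proof -
      have "real j \<le> real (n * 2 ^ k)" using that by (simp add: divide_le_eq)
      then show ?thesis by (simp only: of_nat_le_iff)
    qed
    show "\<forall>\<^sub>F k in sequentially. (\<exists>j\<le>n * 2 ^ k. ?f (real j / 2 ^ k) < - x) = dips_until (real n) x ?f"
    proof (cases "dips_until (real n) x ?f")
      case True
      then obtain q where q: "q \<in> dyadics" "q \<le> real n" "?f q < - x" by (auto simp: dips_until_def)
      then obtain j k where jk: "q = real j / 2 ^ k" by (auto simp: dyadics_def)
      have "\<exists>i\<le>n * 2 ^ K. ?f (real i / 2 ^ K) < - x" if "k \<le> K" for K
        using level_refine[OF that, of j] q jk ge by metis
      then show ?thesis using True by (auto simp: eventually_sequentially)
    next
      case False
      then have "\<not> (\<exists>j\<le>n * 2 ^ k. ?f (real j / 2 ^ k) < - x)" for k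
        using le[of _ k] unfolding dips_until_def by (meson dyadics_I)
      then show ?thesis using False by auto
    qed
  qed
next
  fix k
  show "Measurable.pred dyadic_paths (\<lambda>f. \<exists>j\<le>n * 2 ^ k. f (real j / 2 ^ k) < - x)"
    by (intro pred_intros_countable pred_intros_logic) measurable
qed auto

text \<open>A further drop by more than \<open>y\<close> after passing below \<open>- x\<close>
  leads below \<open>- (x + y)\<close>. An overshoot only helps, and with an infinite horizon no
  time is lost.\<close>

lemma pr_dips_supermult:
  "pr (dips x) * pr (dips y) \<le> pr (dips (x + y))"
proof -
  have le: "pr (\<lambda>f. \<exists>j\<le>n * 2 ^ k. f (real j / 2 ^ k) < - x) * pr (dips y) \<le> pr (dips (x + y))" for n k
  proof -
    have "pr (\<lambda>f. \<exists>j\<le>n * 2 ^ k. f (real j / 2 ^ k) < - x) * pr (dips y)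
      = pr (\<lambda>f. \<exists>j\<in>{..n * 2 ^ k}. first_dip k x j f \<and> dips y (shift (real j / 2 ^ k) f))"
      by (intro pr_first_dip_restart[symmetric] pred_dips pred_dips_shift dyadics_I)
    also have "\<dots> \<le> pr (dips (x + y))"
    proof (rule pr_mono[OF pred_dips])
      fix \<omega> let ?f = "dyadic_path Z \<omega>"
      assume "\<exists>j\<in>{..n * 2 ^ k}. first_dip k x j ?f \<and> dips y (shift (real j / 2 ^ k) ?f)"
      then obtain j q where j: "?f (real j / 2 ^ k) < - x" and q: "q \<in> dyadics" 
        "shift (real j / 2 ^ k) ?f q < - y" by (auto simp: first_dip_def dips_def)
      then have "?f (real j / 2 ^ k + q) < - (x + y)" by simp
      then show "dips (x + y) ?f" unfolding dips_def using q(1) dyadics_add dyadics_I by blast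
    qed
    finally show ?thesis .
  qed
  have "pr (dips_until (real n) x) * pr (dips y) \<le> pr (dips (x + y))" for n
    by (rule LIMSEQ_le_const2[OF tendsto_mult_right[OF pr_grid_dips_tendsto]]) (use le in auto)
  then show ?thesis
    by (intro LIMSEQ_le_const2[OF tendsto_mult_right[OF pr_dips_until_tendsto]]) auto
qed

text \<open>Without negative jumps the process crosses a level downwards without overshoot; on a fine grid
  the overshoot is at most \<open>e\<close>.\<close>

lemma pr_dips_until_submult_aux:
  assumes "0 \<le> x" "0 \<le> y" "0 < e"
  shows "pr (dips_until (real n) (x + y + e)) \<le> pr (dips_until (real n) x) * pr (dips_until (real n) y)"
proof -
  \<comment> \<open>The exceptional event that some drop over one grid step exceeds
    \<open>e\<close>; by \<open>small_drops\<close> its probability vanishes as the mesh is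
    refined.\<close>
  define W where "W = (\<lambda>k f. \<not> (\<forall>j<n * 2 ^ k. f (real j / 2 ^ k) - e \<le> f (real (Suc j) / 2 ^ k)))"
  have Wm: "Measurable.pred dyadic_paths (W k)" for k
  proof -
    have m [measurable]: "(\<lambda>f. f (real i / 2 ^ k)) \<in> borel_measurable dyadic_paths" for i
      by (rule measurable_component_singleton) simp
    have "Measurable.pred dyadic_paths (\<lambda>f. f (real j / 2 ^ k) - e \<le> f (real (Suc j) / 2 ^ k))" for j
      unfolding pred_def by (intro borel_measurable_le borel_measurable_diff borel_measurable_const m)
    then show ?thesis unfolding W_def by (intro pred_intros_countable pred_intros_logic) simp_all
  qed
  have "(\<lambda>k. pr (W k)) \<longlonglongrightarrow> pr (\<lambda>_. False)"
    using Wm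
  proof (rule pr_tendsto)
    show "AE \<omega> in M. \<forall>\<^sub>F k in sequentially. W k (dyadic_path Z \<omega>) = False"
      using small_drops[OF assms(3), of n] unfolding W_def by eventually_elim (simp del: of_nat_Suc)
  qed auto
  then have W0: "(\<lambda>k. pr (W k)) \<longlonglongrightarrow> 0" by (simp add: pr_def)
  let ?G = "\<lambda>k x. pr (\<lambda>f. \<exists>j\<le>n * 2 ^ k. f (real j / 2 ^ k) < - x)"
  have le: "?G k (x + y + e) \<le> pr (W k) + ?G k x * pr (dips_until (real n) y)" for k
  proof -
    have "?G k (x + y + e) \<le> pr (W k) + 
      pr (\<lambda>f. \<exists>j\<in>{..n * 2 ^ k}. first_dip k x j f \<and> dips_until (real n) y (shift (real j / 2 ^ k) f))"
    proof (rule pr_le_add[OF Wm])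
      show "Measurable.pred dyadic_paths
        (\<lambda>f. \<exists>j\<in>{..n * 2 ^ k}. first_dip k x j f \<and> dips_until (real n) y (shift (real j / 2 ^ k) f))"
        by (intro pred_intros_finite pred_intros_logic pred_first_dip pred_dips_shift dyadics_I) simp
      fix \<omega> let ?f = "dyadic_path Z \<omega>"
      assume w: "\<omega> \<in> space M" and "\<exists>j\<le>n * 2 ^ k. ?f (real j / 2 ^ k) < - (x + y + e)"
      then obtain i where i: "i \<le> n * 2 ^ k" "?f (real i / 2 ^ k) < - (x + y + e)" by blast
      then have "?f (real i / 2 ^ k) < - x" using assms by simp
      with i(1) have "\<exists>j\<le>i. first_dip k x j ?f" unfolding ex_first_dip_iff by blast
      then obtain j where j: "j \<le> i" "first_dip k x j ?f" by blast
      have "\<exists>j\<in>{..n * 2 ^ k}. first_dip k x j ?f \<and> dips_until (real n) y (shift (real j / 2 ^ k) ?f)"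
        if nW: "\<not> W k ?f"
      proof -
        \<comment> \<open>The path starts at 0, which is not below \<open>- x\<close>; hence the
          passage has a preceding grid point, where the path is still at least
          \<open>- x\<close>.\<close>
        have "j \<noteq> 0" using j(2) assms(1) w by (intro notI) (simp add: first_dip_def Z_0)
        then obtain l where l: "j = Suc l" by (cases j) auto
        have "- x \<le> ?f (real l / 2 ^ k)" using j(2) l by (auto simp: first_dip_def)
        also have "\<dots> \<le> ?f (real j / 2 ^ k) + e"
          using nW i(1) j(1) l unfolding W_def by (auto simp: le_diff_eq diff_le_eq)
        finally have fj: "- x - e \<le> ?f (real j / 2 ^ k)" by simp
        have q: "real (i - j) / 2 ^ k = real i / 2 ^ k - real j / 2 ^ k"
          using j(1) by (simp add: of_nat_diff diff_divide_distrib)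
        have "shift (real j / 2 ^ k) ?f (real (i - j) / 2 ^ k) < - y"
          using fj i(2) by (simp add: q[symmetric]) (simp add: q)
        \<comment> \<open>The second passage has only the remaining time at its disposal; granting
          it the whole horizon \<open>n\<close> again keeps the inequality in the right
          direction.\<close>
        moreover have "real (i - j) / 2 ^ k \<le> real n"
        proof -
          have "real (i - j) \<le> real (n * 2 ^ k)" using i(1) by (simp only: of_nat_le_iff)
          then show ?thesis by (simp add: divide_le_eq)
        qed
        ultimately have "dips_until (real n) y (shift (real j / 2 ^ k) ?f)"
          unfolding dips_until_def by blast
        then show ?thesis using j i(1) by auto
      qed
      then show "W k ?f \<or> (\<exists>j\<in>{..n * 2 ^ k}. first_dip k x j ?f \<and> dips_until (real n) y (shift (real j / 2 ^ k) ?f))"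
        by blast
    qed
    also have "pr (\<lambda>f. \<exists>j\<in>{..n * 2 ^ k}. first_dip k x j f \<and> dips_until (real n) y (shift (real j / 2 ^ k) f))
      = ?G k x * pr (dips_until (real n) y)"
      by (intro pr_first_dip_restart pred_dips_until pred_dips_shift dyadics_I)
    finally show ?thesis .
  qed
  have "pr (dips_until (real n) (x + y + e)) \<le> 0 + pr (dips_until (real n) x) * pr (dips_until (real n) y)"
    by (rule LIMSEQ_le[OF pr_grid_dips_tendsto tendsto_add[OF W0 tendsto_mult_right[OF pr_grid_dips_tendsto]]])
      (use le in auto)
  then show ?thesis by simp
qed

text \<open>Passage below a level is strict, so a path below \<open>- (x + y)\<close> is also below
  \<open>- (x + y + e)\<close> for small \<open>e\<close>; the allowance for overshoot can be sent
  to 0.\<close>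

lemma pr_dips_until_submult:
  assumes "0 \<le> x" "0 \<le> y"
  shows "pr (dips_until (real n) (x + y)) \<le> pr (dips_until (real n) x) * pr (dips_until (real n) y)"
proof (rule LIMSEQ_le_const2)
  show "(\<lambda>k. pr (dips_until (real n) (x + y + 1 / real (Suc k)))) \<longlonglongrightarrow> pr (dips_until (real n) (x + y))"
  proof (rule pr_tendsto)
    show "AE \<omega> in M. \<forall>\<^sub>F k in sequentially. dips_until (real n) (x + y + 1 / real (Suc k)) (dyadic_path Z \<omega>)
       = dips_until (real n) (x + y) (dyadic_path Z \<omega>)"
    proof (rule AE_I2)
      fix \<omega> let ?f = "dyadic_path Z \<omega>"
      show "\<forall>\<^sub>F k in sequentially. dips_until (real n) (x + y + 1 / real (Suc k)) ?f = dips_until (real n) (x + y) ?f"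
      proof (cases "dips_until (real n) (x + y) ?f")
        case True
        then obtain q where q: "q \<in> dyadics" "q \<le> real n" "?f q < - (x + y)" by (auto simp: dips_until_def)
        have "(\<lambda>k. - (x + y + 1 / real (Suc k))) \<longlonglongrightarrow> - (x + y)" by real_asymp
        then have "\<forall>\<^sub>F k in sequentially. ?f q < - (x + y + 1 / real (Suc k))"
          using q(3) by (rule order_tendstoD)
        then show ?thesis by eventually_elim (use q True in \<open>auto simp: dips_until_def\<close>)
      next
        case False
        then have "\<not> dips_until (real n) (x + y + 1 / real (Suc k)) ?f" for k
          using dips_until_mono[of "real n" "x + y + 1 / real (Suc k)" ?f "x + y"] by auto
        then show ?thesis using False by auto
      qed
    qed
  qed auto
  show "\<exists>N. \<forall>k\<ge>N. pr (dips_until (real n) (x + y + 1 / real (Suc k)))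
      \<le> pr (dips_until (real n) x) * pr (dips_until (real n) y)"
    using assms by (intro exI allI impI pr_dips_until_submult_aux) auto
qed

section \<open>Comparing survival over finite and infinite horizons\<close>

lemma pr_dips_power_le:
  "pr (dips x) ^ Suc n \<le> pr (dips (real (Suc n) * x))"
proof (induction n)
  case (Suc n)
  have "pr (dips x) ^ Suc (Suc n) \<le> pr (dips x) * pr (dips (real (Suc n) * x))"
    using Suc.IH by (simp add: mult_left_mono)
  also have "\<dots> \<le> pr (dips (x + real (Suc n) * x))" by (rule pr_dips_supermult)
  also have "x + real (Suc n) * x = real (Suc (Suc n)) * x" by (simp add: algebra_simps)
  finally show ?case .
qed simp

lemma pr_dips_until_power_ge:
  assumes "0 \<le> x"
  shows "pr (dips_until (real m) (real (Suc n) * x)) \<le> pr (dips_until (real m) x) ^ Suc n"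
proof (induction n)
  case (Suc n)
  have "real (Suc (Suc n)) * x = x + real (Suc n) * x" by (simp add: algebra_simps)
  then have "pr (dips_until (real m) (real (Suc (Suc n)) * x))
      \<le> pr (dips_until (real m) x) * pr (dips_until (real m) (real (Suc n) * x))"
    using assms pr_dips_until_submult[of x "real (Suc n) * x" m] by simp
  also have "\<dots> \<le> pr (dips_until (real m) x) ^ Suc (Suc n)"
    using Suc.IH by (simp add: mult_left_mono)
  finally show ?case .
qed simp

text \<open>If passage below \<open>- x\<close> were certain, supermultiplicativity would make
  passage below every multiple certain, although almost every path is bounded below.\<close>

lemma pr_dips_less_1:
  assumes "0 < x" shows "pr (dips x) < 1"
proof (rule ccontr)
  assume "\<not> pr (dips x) < 1"
  then have 1: "pr (dips x) = 1" by (metis pr_le_1 less_eq_real_def)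
  have "(\<lambda>n. pr (dips (real (Suc n) * x))) \<longlonglongrightarrow> pr (\<lambda>_. False)"
  proof (rule pr_tendsto)
    show "AE \<omega> in M. \<forall>\<^sub>F n in sequentially. dips (real (Suc n) * x) (dyadic_path Z \<omega>) = False"
      using bounded_below
    proof eventually_elim
      case (elim \<omega>)
      then obtain c where c: "\<And>q. q \<in> dyadics \<Longrightarrow> c \<le> Z q \<omega>" by blast
      have "filterlim (\<lambda>n. real (Suc n) * x) at_top sequentially" using assms by real_asymp
      then have "\<forall>\<^sub>F n in sequentially. - c \<le> real (Suc n) * x"
        by (simp add: filterlim_at_top)
      then show ?case by eventually_elim (use c in \<open>force simp: dips_def\<close>)
    qed
  qed auto
  moreover have "pr (dips (real (Suc n) * x)) = 1" for n
  proof -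
    have "1 \<le> pr (dips (real (Suc n) * x))" using pr_dips_power_le[of x n] by (simp only: 1 power_one)
    then show ?thesis by (metis pr_le_1 antisym)
  qed
  ultimately have "(\<lambda>n::nat. 1 :: real) \<longlonglongrightarrow> 0" by (simp add: pr_def)
  then show False by (simp add: LIMSEQ_const_iff)
qed

lemma stays_ge_not_dips: "0 < y \<Longrightarrow> 1 - pr (dips (y / 2)) \<le> pr (stays y)"
proof -
  assume y: "0 < y"
  have "pr (\<lambda>f. \<not> stays y f) \<le> pr (dips (y / 2))"
    by (rule pr_mono[OF pred_dips]) (unfold dips_def, rule not_stays_imp_below[OF _ y])
  then show ?thesis by (simp add: pr_not)
qed

lemma stays_pos: "0 < y \<Longrightarrow> 0 < pr (stays y)"
  using stays_ge_not_dips[of y] pr_dips_less_1[of "y / 2"] by simp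

lemma stays_until_le_not_dips: "pr (stays_until t y) \<le> 1 - pr (dips_until t y)"
proof -
  have "pr (stays_until t y) \<le> pr (\<lambda>f. \<not> dips_until t y f)"
  proof (rule pr_mono)
    fix \<omega> assume "stays_until t y (dyadic_path Z \<omega>)"
    then show "\<not> dips_until t y (dyadic_path Z \<omega>)"
      unfolding dips_until_def by (metis stays_untilD add.commute less_add_same_cancel2 minus_less_iff neg_less_iff_less not_less_iff_gr_or_eq add_less_cancel_left add.right_inverse less_asym)
  qed auto
  then show ?thesis by (simp add: pr_not)
qed

text \<open>Both probabilities are compared with 1/n for n of order 1/y: the product inequality for
  the finite horizon bounds the left side above by a multiple of 1/n, the one for the infinite
  horizon bounds \<open>pr (stays y)\<close> below by another.\<close>

lemma stays_until_le_stays: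
  "\<exists>(n::nat) K. 0 < K \<and> (\<forall>y. 0 < y \<and> y < 1 \<longrightarrow> pr (stays_until (real n) y) \<le> K * pr (stays y))"
proof (cases "pr (dips 1) = 0")
  \<comment> \<open>Here supermultiplicativity excludes passage below any negative level, so staying
    positive has probability 1 and the trivial constants suffice.\<close>
  case True
  have "pr (stays y) = 1" if y: "0 < y" for y
  proof -
    obtain n where n: "1 / real (Suc n) < y / 2" by (rule nat_approx_posE[of "y/2"]) (use y in auto)
    have "pr (dips (1 / real (Suc n))) ^ Suc n \<le> pr (dips (real (Suc n) * (1 / real (Suc n))))"
      by (rule pr_dips_power_le)
    also have "real (Suc n) * (1 / real (Suc n)) = 1" by simp
    finally have "pr (dips (1 / real (Suc n))) ^ Suc n \<le> 0" using True by (simp only:)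
    then have "pr (dips (1 / real (Suc n))) = 0"
      by (metis pr_nonneg antisym power_eq_0_iff zero_le_power)
    moreover have "pr (dips (y / 2)) \<le> pr (dips (1 / real (Suc n)))"
      by (rule pr_mono) (use n dips_mono in \<open>auto simp: less_imp_le\<close>)
    ultimately have "1 \<le> pr (stays y)" using stays_ge_not_dips[OF y] by simp
    then show ?thesis by (metis pr_le_1 antisym)
  qed
  then show ?thesis by (intro exI[of _ 0] exI[of _ 1]) auto
next
  case False
  define a where "a = pr (dips 1)"
  have a: "0 < a" "a < 1" using False pr_dips_less_1[of 1] pr_nonneg[of "dips 1"]
    by (auto simp: a_def less_eq_real_def)
  have "\<forall>\<^sub>F n in sequentially. 0 < pr (dips_until (real n) 1)"
    using pr_dips_until_tendsto a(1) unfolding a_def by (rule order_tendstoD)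
  then obtain m where m: "0 < pr (dips_until (real m) 1)"
    using eventually_happens' by force
  \<comment> \<open>With u = 1 - P(passage below -1/n), the power bound gives P(passage below -1)
    \<le> (1 - u)^n \<le> exp (- n u), hence n u is at most minus the logarithm. The added 1 makes
    \<open>L\<close> strictly positive.\<close>
  define L where "L = - ln (pr (dips_until (real m) 1)) + 1"
  have "ln (pr (dips_until (real m) 1)) \<le> 0" using m ln_le_zero_iff pr_le_1 by blast
  then have L: "0 < L" by (simp add: L_def)
  have up: "1 - pr (dips_until (real m) (1 / real (Suc n))) \<le> L / real (Suc n)" for n
  proof -
    define u where "u = 1 - pr (dips_until (real m) (1 / real (Suc n)))"
    have "pr (dips_until (real m) (real (Suc n) * (1 / real (Suc n)))) \<le> (1 - u) ^ Suc n"
      unfolding u_def using pr_dips_until_power_ge[of "1 / real (Suc n)" m n] by simp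
    also have "real (Suc n) * (1 / real (Suc n)) = 1" by simp
    also have "(1 - u) ^ Suc n \<le> exp (- u) ^ Suc n"
      using exp_ge_add_one_self[of "- u"] by (intro power_mono) (simp_all add: u_def)
    also have "\<dots> = exp (- (real (Suc n) * u))" by (simp only: exp_of_nat_mult[symmetric] mult_minus_right)
    finally have "ln (pr (dips_until (real m) 1)) \<le> - (real (Suc n) * u)"
      using m by (metis ln_exp ln_le_cancel_iff exp_gt_zero)
    then have "real (Suc n) * u \<le> L" by (simp add: L_def)
    then show ?thesis unfolding u_def[symmetric] by (simp add: pos_le_divide_eq mult.commute)
  qed
  have low: "(1 - a) / real (Suc n) \<le> 1 - pr (dips (1 / real (Suc n)))" for n
  proof -
    define v where "v = 1 - pr (dips (1 / real (Suc n)))"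
    \<comment> \<open>Bernoulli's inequality turns the power bound into a lower bound of order
      1/n.\<close>
    have "1 + real (Suc n) * (- v) \<le> (1 + - v) ^ Suc n"
      by (rule Bernoulli_inequality) (simp add: v_def)
    also have "\<dots> \<le> a"
      using pr_dips_power_le[of "1 / real (Suc n)" n] by (simp add: v_def a_def)
    finally have "1 - a \<le> v * real (Suc n)" by (simp add: algebra_simps)
    then show ?thesis unfolding v_def[symmetric] by (simp add: pos_divide_le_eq)
  qed
  \<comment> \<open>For n \<ge> 1 the quotient of L/n by (1 - a)/(2n + 2) is at most 4L/(1 -
    a).\<close>
  define K where "K = 4 * L / (1 - a)"
  have "pr (stays_until (real m) y) \<le> K * pr (stays y)" if y: "0 < y" "y < 1" for y
  proof -
    define n where "n = nat \<lfloor>1 / y\<rfloor>"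
    have n1: "real n \<le> 1 / y" "1 / y < real n + 1" using y by (auto simp: n_def)
    have "1 < 1 / y" using y by simp
    then have "n \<noteq> 0" using n1 by (intro notI) simp
    then obtain l where l: "n = Suc l" by (cases n) auto
    have yl: "y \<le> 1 / real (Suc l)" using n1(1) y by (simp add: l field_simps)
    \<comment> \<open>The index 2n + 2 exceeds 2/y: \<open>stays_ge_not_dips\<close> works at the
      halved level \<open>y / 2\<close>.\<close>
    have yg: "1 / real (Suc (2 * n + 1)) \<le> y / 2" using n1(2) y by (simp add: field_simps)
    have "pr (stays_until (real m) y) \<le> 1 - pr (dips_until (real m) y)" by (rule stays_until_le_not_dips)
    also have "\<dots> \<le> 1 - pr (dips_until (real m) (1 / real (Suc l)))"
      using pr_mono[of "dips_until (real m) y" "dips_until (real m) (1 / real (Suc l))"] dips_until_mono[OF _ yl] by auto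
    also have "\<dots> \<le> L / real n" unfolding l by (rule up)
    also have "\<dots> \<le> K * ((1 - a) / real (Suc (2 * n + 1)))"
    proof -
      have "K * ((1 - a) / real (Suc (2 * n + 1))) = 4 * L / (2 * real n + 2)"
        using a by (simp add: K_def)
      moreover have "L / real n \<le> 4 * L / (2 * real n + 2)"
        using L l by (simp add: field_simps)
      ultimately show ?thesis by simp
    qed
    also have "\<dots> \<le> K * pr (stays y)"
    proof (rule mult_left_mono)
      have "(1 - a) / real (Suc (2 * n + 1)) \<le> 1 - pr (dips (1 / real (Suc (2 * n + 1))))" by (rule low)
      also have "\<dots> \<le> 1 - pr (dips (y / 2))"
        using pr_mono[of "dips (1 / real (Suc (2 * n + 1)))" "dips (y / 2)"] dips_mono[OF _ yg] by auto
      also have "\<dots> \<le> pr (stays y)" using y by (intro stays_ge_not_dips)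
      finally show "(1 - a) / real (Suc (2 * n + 1)) \<le> pr (stays y)" .
      show "0 \<le> K" using a L by (simp add: K_def)
    qed
    finally show ?thesis .
  qed
  moreover have "0 < K" using a L by (simp add: K_def)
  ultimately show ?thesis by blast
qed

end

section \<open>Exponential moments of the conditioned walk\<close>

definition escapes :: "real \<Rightarrow> real \<Rightarrow> (real \<Rightarrow> real) \<Rightarrow> bool" where
  "escapes t c f \<longleftrightarrow> (\<forall>q\<in>dyadics. t \<le> q \<longrightarrow> c \<le> f q)"

lemma pred_not_escapes: "Measurable.pred dyadic_paths (\<lambda>f. \<not> escapes t c f)"
proof -
  have "Measurable.pred dyadic_paths (\<lambda>f. \<exists>q\<in>dyadics. t \<le> q \<and> f q < c)"
    by (intro pred_Bex_dyadics) measurable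
  then show ?thesis unfolding escapes_def by (simp add: not_le)
qed

lemma pred_escapes [measurable]: "Measurable.pred dyadic_paths (escapes t c)"
  using pred_intros_logic(2)[OF pred_not_escapes, of t c] by simp

lemma pred_shift:
  assumes t: "t \<in> dyadics"
  shows "shift t \<in> dyadic_paths \<rightarrow>\<^sub>M dyadic_paths"
  unfolding shift_def[abs_def]
proof (rule measurable_restrict)
  fix s assume s: "s \<in> dyadics"
  show "(\<lambda>f. f (t + s) - f t) \<in> borel_measurable dyadic_paths"
    using t s by (intro borel_measurable_diff measurable_component_singleton dyadics_add)
qed

lemma escapes_mono: "escapes s c f \<Longrightarrow> s \<le> t \<Longrightarrow> d \<le> c \<Longrightarrow> escapes t d f"
  unfolding escapes_def by (meson order_trans)

lemma escapes_shift:
  assumes "t \<in> dyadics" "0 \<le> s"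
  shows "escapes s (c - f t) (shift t f) \<longleftrightarrow> escapes (t + s) c f"
proof
  assume L: "escapes s (c - f t) (shift t f)"
  show "escapes (t + s) c f"
    unfolding escapes_def
  proof (intro ballI impI)
    fix q assume q: "q \<in> dyadics" "t + s \<le> q"
    then have d: "q - t \<in> dyadics" using assms by (intro dyadics_diff) auto
    then have "c - f t \<le> shift t f (q - t)" using L q by (auto simp: escapes_def)
    then show "c \<le> f q" using d by simp
  qed
next
  assume "escapes (t + s) c f"
  then show "escapes s (c - f t) (shift t f)"
    using assms dyadics_add by (auto simp: escapes_def)
qed

text \<open>Only the level of the integer part of \<open>z\<close> contributes. Cutting into unit
  levels reduces the expected integral to occupation times, weighted by a summable sequence.\<close>

lemma exp_le_suminf_levels:
  assumes "0 < z"
  shows "ennreal (exp (- z)) \<le> (\<Sum>a. ennreal (exp (- real a)) * of_bool (real a \<le> z \<and> z < real a + 1))"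
proof -
  define b where "b = nat \<lfloor>z\<rfloor>"
  have b: "real b \<le> z" "z < real b + 1" using assms by (auto simp: b_def)
  have "ennreal (exp (- z)) \<le> ennreal (exp (- real b)) * of_bool (real b \<le> z \<and> z < real b + 1)"
    using b by (simp add: ennreal_leI)
  also have "\<dots> = (\<Sum>a\<in>{b}. ennreal (exp (- real a)) * of_bool (real a \<le> z \<and> z < real a + 1))" by simp
  also have "\<dots> \<le> (\<Sum>a. ennreal (exp (- real a)) * of_bool (real a \<le> z \<and> z < real a + 1))"
    by (rule sum_le_suminf) auto
  finally show ?thesis .
qed

text \<open>The visits to the level that are the last ones, up to a delay \<open>T\<close>, all occur within
  time \<open>T\<close> of the first of them.\<close>

lemma last_visits_le:
  fixes T k :: nat
  defines "d \<equiv> 1 / 2 ^ k :: real"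
  assumes "finite I"
  shows "(\<Sum>j\<in>I. d * of_bool (c \<le> x + f (real j / 2 ^ k) \<and> x + f (real j / 2 ^ k) < c + 1
      \<and> escapes (real j / 2 ^ k + real T) (c + 1) (\<lambda>q. x + f q))) \<le> real T"
proof -
  define S where "S = {j\<in>I. c \<le> x + f (real j / 2 ^ k) \<and> x + f (real j / 2 ^ k) < c + 1
      \<and> escapes (real j / 2 ^ k + real T) (c + 1) (\<lambda>q. x + f q)}"
  have "finite S" using assms by (simp add: S_def)
  have "card S \<le> T * 2 ^ k"
  proof (cases "S = {}")
    case False
    define i where "i = Min S"
    have i: "i \<in> S" unfolding i_def using \<open>finite S\<close> False by (rule Min_in)
    have "S \<subseteq> {i..<i + T * 2 ^ k}"
    proof
      fix j assume j: "j \<in> S"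
      then have "i \<le> j" unfolding i_def using \<open>finite S\<close> by simp
      moreover have "j < i + T * 2 ^ k"
      proof (rule ccontr)
        assume "\<not> j < i + T * 2 ^ k"
        then have "real (i + T * 2 ^ k) \<le> real j" by (simp only: of_nat_le_iff not_less)
        then have "real (i + T * 2 ^ k) / 2 ^ k \<le> real j / 2 ^ k" by (intro divide_right_mono) simp_all
        then have "real i / 2 ^ k + real T \<le> real j / 2 ^ k" by (simp add: add_divide_distrib)
        then have "c + 1 \<le> x + f (real j / 2 ^ k)"
          using i by (auto simp: S_def escapes_def)
        then show False using j by (auto simp: S_def)
      qed
      ultimately show "j \<in> {i..<i + T * 2 ^ k}" by simp
    qed
    then have "card S \<le> card {i..<i + T * 2 ^ k}" by (intro card_mono) auto
    then show ?thesis by simp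
  qed simp
  then have "real (card S) \<le> real (T * 2 ^ k)" by (simp only: of_nat_le_iff)
  then have "d * real (card S) \<le> real T" by (simp add: d_def divide_le_eq)
  also have "real (card S) = (\<Sum>j\<in>I. of_bool (c \<le> x + f (real j / 2 ^ k) \<and> x + f (real j / 2 ^ k) < c + 1
      \<and> escapes (real j / 2 ^ k + real T) (c + 1) (\<lambda>q. x + f q)))"
    unfolding S_def using assms by (simp add: of_bool_def sum.If_cases Int_def)
  finally show ?thesis by (simp add: sum_distrib_left)
qed

context dyadic_levy
begin

section \<open>Escape from a level, occupation and exponential moments\<close>

lemma pr_not_escapes_tendsto: "(\<lambda>n. pr (\<lambda>f. \<not> escapes (real n) c f)) \<longlonglongrightarrow> 0"
proof -
  have "(\<lambda>n. pr (\<lambda>f. \<not> escapes (real n) c f)) \<longlonglongrightarrow> pr (\<lambda>_. False)"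
  proof (rule pr_tendsto)
    show "AE \<omega> in M. \<forall>\<^sub>F n in sequentially. (\<not> escapes (real n) c (dyadic_path Z \<omega>)) = False"
      using drift
    proof eventually_elim
      case (elim \<omega>)
      then obtain m :: nat where m: "\<forall>q\<in>dyadics. real m \<le> q \<longrightarrow> c \<le> Z q \<omega>" by blast
      have "escapes (real n) c (dyadic_path Z \<omega>)" if "m \<le> n" for n
        using m that unfolding escapes_def by (auto intro: order_trans)
      then show ?case by (auto simp: eventually_sequentially)
    qed
  qed (auto simp: pred_not_escapes)
  then show ?thesis by (simp add: pr_def)
qed

text \<open>From y \<ge> 1 the failure to escape need only be rare compared with h(1). From y < 1 it
  must be rare compared with h(y): surviving for time \<open>n\<close> costs at most K h(y), and
  independently of this the increments after \<open>n\<close> fail to rise by 1 within the delay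
  \<open>m\<close> with small probability.\<close>

lemma stays_and_escapes:
  "\<exists>T::nat. \<forall>(a::nat) y. 0 < y \<and> real a \<le> y \<and> y < real a + 1 \<longrightarrow>
     pr (stays y) \<le> 2 * pr (\<lambda>f. stays y f \<and> escapes (real T) (real a + 1 - y) f)"
proof -
  obtain n K where K: "0 < K" and
    nK: "\<And>y. 0 < y \<Longrightarrow> y < 1 \<Longrightarrow> pr (stays_until (real n) y) \<le> K * pr (stays y)"
    using stays_until_le_stays by blast
  \<comment> \<open>The bound 1/(2K) serves starting points below 1, and half of
    \<open>pr (stays 1)\<close> serves the levels \<open>a\<close> \<ge> 1.\<close>
  define e where "e = min (1 / (2 * K)) (pr (stays 1) / 2)"
  have "0 < e" using K stays_pos[of 1] by (simp add: e_def)
  with pr_not_escapes_tendsto[of 1] have "\<forall>\<^sub>F m in sequentially. pr (\<lambda>f. \<not> escapes (real m) 1 f) < e"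
    by (rule order_tendstoD)
  then obtain m where m: "pr (\<lambda>f. \<not> escapes (real m) 1 f) < e"
    using eventually_happens' by force
  define T where "T = n + m"
  have "pr (stays y) \<le> 2 * pr (\<lambda>f. stays y f \<and> escapes (real T) (real a + 1 - y) f)"
    if y: "0 < y" "real a \<le> y" "y < real a + 1" for a :: nat and y
  proof -
    have "pr (stays y) \<le> pr (\<lambda>f. stays y f \<and> escapes (real T) (real a + 1 - y) f)
        + pr (\<lambda>f. stays y f \<and> \<not> escapes (real T) (real a + 1 - y) f)"
      by (intro pr_le_add pred_intros_logic pred_stays pred_escapes) blast
    moreover have "pr (\<lambda>f. stays y f \<and> \<not> escapes (real T) (real a + 1 - y) f) \<le> pr (stays y) / 2"
    proof (cases "a = 0")
      case True
      have "pr (\<lambda>f. stays y f \<and> \<not> escapes (real T) (real a + 1 - y) f)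
         \<le> pr (\<lambda>f. stays_until (real n) y f \<and> \<not> escapes (real m) 1 (shift (real n) f))"
      proof (rule pr_mono)
        show "Measurable.pred dyadic_paths (\<lambda>f. stays_until (real n) y f \<and> \<not> escapes (real m) 1 (shift (real n) f))"
          by (intro pred_intros_logic pred_stays_until
              measurable_compose[OF pred_shift pred_escapes] dyadics_of_nat)
        fix \<omega> let ?f = "dyadic_path Z \<omega>"
        assume *: "stays y ?f \<and> \<not> escapes (real T) (real a + 1 - y) ?f"
        \<comment> \<open>As the path is still positive at time \<open>n\<close>, a rise by 1 from
          there already reaches the top of the lowest level.\<close>
        have "0 < y + ?f (real n)" using * by (intro staysD) auto
        then have "\<not> escapes (real m) 1 (shift (real n) ?f)"
          using * escapes_shift[of "real n" "real m" "1 - y" ?f] 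
            escapes_mono[of "real m" 1 "shift (real n) ?f" "real m" "1 - y - ?f (real n)"] True
          by (auto simp: T_def)
        then show "stays_until (real n) y ?f \<and> \<not> escapes (real m) 1 (shift (real n) ?f)"
          using * stays_imp_stays_until by blast
      qed
      also have "\<dots> = pr (stays_until (real n) y) * pr (\<lambda>f. \<not> escapes (real m) 1 f)"
        by (intro pr_indep_shift stays_until_cong pred_intros_logic pred_stays_until pred_escapes
              measurable_compose[OF pred_shift pred_escapes] dyadics_of_nat) auto
      also have "\<dots> \<le> (K * pr (stays y)) * (1 / (2 * K))"
        using m nK[of y] y True K by (intro mult_mono) (auto simp: e_def)
      also have "\<dots> = pr (stays y) / 2" using K by simp
      finally show ?thesis .
    next
      case False
      then have y1: "1 \<le> y" using y by linarith
      have "pr (\<lambda>f. stays y f \<and> \<not> escapes (real T) (real a + 1 - y) f)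
         \<le> pr (\<lambda>f. \<not> escapes (real m) 1 f)"
        by (rule pr_mono[OF pred_not_escapes])
          (use y escapes_mono[of "real m" 1 _ "real T" "real a + 1 - y"] in \<open>auto simp: T_def\<close>)
      also have "\<dots> \<le> pr (stays 1) / 2" using m by (simp add: e_def)
      also have "pr (stays 1) \<le> pr (stays y)" by (rule pr_mono[OF pred_stays]) (rule stays_mono[OF _ y1])
      finally show ?thesis by simp
    qed
    ultimately show ?thesis by simp
  qed
  then show ?thesis by blast
qed

text \<open>At a visit to a level, requiring in addition that the level be left for good after delay
  \<open>T\<close> costs a factor 2, by the Markov property. Visits with this extra property are
  bounded in number along every path, and the level weights are summable.\<close>

lemma occupation_bound:
  "\<exists>C::real. 0 < C \<and> (\<forall>x k m. 0 < x \<longrightarrow>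
     (\<Sum>j=1..m. EE (\<lambda>f. ennreal (exp (- (x + f (real j / 2 ^ k))) / 2 ^ k) * of_bool (stays x f)))
       \<le> ennreal C * ennreal (pr (stays x)))"
proof -
  obtain T :: nat where T: "\<And>a y. 0 < y \<Longrightarrow> real a \<le> y \<Longrightarrow> y < real a + 1 \<Longrightarrow>
     pr (stays y) \<le> 2 * pr (\<lambda>f. stays y f \<and> escapes (real T) (real a + 1 - y) f)"
    using stays_and_escapes by blast
  have comp [measurable]: "(\<lambda>f. f q) \<in> borel_measurable dyadic_paths" if "q \<in> dyadics" for q
    using that by (rule measurable_component_singleton)
  define lev where "lev = (\<lambda>(a::nat) z. real a \<le> z \<and> z < real a + 1)"
  have levm: "Measurable.pred dyadic_paths (\<lambda>f. lev a (x + f q))" if "q \<in> dyadics" for a x q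
    using comp[OF that] unfolding lev_def by measurable
  define S where "S = (\<Sum>a. exp (- real a))"
  have sm: "summable (\<lambda>a. exp (- real a))"
  proof -
    have "summable (\<lambda>a. exp (- 1 :: real) ^ a)" by (rule summable_geometric) simp
    then show ?thesis by (simp add: exp_of_nat_mult[symmetric])
  qed
  have S: "0 < S" unfolding S_def by (rule suminf_pos[OF sm]) simp
  \<comment> \<open>2T bounds the time spent in one level and \<open>S\<close> sums the weights of
    the levels; the added 1 keeps \<open>C\<close> positive if \<open>T\<close> is 0.\<close>
  define C where "C = 2 * real T * S + 1"
  have "(\<Sum>j=1..m. EE (\<lambda>f. ennreal (exp (- (x + f (real j / 2 ^ k))) / 2 ^ k) * of_bool (stays x f)))
       \<le> ennreal C * ennreal (pr (stays x))" if x: "0 < x" for x k m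
  proof -
    define d :: real where "d = 1 / 2 ^ k"
    have d0: "0 \<le> d" by (simp add: d_def)
    define t where "t = (\<lambda>j::nat. real j / 2 ^ k)"
    have t: "t j \<in> dyadics" for j by (simp add: t_def)
    define G where "G = (\<lambda>a j f. ennreal d * of_bool (stays x f \<and> lev a (x + f (t j))))"
    have Gm: "G a j \<in> borel_measurable dyadic_paths" for a j
      unfolding G_def by (intro borel_measurable_times_ennreal borel_measurable_const 
        borel_measurable_of_bool pred_intros_logic pred_stays levm t)
    have level: "(\<Sum>j=1..m. EE (G a j)) \<le> ennreal (2 * real T) * ennreal (pr (stays x))" for a
    proof -
      \<comment> \<open>The visits of \<open>G\<close> that are followed by escape after delay
        \<open>T\<close>; the weight is doubled to make up for the probability lost.\<close>
      define G' where "G' = (\<lambda>j f. ennreal (2 * d) * of_bool (stays x f \<and> lev a (x + f (t j)) 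
          \<and> escapes (t j + real T) (real a + 1 - x) f))"
      have G'm: "G' j \<in> borel_measurable dyadic_paths" for j
        unfolding G'_def by (intro borel_measurable_times_ennreal borel_measurable_const 
          borel_measurable_of_bool pred_intros_logic pred_stays levm t pred_escapes)
      have "EE (G a j) \<le> EE (G' j)" for j
      proof -
        \<comment> \<open>What the past up to the visit decides. On it the present position is
          positive and lies in level \<open>a\<close>, which are the conditions for the escape
          estimate.\<close>
        define c :: "(real \<Rightarrow> real) \<Rightarrow> ennreal" where
          "c = (\<lambda>f. ennreal d * of_bool (stays_until (t j) x f \<and> lev a (x + f (t j))))"
        have c_past: "c f = c g" if "\<And>q. q \<in> dyadics \<Longrightarrow> q \<le> t j \<Longrightarrow> f q = g q" for f g
          using stays_until_cong[of "t j" f g x] that t by (simp add: c_def)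
        have "EE (G a j) = EE (\<lambda>f. c f * EE (\<lambda>g. of_bool (stays (x + f (t j)) g)))"
        proof (rule restart[OF t Gm])
          show "G a j f = c f * of_bool (stays (x + f (t j)) (shift (t j) f))" for f
            unfolding G_def c_def by (subst stays_split[OF t[of j], of x f]) (auto simp: of_bool_def)
        next
          show "c f = c g" if "\<And>q. q \<in> dyadics \<Longrightarrow> q \<le> t j \<Longrightarrow> f q = g q" for f g
            by (rule c_past[OF that])
        qed (intro borel_measurable_times_ennreal borel_measurable_const borel_measurable_of_bool pred_intros_logic pred_stays pred_escapes)
        also have "\<dots> \<le> EE (\<lambda>f. c f * EE (\<lambda>g. 2 * of_bool (stays (x + f (t j)) g \<and> 
            escapes (real T) (real a + 1 - (x + f (t j))) g)))"
        proof (rule EE_mono)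
          fix \<omega> let ?f = "dyadic_path Z \<omega>" let ?y = "x + ?f (t j)"
          show "c ?f * EE (\<lambda>g. of_bool (stays ?y g)) \<le> 
             c ?f * EE (\<lambda>g. 2 * of_bool (stays ?y g \<and> escapes (real T) (real a + 1 - ?y) g))"
          proof (cases "stays_until (t j) x ?f \<and> lev a ?y")
            case True
            have "0 < ?y" using True t by (intro stays_untilD[of "t j" x ?f]) auto
            then have "pr (stays ?y) \<le> 2 * pr (\<lambda>f. stays ?y f \<and> escapes (real T) (real a + 1 - ?y) f)"
              using True by (intro T) (auto simp: lev_def)
            then have "ennreal (pr (stays ?y)) \<le> 2 * ennreal (pr (\<lambda>f. stays ?y f \<and> escapes (real T) (real a + 1 - ?y) f))"
              by (subst ennreal_numeral[symmetric]) (simp add: ennreal_mult[symmetric] del: ennreal_numeral)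
            then have "EE (\<lambda>g. of_bool (stays ?y g)) \<le> EE (\<lambda>g. 2 * of_bool (stays ?y g \<and> escapes (real T) (real a + 1 - ?y) g))"
              by (subst EE_cmult) (auto intro!: borel_measurable_of_bool simp: EE_of_bool)
            then show ?thesis by (rule mult_left_mono) simp
          next
            case False
            then have "c ?f = 0" by (simp add: c_def)
            then show ?thesis by simp
          qed
        qed
        also have "\<dots> = EE (G' j)"
        proof (rule restart[OF t G'm, symmetric])
          show "G' j f = c f * (2 * of_bool (stays (x + f (t j)) (shift (t j) f) \<and> 
            escapes (real T) (real a + 1 - (x + f (t j))) (shift (t j) f)))" for f
          proof -
            have "escapes (real T) (real a + 1 - (x + f (t j))) (shift (t j) f) = escapes (t j + real T) (real a + 1 - x) f"
              using escapes_shift[OF t[of j], of "real T" "real a + 1 - x" f] by (simp add: algebra_simps)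
            moreover have "ennreal (2 * d) = 2 * ennreal d" using d0 by (simp add: ennreal_mult)
            ultimately show ?thesis
              unfolding G'_def c_def by (subst stays_split[OF t[of j], of x f]) (auto simp: of_bool_def mult.commute)
          qed
        next
          show "c f = c g" if "\<And>q. q \<in> dyadics \<Longrightarrow> q \<le> t j \<Longrightarrow> f q = g q" for f g
            by (rule c_past[OF that])
        qed (intro borel_measurable_times_ennreal borel_measurable_const borel_measurable_of_bool pred_intros_logic pred_stays pred_escapes)
        finally show ?thesis .
      qed
      then have "(\<Sum>j=1..m. EE (G a j)) \<le> (\<Sum>j=1..m. EE (G' j))" by (intro sum_mono)
      \<comment> \<open>With the sum back inside the expectation, the escaping visits can be counted
        path by path.\<close>
      also have "\<dots> = EE (\<lambda>f. \<Sum>j=1..m. G' j f)" by (intro EE_sum[symmetric] G'm)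
      also have "\<dots> \<le> EE (\<lambda>f. ennreal (2 * real T) * of_bool (stays x f))"
      proof (rule EE_mono)
        fix \<omega> let ?f = "dyadic_path Z \<omega>"
        let ?b = "\<lambda>j. real a \<le> x + ?f (real j / 2 ^ k) \<and> x + ?f (real j / 2 ^ k) < real a + 1
          \<and> escapes (real j / 2 ^ k + real T) (real a + 1) (\<lambda>q. x + ?f q)"
        have e: "escapes s (real a + 1 - x) ?f = escapes s (real a + 1) (\<lambda>q. x + ?f q)" for s
          unfolding escapes_def by (simp add: algebra_simps)
        have "(\<Sum>j=1..m. G' j ?f) = (\<Sum>j=1..m. ennreal (2 * (d * of_bool (?b j)))) * of_bool (stays x ?f)"
          unfolding sum_distrib_right by (intro sum.cong refl) (auto simp: G'_def e lev_def t_def of_bool_def)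
        also have "(\<Sum>j=1..m. ennreal (2 * (d * of_bool (?b j)))) = ennreal (\<Sum>j=1..m. 2 * (d * of_bool (?b j)))"
          by (rule sum_ennreal) (simp add: d0)
        also have "\<dots> * of_bool (stays x ?f) \<le> ennreal (2 * real T) * of_bool (stays x ?f)"
        proof (intro mult_right_mono ennreal_leI)
          have "(\<Sum>j=1..m. 2 * (d * of_bool (?b j))) = 2 * (\<Sum>j=1..m. d * of_bool (?b j))"
            by (rule sum_distrib_left[symmetric])
          moreover have "(\<Sum>j=1..m. d * of_bool (?b j)) \<le> real T"
            unfolding d_def by (rule last_visits_le) simp
          ultimately show "(\<Sum>j=1..m. 2 * (d * of_bool (?b j))) \<le> 2 * real T" by linarith
        qed simp
        finally show "(\<Sum>j=1..m. G' j ?f) \<le> ennreal (2 * real T) * of_bool (stays x ?f)" .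
      qed
      also have "\<dots> = ennreal (2 * real T) * ennreal (pr (stays x))"
        by (subst EE_cmult) (auto intro!: borel_measurable_of_bool simp: EE_of_bool)
      finally show ?thesis .
    qed
    have "(\<Sum>j=1..m. EE (\<lambda>f. ennreal (exp (- (x + f (real j / 2 ^ k))) / 2 ^ k) * of_bool (stays x f)))
      \<le> (\<Sum>j=1..m. EE (\<lambda>f. \<Sum>a. ennreal (exp (- real a)) * G a j f))"
    proof (intro sum_mono EE_mono)
      fix j \<omega> let ?f = "dyadic_path Z \<omega>" let ?z = "x + ?f (t j)"
      show "ennreal (exp (- (x + ?f (real j / 2 ^ k))) / 2 ^ k) * of_bool (stays x ?f)
         \<le> (\<Sum>a. ennreal (exp (- real a)) * G a j ?f)"
      proof (cases "stays x ?f")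
        case True
        then have "0 < ?z" using t by (intro staysD)
        have "ennreal (exp (- ?z) / 2 ^ k) = ennreal d * ennreal (exp (- ?z))"
          by (simp add: d_def ennreal_mult[symmetric])
        also have "\<dots> \<le> ennreal d * (\<Sum>a. ennreal (exp (- real a)) * of_bool (lev a ?z))"
          unfolding lev_def by (intro mult_left_mono exp_le_suminf_levels \<open>0 < ?z\<close>) simp
        also have "\<dots> = (\<Sum>a. ennreal d * (ennreal (exp (- real a)) * of_bool (lev a ?z)))"
          by (rule ennreal_suminf_cmult[symmetric])
        also have "\<dots> = (\<Sum>a. ennreal (exp (- real a)) * G a j ?f)"
          using True by (intro suminf_cong) (simp add: G_def mult_ac)
        finally show ?thesis using True by (simp add: t_def)
      qed simp
    qed
    also have "\<dots> = (\<Sum>j=1..m. \<Sum>a. ennreal (exp (- real a)) * EE (G a j))"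
      by (intro sum.cong refl, subst EE_suminf) 
         (auto intro!: borel_measurable_times_ennreal Gm suminf_cong EE_cmult)
    also have "\<dots> = (\<Sum>a. \<Sum>j=1..m. ennreal (exp (- real a)) * EE (G a j))"
      by (rule suminf_sum[symmetric]) simp
    also have "\<dots> = (\<Sum>a. ennreal (exp (- real a)) * (\<Sum>j=1..m. EE (G a j)))"
      by (simp add: sum_distrib_left)
    also have "\<dots> \<le> (\<Sum>a. ennreal (exp (- real a)) * (ennreal (2 * real T) * ennreal (pr (stays x))))"
      by (intro suminf_le mult_left_mono level) auto
    also have "\<dots> = (\<Sum>a. ennreal (exp (- real a))) * (ennreal (2 * real T) * ennreal (pr (stays x)))"
      by (rule ennreal_suminf_multc)
    also have "(\<Sum>a. ennreal (exp (- real a))) = ennreal S"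
      unfolding S_def by (rule suminf_ennreal2[OF _ sm]) simp
    also have "ennreal S * (ennreal (2 * real T) * ennreal (pr (stays x))) = ennreal (S * (2 * real T)) * ennreal (pr (stays x))"
      using S by (simp add: ennreal_mult mult.assoc)
    also have "\<dots> \<le> ennreal C * ennreal (pr (stays x))"
      using S by (intro mult_right_mono ennreal_leI) (auto simp: C_def)
    finally show ?thesis .
  qed
  moreover have "0 < C" using S by (simp add: C_def add_nonneg_pos)
  ultimately show ?thesis by blast
qed

text \<open>Khasminskii's argument: the exponential of the total sum is expanded at each grid time, and
  the contribution of the later times is estimated by the Markov property and induction.\<close>

lemma exponential_moment_bound:
  "\<exists>l::real. 0 < l \<and> (\<forall>x k m. 0 < x \<longrightarrow>
     EE (\<lambda>f. ennreal (exp (l * (\<Sum>j=1..m. exp (- (x + f (real j / 2 ^ k))) / 2 ^ k))) * of_bool (stays x f))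
       \<le> 2 * ennreal (pr (stays x)))"
proof -
  obtain C :: real where C0: "0 < C" and C: "\<And>x k m. 0 < x \<Longrightarrow>
     (\<Sum>j=1..m. EE (\<lambda>f. ennreal (exp (- (x + f (real j / 2 ^ k))) / 2 ^ k) * of_bool (stays x f)))
       \<le> ennreal C * ennreal (pr (stays x))"
    using occupation_bound by blast
  \<comment> \<open>\<open>l \<le> 1\<close> keeps each exponent \<open>l * w\<close> at most 1,
    where the exponential is controlled linearly; \<open>4 * l * C \<le> 1\<close> lets the
    induction close with the same constant 2.\<close>
  define l where "l = min 1 (1 / (4 * C))"
  have l: "0 < l" "l \<le> 1" "4 * l * C \<le> 1"
    using C0 by (auto simp: l_def min_def field_simps)
  have "EE (\<lambda>f. ennreal (exp (l * (\<Sum>j=1..m. exp (- (x + f (real j / 2 ^ k))) / 2 ^ k))) * of_bool (stays x f))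
       \<le> 2 * ennreal (pr (stays x))" if "0 < x" for x k m
    using that
  proof (induction m arbitrary: x rule: less_induct)
    case (less m)
    define t where "t = (\<lambda>j::nat. real j / 2 ^ k)"
    have t: "t j \<in> dyadics" for j by (simp add: t_def)
    have tadd: "t i + t j = t (i + j)" for i j by (simp add: t_def add_divide_distrib)
    have tle: "t i \<le> t j" if "i \<le> j" for i j using that by (simp add: t_def divide_right_mono)
    have comp [measurable]: "(\<lambda>f. f (t i)) \<in> borel_measurable dyadic_paths" for i
      using t by (rule measurable_component_singleton)
    define w where "w = (\<lambda>(y::real) (f::real \<Rightarrow> real) j. exp (- (y + f (t j))) / 2 ^ k)"
    have wm [measurable]: "(\<lambda>f. w y f j) \<in> borel_measurable dyadic_paths" for y j
      unfolding w_def by measurable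
    define E where "E = (\<lambda>y n f. exp (l * (\<Sum>j=1..n. w y f j)))"
    have Em [measurable]: "E y n \<in> borel_measurable dyadic_paths" for y n
      unfolding E_def by measurable
    \<comment> \<open>The exponential of the contributions strictly after time index
      \<open>j\<close>; seen from there it is the same functional with \<open>m - j\<close> grid
      points, to which the induction hypothesis applies.\<close>
    define R where "R = (\<lambda>j f. exp (l * (\<Sum>i=Suc j..m. w x f i)))"
    have Rm [measurable]: "R j \<in> borel_measurable dyadic_paths" for j
      unfolding R_def by measurable
    have IH: "EE (\<lambda>f. ennreal (E y (m - j) f) * of_bool (stays y f)) \<le> 2 * ennreal (pr (stays y))"
      if "0 < y" "j \<in> {1..m}" for y j
      using less.IH[of "m - j" y] that unfolding E_def w_def t_def by auto
    \<comment> \<open>Each summand equals \<open>R (j - 1) f - R j f\<close>, and the sum telescopes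
      from the full exponential to the empty one.\<close>
    have expand: "E x m f = 1 + (\<Sum>j=1..m. (exp (l * w x f j) - 1) * R j f)" for f
    proof -
      have "(exp (l * w x f j) - 1) * R j f = R (j - 1) f - R j f" if "j \<in> {1..m}" for j
      proof -
        have "(\<Sum>i=Suc (j - 1)..m. w x f i) = w x f j + (\<Sum>i=Suc j..m. w x f i)"
          using that by (simp add: sum.atLeast_Suc_atMost)
        then show ?thesis unfolding R_def by (simp add: distrib_left exp_add left_diff_distrib)
      qed
      then have "(\<Sum>j=1..m. (exp (l * w x f j) - 1) * R j f) = (\<Sum>j=1..m. R (j - 1) f - R j f)"
        by (intro sum.cong) auto
      also have "\<dots> = (\<Sum>j<m. R j f - R (Suc j) f)"
        by (intro sum.reindex_bij_witness[of _ Suc "\<lambda>j. j - 1"]) auto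
      also have "\<dots> = R 0 f - R m f" by (rule sum_lessThan_telescope')
      finally show ?thesis by (simp add: R_def E_def)
    qed
    define F where "F = (\<lambda>j f. ennreal ((exp (l * w x f j) - 1) * R j f) * of_bool (stays x f))"
    have w0: "0 \<le> w y f j" for y f j by (simp add: w_def)
    have ew0: "0 \<le> exp (l * w y f j) - 1" for y f j using w0[of y f j] l by simp
    have Fm [measurable]: "F j \<in> borel_measurable dyadic_paths" for j
      unfolding F_def by (intro borel_measurable_times_ennreal borel_measurable_of_bool pred_stays) measurable
    define F' where "F' = (\<lambda>j f. ennreal (exp (l * w x f j) - 1) * (2 * of_bool (stays x f)))"
    have F'm [measurable]: "F' j \<in> borel_measurable dyadic_paths" for j
      unfolding F'_def by (intro borel_measurable_times_ennreal borel_measurable_of_bool pred_stays) measurable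
    have FF': "EE (F j) \<le> EE (F' j)" if j: "j \<in> {1..m}" for j
    proof -
      define c where "c = (\<lambda>f. ennreal (exp (l * w x f j) - 1) * of_bool (stays_until (t j) x f))"
      have c_past: "c f = c g" if "\<And>q. q \<in> dyadics \<Longrightarrow> q \<le> t j \<Longrightarrow> f q = g q" for f g
        using stays_until_cong[of "t j" f g x] that t by (simp add: c_def w_def)
      have "EE (F j) = EE (\<lambda>f. c f * EE (\<lambda>g. ennreal (E (x + f (t j)) (m - j) g) * of_bool (stays (x + f (t j)) g)))"
      proof (rule restart[OF t Fm])
        show "F j f = c f * (ennreal (E (x + f (t j)) (m - j) (shift (t j) f)) * of_bool (stays (x + f (t j)) (shift (t j) f)))" for f
        proof -
          have "(\<Sum>i=1..m - j. w (x + f (t j)) (shift (t j) f) i) = (\<Sum>i=Suc j..m. w x f i)"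
            using j by (intro sum.reindex_bij_witness[of _ "\<lambda>i. i - j" "\<lambda>i. i + j"])
              (auto simp: w_def t tadd add.commute)
          then have "E (x + f (t j)) (m - j) (shift (t j) f) = R j f" by (simp add: E_def R_def)
          then show ?thesis unfolding F_def c_def
            by (subst stays_split[OF t[of j], of x f]) (auto simp: of_bool_def ennreal_mult'' R_def)
        qed
      next
        show "c f = c g" if "\<And>q. q \<in> dyadics \<Longrightarrow> q \<le> t j \<Longrightarrow> f q = g q" for f g
          by (rule c_past[OF that])
      qed (intro borel_measurable_times_ennreal borel_measurable_const borel_measurable_of_bool pred_intros_logic pred_stays pred_escapes
          measurable_compose[OF Em measurable_ennreal])
      also have "\<dots> \<le> EE (\<lambda>f. c f * EE (\<lambda>g. 2 * of_bool (stays (x + f (t j)) g)))"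
      proof (rule EE_mono)
        fix \<omega> let ?f = "dyadic_path Z \<omega>" let ?y = "x + ?f (t j)"
        show "c ?f * EE (\<lambda>g. ennreal (E ?y (m - j) g) * of_bool (stays ?y g)) \<le> c ?f * EE (\<lambda>g. 2 * of_bool (stays ?y g))"
        proof (cases "stays_until (t j) x ?f")
          case True
          then have "0 < ?y" using t by (intro stays_untilD[of "t j" x ?f]) auto
          then have "EE (\<lambda>g. ennreal (E ?y (m - j) g) * of_bool (stays ?y g)) \<le> EE (\<lambda>g. 2 * of_bool (stays ?y g))"
            using IH[of ?y j] j by (simp only: EE_cmult[OF borel_measurable_of_bool[OF pred_stays]] EE_of_bool[OF pred_stays])
          then show ?thesis by (rule mult_left_mono) simp
        qed (simp add: c_def)
      qed
      \<comment> \<open>The probability of staying positive from the present position is folded back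
        into the event \<open>stays x\<close>, by the Markov property read in the opposite
        direction.\<close>
      also have "\<dots> = EE (F' j)"
      proof (rule restart[OF t F'm, symmetric])
        show "F' j f = c f * (2 * of_bool (stays (x + f (t j)) (shift (t j) f)))" for f
          unfolding F'_def c_def by (subst stays_split[OF t[of j], of x f]) (auto simp: of_bool_def)
      next
        show "c f = c g" if "\<And>q. q \<in> dyadics \<Longrightarrow> q \<le> t j \<Longrightarrow> f q = g q" for f g
          by (rule c_past[OF that])
      qed (intro borel_measurable_times_ennreal borel_measurable_const borel_measurable_of_bool pred_intros_logic pred_stays pred_escapes
          measurable_compose[OF Em measurable_ennreal])
      finally show ?thesis .
    qed
    have F'_le: "EE (F' j) \<le> ennreal (4 * l) * EE (\<lambda>f. ennreal (w x f j) * of_bool (stays x f))" for j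
    proof -
      have "EE (F' j) \<le> EE (\<lambda>f. ennreal (4 * l) * (ennreal (w x f j) * of_bool (stays x f)))"
      proof (rule EE_mono)
        fix \<omega> let ?f = "dyadic_path Z \<omega>"
        show "F' j ?f \<le> ennreal (4 * l) * (ennreal (w x ?f j) * of_bool (stays x ?f))"
        proof (cases "stays x ?f")
          case True
          have "0 < x + ?f (t j)" using True t by (rule staysD)
          then have "w x ?f j \<le> 1 / 2 ^ k" by (simp add: w_def divide_right_mono)
          also have "\<dots> \<le> 1" by simp
          finally have "w x ?f j \<le> 1" .
          then have u: "0 \<le> l * w x ?f j" "l * w x ?f j \<le> 1"
            using w0[of x ?f j] l by (auto intro: mult_le_one)
          \<comment> \<open>For 0 \<le> u \<le> 1 one has exp u - 1 \<le> u + u^2 \<le> 2u; with the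
            factor 2 from the induction hypothesis this is the origin of
            \<open>4 * l\<close>.\<close>
          have "exp (l * w x ?f j) - 1 \<le> l * w x ?f j + (l * w x ?f j)\<^sup>2" using exp_bound[OF u] by simp
          also have "(l * w x ?f j)\<^sup>2 \<le> l * w x ?f j" using u by (simp add: power2_eq_square mult_left_le)
          finally have "2 * (exp (l * w x ?f j) - 1) \<le> 4 * l * w x ?f j" by simp
          then have "ennreal ((exp (l * w x ?f j) - 1) * 2) \<le> ennreal (4 * l * w x ?f j)"
            by (intro ennreal_leI) simp
          moreover have "ennreal ((exp (l * w x ?f j) - 1) * 2) = ennreal (exp (l * w x ?f j) - 1) * ennreal 2"
            by (rule ennreal_mult'') simp
          moreover have "ennreal (4 * l * w x ?f j) = ennreal (4 * l) * ennreal (w x ?f j)"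
            by (rule ennreal_mult''[OF w0])
          ultimately show ?thesis using True by (simp only: F'_def of_bool_eq mult_1_right ennreal_numeral)
        qed (simp add: F'_def)
      qed
      also have "\<dots> = ennreal (4 * l) * EE (\<lambda>f. ennreal (w x f j) * of_bool (stays x f))"
        by (intro EE_cmult borel_measurable_times_ennreal borel_measurable_of_bool pred_stays) measurable
      finally show ?thesis .
    qed
    have "EE (\<lambda>f. ennreal (E x m f) * of_bool (stays x f)) = EE (\<lambda>f. of_bool (stays x f) + (\<Sum>j=1..m. F j f))"
    proof (rule EE_cong)
      fix \<omega> let ?f = "dyadic_path Z \<omega>"
      have R0: "0 \<le> R j ?f" for j by (simp add: R_def)
      have "ennreal (E x m ?f) = 1 + (\<Sum>j=1..m. ennreal ((exp (l * w x ?f j) - 1) * R j ?f))"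
        unfolding expand using ew0 R0 by (subst ennreal_plus) (auto intro!: sum_nonneg mult_nonneg_nonneg)
      then show "ennreal (E x m ?f) * of_bool (stays x ?f) = of_bool (stays x ?f) + (\<Sum>j=1..m. F j ?f)"
        by (simp add: F_def distrib_right sum_distrib_right)
    qed
    also have "\<dots> = ennreal (pr (stays x)) + (\<Sum>j=1..m. EE (F j))"
      by (subst EE_add) (auto intro!: borel_measurable_of_bool simp: EE_of_bool EE_sum)
    also have "(\<Sum>j=1..m. EE (F j)) \<le> (\<Sum>j=1..m. ennreal (4 * l) * EE (\<lambda>f. ennreal (w x f j) * of_bool (stays x f)))"
      using FF' F'_le by (intro sum_mono) (meson order_trans)
    also have "\<dots> = ennreal (4 * l) * (\<Sum>j=1..m. EE (\<lambda>f. ennreal (w x f j) * of_bool (stays x f)))"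
      by (simp add: sum_distrib_left)
    also have "\<dots> \<le> ennreal (4 * l) * (ennreal C * ennreal (pr (stays x)))"
      unfolding w_def t_def by (intro mult_left_mono C less.prems) simp
    also have "\<dots> = ennreal (4 * l * C) * ennreal (pr (stays x))"
      using l C0 by (simp add: ennreal_mult mult.assoc)
    \<comment> \<open>The leading 1 of the expansion contributes one h(x) and all later terms
      together at most another, which restores the constant 2.\<close>
    also have "\<dots> \<le> 1 * ennreal (pr (stays x))" using l by (intro mult_right_mono) auto
    finally have "EE (\<lambda>f. ennreal (E x m f) * of_bool (stays x f)) \<le> ennreal (pr (stays x)) + 1 * ennreal (pr (stays x))"
      by (simp add: add_left_mono)
    then show ?case unfolding E_def w_def t_def by (simp add: mult_2)
  qed
  then show ?thesis using l by blast
qed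

end

section \<open>Cadlag paths and the Skorokhod topology\<close>

text \<open>Near \<open>t\<close> the path is almost constant on either side separately, with values
  near \<open>f t\<close> and near the left limit \<open>l\<close>. At time 0 the left side is empty
  and \<open>l\<close> is a dummy.\<close>

lemma cadlag_local:
  assumes f: "cadlag f" and t: "0 \<le> t" and e: "0 < e"
  obtains d l where "0 < d" "\<And>u. t \<le> u \<Longrightarrow> u < t + d \<Longrightarrow> \<bar>f u - f t\<bar> < e"
    "\<And>u. 0 \<le> u \<Longrightarrow> t - d < u \<Longrightarrow> u < t \<Longrightarrow> \<bar>f u - l\<bar> < e"
    "0 < t \<Longrightarrow> (f \<longlongrightarrow> l) (at_left t)"
proof -
  have "(f \<longlongrightarrow> f t) (at_right t)" using f t by (simp add: cadlag_def)
  then have "\<forall>\<^sub>F u in at_right t. dist (f u) (f t) < e" using e by (rule tendstoD)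
  then obtain b where b: "t < b" "\<And>u. t < u \<Longrightarrow> u < b \<Longrightarrow> dist (f u) (f t) < e"
    unfolding eventually_at_right_field by blast
  have R: "\<bar>f u - f t\<bar> < e" if "t \<le> u" "u < t + (b - t)" for u
    using b(2)[of u] that e by (cases "u = t") (auto simp: dist_real_def)
  show thesis
  proof (cases "0 < t")
    case False
    then show ?thesis using b t R by (intro that[of "b - t" 0]) auto
  next
    case True
    then obtain l where l: "(f \<longlongrightarrow> l) (at_left t)" using f by (auto simp: cadlag_def)
    then have "\<forall>\<^sub>F u in at_left t. dist (f u) l < e" using e by (rule tendstoD)
    then obtain a where a: "a < t" "\<And>u. a < u \<Longrightarrow> u < t \<Longrightarrow> dist (f u) l < e"
      unfolding eventually_at_left_field by blast
    show ?thesis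
    proof (rule that[of "min (b - t) (t - a)" l])
      show "\<bar>f u - f t\<bar> < e" if "t \<le> u" "u < t + min (b - t) (t - a)" for u
        using R[of u] that by auto
      show "\<bar>f u - l\<bar> < e" if "0 \<le> u" "t - min (b - t) (t - a) < u" "u < t" for u
        using a(2)[of u] that by (auto simp: dist_real_def)
    qed (use a b l in auto)
  qed
qed

text \<open>One-sided limits give a lower bound near each point, and bisection glues these along the
  compact interval.\<close>

lemma cadlag_bounded_below:
  assumes f: "cadlag f"
  shows "\<exists>c. \<forall>t\<in>{0..T}. c \<le> f t"
proof (cases "0 \<le> T")
  case True
  define P where "P = (\<lambda>a b. \<exists>c. \<forall>t\<in>{a..b}. 0 \<le> t \<longrightarrow> c \<le> f t)"
  from True have "P 0 T"
  proof (induction rule: Bolzano)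
    case (trans a b c)
    from trans(1) obtain x where x: "\<And>t. t \<in> {a..b} \<Longrightarrow> 0 \<le> t \<Longrightarrow> x \<le> f t" unfolding P_def by blast
    from trans(2) obtain y where y: "\<And>t. t \<in> {b..c} \<Longrightarrow> 0 \<le> t \<Longrightarrow> y \<le> f t" unfolding P_def by blast
    show ?case
      unfolding P_def
    proof (intro exI[of _ "min x y"] ballI impI)
      fix t assume "t \<in> {a..c}" "0 \<le> t"
      then show "min x y \<le> f t" using x[of t] y[of t] by (cases "t \<le> b") auto
    qed
  next
    case (local t)
    obtain d l where d: "0 < d" "\<And>u. t \<le> u \<Longrightarrow> u < t + d \<Longrightarrow> \<bar>f u - f t\<bar> < 1"
      "\<And>u. 0 \<le> u \<Longrightarrow> t - d < u \<Longrightarrow> u < t \<Longrightarrow> \<bar>f u - l\<bar> < 1"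
      "0 < t \<Longrightarrow> (f \<longlongrightarrow> l) (at_left t)"
      by (rule cadlag_local[OF f local(1) zero_less_one]) (rule that)
    have "P a b" if "a \<le> t" "t \<le> b" "b - a < d" for a b
      unfolding P_def
    proof (intro exI[of _ "min (f t) l - 1"] ballI impI)
      fix u assume "u \<in> {a..b}" "0 \<le> u"
      then show "min (f t) l - 1 \<le> f u" using d(2)[of u] d(3)[of u] that by (cases "t \<le> u") auto
    qed
    then show ?case using d(1) by blast
  qed
  then show ?thesis by (auto simp: P_def)
qed auto

text \<open>Between nearby times a large drop could only come from a jump, and at a jump the path
  goes up from its left limit. Compactness makes the local width uniform on the time
  interval.\<close>

lemma cadlag_small_drops:
  assumes f: "cadlag f" and nj: "no_negative_jumps f" and e: "0 < e"
  shows "\<exists>d>0. \<forall>s u. 0 \<le> s \<and> s \<le> u \<and> u \<le> T \<and> u < s + d \<longrightarrow> f s - e \<le> f u"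
proof -
  have loc: "\<exists>d>0. \<forall>s u. 0 \<le> s \<and> t - d < s \<and> s \<le> u \<and> u < t + d \<longrightarrow> f s - e \<le> f u" if t: "0 \<le> t" for t
  proof -
    obtain d l where d: "0 < d" "\<And>u. t \<le> u \<Longrightarrow> u < t + d \<Longrightarrow> \<bar>f u - f t\<bar> < e / 2"
      "\<And>u. 0 \<le> u \<Longrightarrow> t - d < u \<Longrightarrow> u < t \<Longrightarrow> \<bar>f u - l\<bar> < e / 2"
      "0 < t \<Longrightarrow> (f \<longlongrightarrow> l) (at_left t)"
      by (rule cadlag_local[OF f t half_gt_zero[OF e]]) (rule that)
    have l: "l \<le> f t" if "0 < t"
      using tendsto_Lim[OF _ d(4)[OF that]] nj that by (auto simp: no_negative_jumps_def)
    have "f s - e \<le> f u" if su: "0 \<le> s" "t - d < s" "s \<le> u" "u < t + d" for s u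
    proof -
      consider "t \<le> s" | "s < t" "t \<le> u" | "u < t" using su by linarith
      then show ?thesis
      proof cases
        case 1
        then show ?thesis using d(2)[of s] d(2)[of u] su by linarith
      next
        case 2
        then show ?thesis using d(3)[of s] d(2)[of u] l su by linarith
      next
        case 3
        then show ?thesis using d(3)[of s] d(3)[of u] su by linarith
      qed
    qed
    then show ?thesis using d(1) by blast
  qed
  then obtain D where D: "\<And>t. 0 \<le> t \<Longrightarrow> 0 < D t"
    "\<And>t s u. 0 \<le> t \<Longrightarrow> 0 \<le> s \<Longrightarrow> t - D t < s \<Longrightarrow> s \<le> u \<Longrightarrow> u < t + D t \<Longrightarrow> f s - e \<le> f u"
    by metis
  \<comment> \<open>A Lebesgue number of the cover by the local neighbourhoods.\<close>
  obtain d where d: "0 < d" "\<And>t. t \<in> {0..T} \<Longrightarrow> \<exists>G\<in>(\<lambda>t. ball t (D t)) ` {0..T}. ball t d \<subseteq> G"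
  proof (rule Heine_Borel_lemma[of "{0..T}" "(\<lambda>t. ball t (D t)) ` {0..T}"])
    show "{0..T} \<subseteq> \<Union> ((\<lambda>t. ball t (D t)) ` {0..T})" using D(1) by fastforce
  qed auto
  have "f s - e \<le> f u" if su: "0 \<le> s" "s \<le> u" "u \<le> T" "u < s + d" for s u
  proof -
    obtain t where t: "0 \<le> t" "ball s d \<subseteq> ball t (D t)" using d(2)[of s] su by auto
    have "s \<in> ball s d" "u \<in> ball s d" using su d(1) by (auto simp: dist_real_def)
    from this[THEN subsetD[OF t(2)]] have "s \<in> ball t (D t)" "u \<in> ball t (D t)" .
    then have "t - D t < s" "u < t + D t" by (auto simp: dist_real_def)
    then show ?thesis using su t(1) by (intro D(2)[of t s u])
  qed
  then show ?thesis using d(1) by blast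
qed

text \<open>Points whose oscillation is at least \<open>e\<close> cannot accumulate at any
  \<open>x\<close>, since on each side of \<open>x\<close> all values are within
  \<open>e / 2\<close> of a common one. Such a set is countable, and the values e = 1/(n + 1)
  exhaust all discontinuities.\<close>

lemma cadlag_countable_discontinuities:
  assumes f: "cadlag f"
  shows "countable {t. 0 < t \<and> \<not> isCont f t}"
proof -
  define B where "B = (\<lambda>e. {t. 0 < t \<and> \<not> (\<exists>d>0. \<forall>u. \<bar>u - t\<bar> < d \<longrightarrow> \<bar>f u - f t\<bar> < e)})"
  have "countable (B e)" if e: "0 < e" for e
  proof -
    have "\<not> x islimpt B e" for x
    proof (cases "0 \<le> x")
      case False
      then have "open {..<0::real}" "x \<in> {..<0}" "\<And>y. y \<in> {..<0} \<Longrightarrow> y \<notin> B e" by (auto simp: B_def)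
      then show ?thesis unfolding islimpt_def by blast
    next
      case True
      obtain d l where d: "0 < d" "\<And>u. x \<le> u \<Longrightarrow> u < x + d \<Longrightarrow> \<bar>f u - f x\<bar> < e / 2"
        "\<And>u. 0 \<le> u \<Longrightarrow> x - d < u \<Longrightarrow> u < x \<Longrightarrow> \<bar>f u - l\<bar> < e / 2"
        "0 < x \<Longrightarrow> (f \<longlongrightarrow> l) (at_left x)"
        by (rule cadlag_local[OF f True half_gt_zero[OF e]]) (rule that)
      have "y \<notin> B e" if y: "y \<in> {x - d<..<x + d}" "y \<noteq> x" for y
      proof
        assume "y \<in> B e"
        then have y0: "0 < y" and no: "\<And>r. 0 < r \<Longrightarrow> \<exists>u. \<bar>u - y\<bar> < r \<and> \<not> \<bar>f u - f y\<bar> < e"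
          by (auto simp: B_def)
        \<comment> \<open>The radius keeps the neighbourhood of \<open>y\<close> on one side of
          \<open>x\<close>, inside the good interval, and at nonnegative times.\<close>
        define r where "r = (if x < y then min (y - x) (x + d - y) else Min {x - y, y - (x - d), y})"
        have r0: "0 < r" using y y0 by (auto simp: r_def)
        obtain u where u: "\<bar>u - y\<bar> < r" "\<not> \<bar>f u - f y\<bar> < e" using no[OF r0] by blast
        show False
        proof (cases "x < y")
          case True
          then have "x \<le> u" "u < x + d" "x \<le> y" "y < x + d" using u(1) y by (auto simp: r_def)
          then have "\<bar>f u - f x\<bar> < e / 2" "\<bar>f y - f x\<bar> < e / 2" by (simp_all only: d(2))
          then show False using u(2) by linarith
        next
          case False
          then have "0 \<le> u" "x - d < u" "u < x" "0 \<le> y" "x - d < y" "y < x" using u(1) y y0 by (auto simp: r_def)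
          then have "\<bar>f u - l\<bar> < e / 2" "\<bar>f y - l\<bar> < e / 2" by (simp_all only: d(3))
          then show False using u(2) by linarith
        qed
      qed
      moreover have "open {x - d<..<x + d}" "x \<in> {x - d<..<x + d}" using d(1) by auto
      ultimately show ?thesis unfolding islimpt_def by blast
    qed
    then have "B e sparse_in UNIV" by (auto simp: sparse_in_def)
    from sparse_imp_countable[OF open_UNIV this] show ?thesis by simp
  qed
  then have "countable (\<Union>n. B (1 / real (Suc n)))" by (intro countable_UN) auto
  moreover have "{t. 0 < t \<and> \<not> isCont f t} \<subseteq> (\<Union>n. B (1 / real (Suc n)))"
  proof
    fix t assume "t \<in> {t. 0 < t \<and> \<not> isCont f t}"
    then have t: "0 < t" and "\<not> isCont f t" by auto
    then obtain e where e: "0 < e" "\<And>d. 0 < d \<Longrightarrow> \<exists>u. \<bar>u - t\<bar> < d \<and> \<not> \<bar>f u - f t\<bar> < e"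
      unfolding continuous_at_eps_delta dist_real_def by blast
    obtain n where n: "1 / real (Suc n) < e" using e(1) by (rule nat_approx_posE)
    have "\<not> (\<forall>u. \<bar>u - t\<bar> < r \<longrightarrow> \<bar>f u - f t\<bar> < 1 / real (Suc n))" if "0 < r" for r
      using e(2)[OF that] n less_trans by metis
    then have "t \<in> B (1 / real (Suc n))" unfolding B_def mem_Collect_eq using t by metis
    then show "t \<in> (\<Union>n. B (1 / real (Suc n)))" by (rule UN_I[OF UNIV_I])
  qed
  ultimately show ?thesis by (rule countable_subset[rotated])
qed

text \<open>The next grid point strictly to the right, even if \<open>t\<close> is on the grid:
  right-continuity can be applied, and the point is the right end of the half-open cell containing
  \<open>t\<close>.\<close>

definition dyadic_ceil :: "nat \<Rightarrow> real \<Rightarrow> real" where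
  "dyadic_ceil k t = real (Suc (nat \<lfloor>t * 2 ^ k\<rfloor>)) / 2 ^ k"

lemma dyadic_ceil_bounds:
  assumes "0 \<le> t" shows "t < dyadic_ceil k t" "dyadic_ceil k t \<le> t + 1 / 2 ^ k"
proof -
  have "real (nat \<lfloor>t * 2 ^ k\<rfloor>) = real_of_int \<lfloor>t * 2 ^ k\<rfloor>" using assms by simp
  then have 1: "real (nat \<lfloor>t * 2 ^ k\<rfloor>) \<le> t * 2 ^ k" "t * 2 ^ k < real (Suc (nat \<lfloor>t * 2 ^ k\<rfloor>))"
    using of_int_floor_le[of "t * 2 ^ k"] real_of_int_floor_add_one_gt[of "t * 2 ^ k"] by linarith+
  show "t < dyadic_ceil k t" using 1(2) by (simp add: dyadic_ceil_def pos_less_divide_eq)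
  show "dyadic_ceil k t \<le> t + 1 / 2 ^ k" using 1(1) by (simp add: dyadic_ceil_def field_simps)
qed

lemma dyadic_ceil_in [simp]: "dyadic_ceil k t \<in> dyadics"
  unfolding dyadic_ceil_def by (rule dyadics_I)

lemma dyadic_ceil_tendsto:
  assumes t: "0 \<le> t" and f: "cadlag f"
  shows "(\<lambda>k. f (dyadic_ceil k t)) \<longlonglongrightarrow> f t"
proof -
  have "(\<lambda>k. dyadic_ceil k t) \<longlonglongrightarrow> t"
  proof (rule tendsto_sandwich[of "\<lambda>_. t" _ _ "\<lambda>k. t + 1 / 2 ^ k"])
    show "(\<lambda>k. t + 1 / 2 ^ k) \<longlonglongrightarrow> t" by real_asymp
  qed (use dyadic_ceil_bounds[OF t] in \<open>auto intro!: always_eventually less_imp_le\<close>)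
  then have "filterlim (\<lambda>k. dyadic_ceil k t) (at_right t) sequentially"
    using dyadic_ceil_bounds[OF t] by (intro tendsto_imp_filterlim_at_right) auto
  moreover have "(f \<longlongrightarrow> f t) (at_right t)" using f t by (simp add: cadlag_def)
  ultimately show ?thesis by (rule filterlim_compose[rotated])
qed

text \<open>By right-continuity every value is a limit of values at dyadic times, and the uniform
  margin passes to the limit. This identifies the conditioning event with the discrete one.\<close>

lemma INF_pos_iff_stays:
  assumes f: "cadlag f" and g: "\<And>q. q \<in> dyadics \<Longrightarrow> g q = f q"
  shows "0 < (INF t\<in>{0..}. ereal (x + f t)) \<longleftrightarrow> stays x g"
proof
  assume "0 < (INF t\<in>{0..}. ereal (x + f t))"
  then obtain r where r: "0 < ereal r" "ereal r < (INF t\<in>{0..}. ereal (x + f t))"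
    using ereal_dense2 by blast
  obtain n where n: "1 / real (Suc n) < r" using nat_approx_posE[of r] r(1) by auto
  have "1 / real (Suc n) \<le> x + g q" if "q \<in> dyadics" for q
  proof -
    have "ereal r < ereal (x + f q)"
      by (rule less_le_trans[OF r(2)]) (use that in \<open>auto intro!: INF_lower\<close>)
    then show ?thesis using n g[OF that] by simp
  qed
  then show "stays x g" unfolding stays_def by blast
next
  assume "stays x g"
  then obtain n where n: "\<And>q. q \<in> dyadics \<Longrightarrow> 1 / real (Suc n) \<le> x + f q"
    using g by (auto simp: stays_def)
  have "1 / real (Suc n) \<le> x + f t" if "0 \<le> t" for t
    by (rule LIMSEQ_le_const[OF tendsto_add[OF tendsto_const dyadic_ceil_tendsto[OF that f]]])
      (use n in auto)
  then have "ereal (1 / real (Suc n)) \<le> (INF t\<in>{0..}. ereal (x + f t))"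
    by (intro INF_greatest) auto
  then show "0 < (INF t\<in>{0..}. ereal (x + f t))"
    by (rule less_le_trans[rotated]) simp
qed

text \<open>Convergence in distribution tests only functionals bounded on the whole path space,
  which also contains negative paths; hence the integrand is capped as well as the time
  window.\<close>

definition truncated_functional :: "nat \<Rightarrow> (real \<Rightarrow> real) \<Rightarrow> real" where
  "truncated_functional n f = (\<integral>t. min (real n) (exp (- f t)) * indicator {0..<real n} t \<partial>lborel)"

text \<open>Right-endpoint Riemann sums are integrals of step functions that converge pointwise and
  are dominated; measurability of the integrand comes from the same limit. This connects the
  integral with the grid estimates.\<close>

lemma riemann_sum_tendsto:
  assumes f: "cadlag f"
  shows "(\<lambda>k. \<Sum>j=1..n * 2 ^ k. min (real n) (exp (- f (real j / 2 ^ k))) / 2 ^ k)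
      \<longlonglongrightarrow> truncated_functional n f"
    and "(\<lambda>t. min (real n) (exp (- f t)) * indicator {0..<real n} t) \<in> borel_measurable lborel"
proof -
  define g where "g = (\<lambda>t. min (real n) (exp (- f t)))"
  have g0: "0 \<le> g t" "g t \<le> real n" for t by (auto simp: g_def)
  define I where "I = (\<lambda>k (j::nat). {real (j - 1) / 2 ^ k..<real j / 2 ^ k})"
  \<comment> \<open>Each half-open cell carries the value at its right end, so on the window this is
    \<open>g (dyadic_ceil k t)\<close>.\<close>
  define s where "s = (\<lambda>k t. \<Sum>j=1..n * 2 ^ k. g (real j / 2 ^ k) * indicator (I k j) t)"
  have sm: "s k \<in> borel_measurable lborel" for k
    unfolding s_def I_def by measurable
  have in_I: "t \<in> I k j \<longleftrightarrow> 0 \<le> t \<and> j = Suc (nat \<lfloor>t * 2 ^ k\<rfloor>)" if j: "1 \<le> j" for t k j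
  proof -
    have "t \<in> I k j \<longleftrightarrow> real (j - 1) \<le> t * 2 ^ k \<and> t * 2 ^ k < real j"
      by (simp add: I_def pos_divide_le_eq pos_less_divide_eq)
    also have "\<dots> \<longleftrightarrow> 0 \<le> t \<and> j = Suc (nat \<lfloor>t * 2 ^ k\<rfloor>)"
    proof
      assume *: "real (j - 1) \<le> t * 2 ^ k \<and> t * 2 ^ k < real j"
      then have "0 \<le> t * 2 ^ k" by (meson of_nat_0_le_iff order_trans)
      then have t: "0 \<le> t" using mult_neg_pos[of t "2 ^ k"] by (intro leI notI) simp
      have "\<lfloor>t * 2 ^ k\<rfloor> = int (j - 1)"
        using * j by (intro floor_unique) (auto simp: of_nat_diff)
      then show "0 \<le> t \<and> j = Suc (nat \<lfloor>t * 2 ^ k\<rfloor>)" using t j by simp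
    next
      assume *: "0 \<le> t \<and> j = Suc (nat \<lfloor>t * 2 ^ k\<rfloor>)"
      then have "real_of_int \<lfloor>t * 2 ^ k\<rfloor> = real (j - 1)" "real j = real (j - 1) + 1" by simp_all
      then show "real (j - 1) \<le> t * 2 ^ k \<and> t * 2 ^ k < real j"
        using of_int_floor_le[of "t * 2 ^ k"] real_of_int_floor_add_one_gt[of "t * 2 ^ k"] by linarith
    qed
    finally show ?thesis .
  qed
  have s_eq: "s k t = g (dyadic_ceil k t) * indicator {0..<real n} t" for k t
  proof (cases "0 \<le> t \<and> t < real n")
    case True
    let ?j = "Suc (nat \<lfloor>t * 2 ^ k\<rfloor>)"
    have "t * 2 ^ k < real (n * 2 ^ k)" using True by simp
    then have "\<lfloor>t * 2 ^ k\<rfloor> < int (n * 2 ^ k)" by (simp only: floor_less_iff of_int_of_nat_eq)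
    then have j: "?j \<in> {1..n * 2 ^ k}" using True by (simp add: nat_less_iff Suc_le_eq)
    have "s k t = (\<Sum>j=1..n * 2 ^ k. if j = ?j then g (real ?j / 2 ^ k) else 0)"
      unfolding s_def
    proof (intro sum.cong refl)
      fix j assume "j \<in> {1..n * 2 ^ k}"
      then have "t \<in> I k j \<longleftrightarrow> j = ?j" using in_I[of j t k] True by simp
      then show "g (real j / 2 ^ k) * indicator (I k j) t = (if j = ?j then g (real ?j / 2 ^ k) else 0)"
        by (cases "j = ?j") (simp_all add: indicator_def del: of_nat_Suc)
    qed
    also have "\<dots> = g (real ?j / 2 ^ k)" using j by (subst sum.delta) auto
    finally show ?thesis using True by (simp add: dyadic_ceil_def)
  next
    case False
    have "t \<notin> I k j" if "j \<in> {1..n * 2 ^ k}" for j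
    proof
      assume "t \<in> I k j"
      then have "0 \<le> t" "t < real j / 2 ^ k" using in_I[of j t k] that by (auto simp: I_def)
      moreover have "real j / 2 ^ k \<le> real n"
      proof -
        have "real j \<le> real (n * 2 ^ k)" using that by (simp only: of_nat_le_iff atLeastAtMost_iff)
        then show ?thesis by (simp add: divide_le_eq)
      qed
      ultimately show False using False by simp
    qed
    then have "s k t = 0" unfolding s_def by (intro sum.neutral ballI) simp
    then show ?thesis using False by (simp add: indicator_def)
  qed
  have lim: "(\<lambda>k. s k t) \<longlonglongrightarrow> g t * indicator {0..<real n} t" for t
  proof (cases "0 \<le> t")
    case True
    show ?thesis unfolding s_eq g_def
      by (intro tendsto_intros dyadic_ceil_tendsto True f)
  qed (simp add: s_eq)
  have gm: "(\<lambda>t. g t * indicator {0..<real n} t) \<in> borel_measurable lborel"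
    by (rule borel_measurable_LIMSEQ_real[OF lim sm])
  then show "(\<lambda>t. min (real n) (exp (- f t)) * indicator {0..<real n} t) \<in> borel_measurable lborel"
    by (simp add: g_def)
  have "(\<lambda>k. \<integral>t. s k t \<partial>lborel) \<longlonglongrightarrow> (\<integral>t. g t * indicator {0..<real n} t \<partial>lborel)"
  proof (rule integral_dominated_convergence[where w = "\<lambda>t. real n * indicator {0..<real n} t"])
    show "AE t in lborel. norm (s k t) \<le> real n * indicator {0..<real n} t" for k
      using g0 by (intro AE_I2) (auto simp: s_eq abs_mult indicator_def)
  qed (use lim sm gm in auto)
  moreover have "(\<integral>t. s k t \<partial>lborel) = (\<Sum>j=1..n * 2 ^ k. g (real j / 2 ^ k) / 2 ^ k)" for k
  proof -
    have "(\<integral>t. s k t \<partial>lborel) = (\<Sum>j=1..n * 2 ^ k. \<integral>t. g (real j / 2 ^ k) * indicator (I k j) t \<partial>lborel)"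
      unfolding s_def
    proof (rule Bochner_Integration.integral_sum)
      fix j assume "j \<in> {1..n * 2 ^ k}"
      then have "real (j - 1) / 2 ^ k \<le> real j / 2 ^ k" by (intro divide_right_mono) auto
      then have "emeasure lborel (I k j) < \<infinity>" unfolding I_def by (subst emeasure_lborel_Ico) auto
      then show "integrable lborel (\<lambda>t. g (real j / 2 ^ k) * indicator (I k j) t)"
        by (intro integrable_mult_right integrable_real_indicator) (simp_all add: I_def)
    qed
    also have "\<dots> = (\<Sum>j=1..n * 2 ^ k. g (real j / 2 ^ k) / 2 ^ k)"
    proof (rule sum.cong)
      fix j assume "j \<in> {1..n * 2 ^ k}"
      then have "measure lborel (I k j) = 1 / 2 ^ k"
        unfolding I_def by (subst measure_lborel_Ico) (auto simp: of_nat_diff divide_right_mono diff_divide_distrib)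
      then show "(\<integral>t. g (real j / 2 ^ k) * indicator (I k j) t \<partial>lborel) = g (real j / 2 ^ k) / 2 ^ k"
        by simp
    qed simp
    finally show ?thesis .
  qed
  ultimately show "(\<lambda>k. \<Sum>j=1..n * 2 ^ k. min (real n) (exp (- f (real j / 2 ^ k))) / 2 ^ k)
      \<longlonglongrightarrow> truncated_functional n f"
    by (simp add: g_def truncated_functional_def)
qed

lemma truncated_functional_bounds:
  "0 \<le> truncated_functional n f" "truncated_functional n f \<le> real n * real n"
proof -
  show "0 \<le> truncated_functional n f" unfolding truncated_functional_def by (rule integral_nonneg_AE) simp
  show "truncated_functional n f \<le> real n * real n"
  proof (cases "integrable lborel (\<lambda>t. min (real n) (exp (- f t)) * indicator {0..<real n} t)")
    case True
    have "truncated_functional n f \<le> (\<integral>t. real n * indicator {0..<real n} t \<partial>lborel)"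
      unfolding truncated_functional_def using True by (rule integral_mono) (simp, simp add: indicator_def)
    also have "\<dots> = real n * real n" by simp
    finally show ?thesis .
  qed (simp add: truncated_functional_def not_integrable_integral_eq)
qed

text \<open>Convergence in the Skorokhod topology is pointwise at continuity points of the limit.
  The remaining times are countable, hence null, and the capped integrands are dominated.\<close>

lemma truncated_functional_skorokhod:
  assumes F: "range F \<subseteq> space path_space" and g: "g \<in> space path_space" and lim: "skorokhod_tendsto F g"
  shows "(\<lambda>k. truncated_functional n (F k)) \<longlonglongrightarrow> truncated_functional n g"
proof -
  have cF: "cadlag (F k)" for k using F by (auto simp: path_space_def space_restrict_space)
  have cg: "cadlag g" using g by (auto simp: path_space_def space_restrict_space)
  obtain \<tau> where bij: "\<And>k. bij_betw (\<tau> k) {0..} {0..}"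
    and \<tau>: "uniform_limit {0..} \<tau> (\<lambda>t. t) sequentially"
    and uF: "\<And>T. uniform_limit {0..T} (\<lambda>k t. F k (\<tau> k t)) g sequentially"
    using lim unfolding skorokhod_tendsto_def by blast
  have pt: "(\<lambda>k. F k t) \<longlonglongrightarrow> g t" if t: "0 < t" "isCont g t" for t
  proof -
    \<comment> \<open>The preimage of \<open>t\<close> under the time change: the value of
      \<open>F k\<close> at \<open>t\<close> is close to \<open>g (s k)\<close>, and
      \<open>s k\<close> tends to \<open>t\<close> because the time changes tend uniformly to the
      identity.\<close>
    define s where "s = (\<lambda>k. inv_into {0..} (\<tau> k) t)"
    have ts: "t \<in> \<tau> k ` {0..}" for k using bij[of k] t(1) by (simp add: bij_betw_def)
    have s0: "0 \<le> s k" and \<tau>s: "\<tau> k (s k) = t" for k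
      using inv_into_into[OF ts[of k]] f_inv_into_f[OF ts[of k]] by (auto simp: s_def)
    have st: "s \<longlonglongrightarrow> t"
    proof (rule tendstoI)
      fix e :: real assume "0 < e"
      with \<tau> have "\<forall>\<^sub>F k in sequentially. \<forall>u\<in>{0..}. dist (\<tau> k u) u < e" by (rule uniform_limitD)
      then show "\<forall>\<^sub>F k in sequentially. dist (s k) t < e"
        by eventually_elim (metis \<tau>s s0 atLeast_iff dist_commute)
    qed
    have "(\<lambda>k. F k t - g (s k)) \<longlonglongrightarrow> 0"
    proof (rule tendstoI)
      fix e :: real assume e: "0 < e"
      have "\<forall>\<^sub>F k in sequentially. \<forall>u\<in>{0..t + 1}. dist (F k (\<tau> k u)) (g u) < e"
        using uF e by (rule uniform_limitD)
      moreover have "\<forall>\<^sub>F k in sequentially. s k < t + 1" using st by (rule order_tendstoD) simp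
      ultimately show "\<forall>\<^sub>F k in sequentially. dist (F k t - g (s k)) 0 < e"
      proof eventually_elim
        case (elim k)
        then have "dist (F k (\<tau> k (s k))) (g (s k)) < e" using s0[of k] by auto
        then show ?case by (simp add: \<tau>s dist_real_def)
      qed
    qed
    moreover have "(\<lambda>k. g (s k)) \<longlonglongrightarrow> g t" by (rule isCont_tendsto_compose[OF t(2) st])
    ultimately have "(\<lambda>k. F k t - g (s k) + g (s k)) \<longlonglongrightarrow> 0 + g t" by (rule tendsto_add)
    then show ?thesis by simp
  qed
  have "countable ({t. 0 < t \<and> \<not> isCont g t} \<union> {0})"
    using cadlag_countable_discontinuities[OF cg] by simp
  then have ae: "AE t in lborel. t \<notin> {t. 0 < t \<and> \<not> isCont g t} \<union> {0}"
    by (intro AE_not_in countable_imp_null_set_lborel)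
  show ?thesis unfolding truncated_functional_def
  proof (rule integral_dominated_convergence[where w = "\<lambda>t. real n * indicator {0..<real n} t"])
    show "AE t in lborel. (\<lambda>k. min (real n) (exp (- F k t)) * indicator {0..<real n} t)
        \<longlonglongrightarrow> min (real n) (exp (- g t)) * indicator {0..<real n} t"
      using ae
    proof eventually_elim
      case (elim t)
      show ?case
      proof (cases "0 < t")
        case True
        then show ?thesis using elim by (intro tendsto_intros pt) auto
      next
        case False
        then have "t \<notin> {0..<real n}" using elim by auto
        then show ?thesis by simp
      qed
    qed
    show "AE t in lborel. norm (min (real n) (exp (- F k t)) * indicator {0..<real n} t)
        \<le> real n * indicator {0..<real n} t" for k
      by (intro AE_I2) (simp add: indicator_def)
  qed (use riemann_sum_tendsto(2)[OF cF] riemann_sum_tendsto(2)[OF cg] in simp_all)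
qed

text \<open>A pointwise limit of functions of finitely many coordinates.\<close>

lemma truncated_functional_measurable:
  "truncated_functional n \<in> borel_measurable path_space"
proof (rule borel_measurable_LIMSEQ_real)
  fix f assume "f \<in> space path_space"
  then have "cadlag f" by (simp add: path_space_def space_restrict_space)
  then show "(\<lambda>k. \<Sum>j=1..n * 2 ^ k. min (real n) (exp (- f (real j / 2 ^ k))) / 2 ^ k)
      \<longlonglongrightarrow> truncated_functional n f" by (rule riemann_sum_tendsto)
next
  fix k
  have "(\<lambda>f. f (real j / 2 ^ k)) \<in> borel_measurable path_space" for j
    unfolding path_space_def
    by (intro measurable_restrict_space1 measurable_component_singleton) simp
  then show "(\<lambda>f. \<Sum>j=1..n * 2 ^ k. min (real n) (exp (- f (real j / 2 ^ k))) / 2 ^ k)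
      \<in> borel_measurable path_space"
    by (intro borel_measurable_sum borel_measurable_divide borel_measurable_min borel_measurable_const
        borel_measurable_exp borel_measurable_uminus) auto
qed

lemma cadlag_cong:
  assumes "cadlag f" "\<And>t. 0 \<le> t \<Longrightarrow> f t = g t" shows "cadlag g"
  unfolding cadlag_def
proof (intro conjI allI impI)
  fix t :: real assume t: "0 \<le> t"
  have "(f \<longlongrightarrow> f t) (at_right t)" using assms(1) t by (simp add: cadlag_def)
  moreover have "\<forall>\<^sub>F u in at_right t. f u = g u"
    using t assms(2) by (auto simp: eventually_at_filter)
  ultimately show "(g \<longlongrightarrow> g t) (at_right t)" using assms(2)[OF t] by (simp add: tendsto_cong)
next
  fix t :: real assume t: "0 < t"
  obtain l where l: "(f \<longlongrightarrow> l) (at_left t)" using assms(1) t by (auto simp: cadlag_def)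
  have "\<forall>\<^sub>F u in at_left t. f u = g u"
    unfolding eventually_at_left_field using t assms(2) by (intro exI[of _ 0]) auto
  then show "\<exists>l. (g \<longlongrightarrow> l) (at_left t)" using l by (auto simp: tendsto_cong)
qed

lemma cadlag_add_const: "cadlag f \<Longrightarrow> cadlag (\<lambda>t. c + f t)"
  unfolding cadlag_def by (blast intro: tendsto_add[OF tendsto_const])

lemma truncated_functional_cong:
  assumes "\<And>t. 0 \<le> t \<Longrightarrow> f t = g t"
  shows "truncated_functional n f = truncated_functional n g"
  unfolding truncated_functional_def using assms
  by (intro Bochner_Integration.integral_cong) (auto simp: indicator_def)

lemma measurable_process_path:
  assumes "\<And>t. 0 \<le> t \<Longrightarrow> X t \<in> borel_measurable M"
    and "\<And>\<omega>. \<omega> \<in> space M \<Longrightarrow> cadlag (\<lambda>t. X t \<omega>)"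
  shows "(\<lambda>\<omega>. \<lambda>t\<in>{0..}. X t \<omega>) \<in> M \<rightarrow>\<^sub>M path_space"
  unfolding path_space_def
proof (rule measurable_restrict_space2)
  show "(\<lambda>\<omega>. \<lambda>t\<in>{0..}. X t \<omega>) \<in> space M \<rightarrow> {f. cadlag f}"
    by (intro funcsetI CollectI cadlag_cong[OF assms(2)]) auto
  show "(\<lambda>\<omega>. \<lambda>t\<in>{0..}. X t \<omega>) \<in> M \<rightarrow>\<^sub>M PiM {0..} (\<lambda>_. borel)"
    using assms(1) by (intro measurable_restrict) auto
qed

section \<open>The exponential functional\<close>

text \<open>The initial value is 0 only almost surely. Subtracting it leaves the increments
  unchanged and yields a version starting from 0 everywhere, as the path identities for splicing
  require.\<close>

lemma levy_process_start_at_0: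
  fixes Z :: "real \<Rightarrow> 'a \<Rightarrow> real"
  assumes "levy_process M Z"
  shows "levy_process M (\<lambda>t \<omega>. Z t \<omega> - Z 0 \<omega>)"
proof -
  have cp: "cadlag_process M Z" and Z0: "AE \<omega> in M. Z 0 \<omega> = 0"
    and incr: "\<forall>n (s :: nat \<Rightarrow> real). 0 \<le> s 0 \<and> mono_on {..n} s \<longrightarrow>
        prob_space.indep_vars M (\<lambda>_. borel) (\<lambda>i \<omega>. Z (s (Suc i)) \<omega> - Z (s i) \<omega>) {..<n}"
    and stat: "\<forall>s\<ge>0. \<forall>h\<ge>0. distr M borel (\<lambda>\<omega>. Z (s + h) \<omega> - Z s \<omega>) = distr M borel (Z h)"
    using assms[unfolded levy_process_def, THEN conjunct1] assms[unfolded levy_process_def, THEN conjunct2, THEN conjunct1]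
      assms[unfolded levy_process_def, THEN conjunct2, THEN conjunct2, THEN conjunct1]
      assms[unfolded levy_process_def, THEN conjunct2, THEN conjunct2, THEN conjunct2] .
  have meas: "Z t \<in> borel_measurable M" if "0 \<le> t" for t
    using cp that by (simp add: cadlag_process_def)
  have "cadlag_process M (\<lambda>t \<omega>. Z t \<omega> - Z 0 \<omega>)"
    unfolding cadlag_process_def
  proof (intro conjI allI impI ballI)
    show "prob_space M" using cp by (simp add: cadlag_process_def)
    show "(\<lambda>\<omega>. Z t \<omega> - Z 0 \<omega>) \<in> borel_measurable M" if "0 \<le> t" for t
      using that by (intro borel_measurable_diff meas) auto
    fix \<omega> assume "\<omega> \<in> space M"
    then have "cadlag (\<lambda>t. - Z 0 \<omega> + Z t \<omega>)"
      using cp by (intro cadlag_add_const) (simp add: cadlag_process_def)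
    then show "cadlag (\<lambda>t. Z t \<omega> - Z 0 \<omega>)" by simp
  qed
  moreover have "distr M borel (\<lambda>\<omega>. Z h \<omega> - Z 0 \<omega>) = distr M borel (Z h)" if "0 \<le> h" for h
  proof (rule distr_cong_AE)
    show "AE \<omega> in M. Z h \<omega> - Z 0 \<omega> = Z h \<omega>" using Z0 by eventually_elim simp
  qed (use that meas in \<open>auto intro!: borel_measurable_diff\<close>)
  ultimately show ?thesis
    unfolding levy_process_def using incr stat by simp
qed

text \<open>The lower bound combines the drift after some time with boundedness on the compact
  interval before it. \<open>small_drops\<close> holds once the mesh is below the width supplied by
  \<open>cadlag_small_drops\<close>.\<close>

lemma dyadic_levyI:
  fixes Z :: "real \<Rightarrow> 'a \<Rightarrow> real"
  assumes sp: "spectrally_positive_levy_process M Z" and drift: "drifts_to_infinity M Z"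
  shows "dyadic_levy M (\<lambda>t \<omega>. Z t \<omega> - Z 0 \<omega>)"
proof -
  let ?Z = "\<lambda>t \<omega>. Z t \<omega> - Z 0 \<omega>"
  have levyZ: "levy_process M Z" using sp by (simp add: spectrally_positive_levy_process_def)
  then have levy: "levy_process M ?Z" by (rule levy_process_start_at_0)
  then have cp: "cadlag_process M ?Z" by (simp add: levy_process_def)
  have cad: "cadlag (\<lambda>t. ?Z t \<omega>)" if "\<omega> \<in> space M" for \<omega>
    using cp that by (simp add: cadlag_process_def)
  interpret prob_space M using cp by (simp add: cadlag_process_def)
  have Z0: "AE \<omega> in M. Z 0 \<omega> = 0" using levyZ by (simp add: levy_process_def)
  have dr: "AE \<omega> in M. \<forall>c. \<exists>n::nat. \<forall>q\<in>dyadics. real n \<le> q \<longrightarrow> c \<le> ?Z q \<omega>"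
    using drift Z0 unfolding drifts_to_infinity_def
  proof eventually_elim
    case (elim \<omega>)
    show ?case
    proof
      fix c
      obtain T where T: "\<And>t. T \<le> t \<Longrightarrow> c \<le> Z t \<omega>"
        using elim(1) unfolding filterlim_at_top eventually_at_top_linorder by blast
      show "\<exists>n::nat. \<forall>q\<in>dyadics. real n \<le> q \<longrightarrow> c \<le> ?Z q \<omega>"
        using elim(2) T real_nat_ceiling_ge[of T] by (intro exI[of _ "nat \<lceil>T\<rceil>"]) (auto intro: order_trans)
    qed
  qed
  have nj: "AE \<omega> in M. no_negative_jumps (\<lambda>t. ?Z t \<omega>)"
    using sp Z0 unfolding spectrally_positive_levy_process_def by (auto simp: eventually_conj_iff)
  show ?thesis
  proof unfold_locales
    show "?Z t \<in> borel_measurable M" if "t \<in> dyadics" for t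
      using cp that by (simp add: cadlag_process_def)
    show "Z 0 \<omega> - Z 0 \<omega> = 0" for \<omega> by simp
    show "(\<integral>\<^sup>+\<omega>. \<Psi> (dyadic_path ?Z \<omega>) \<partial>M)
        = (\<integral>\<^sup>+\<omega>. \<integral>\<^sup>+\<omega>'. \<Psi> (splice t (dyadic_path ?Z \<omega>) (dyadic_path ?Z \<omega>')) \<partial>M \<partial>M)"
      if "t \<in> dyadics" "\<Psi> \<in> borel_measurable dyadic_paths" for t \<Psi>
      by (rule levy_markov_splice[OF levy _ that]) simp
    show "AE \<omega> in M. \<forall>c. \<exists>n::nat. \<forall>q\<in>dyadics. real n \<le> q \<longrightarrow> c \<le> ?Z q \<omega>" by (rule dr)
    show "AE \<omega> in M. \<exists>c. \<forall>q\<in>dyadics. c \<le> ?Z q \<omega>"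
      using dr AE_space
    proof eventually_elim
      case (elim \<omega>)
      then obtain n :: nat where n: "\<And>q. q \<in> dyadics \<Longrightarrow> real n \<le> q \<Longrightarrow> 0 \<le> ?Z q \<omega>" by blast
      obtain c where c: "\<And>q. q \<in> {0..real n} \<Longrightarrow> c \<le> ?Z q \<omega>"
        using cadlag_bounded_below[OF cad[OF elim(2)]] by blast
      have "min 0 c \<le> ?Z q \<omega>" if "q \<in> dyadics" for q
        using n[OF that] c[of q] that by (cases "q \<le> real n") auto
      then show ?case by blast
    qed
    fix e :: real and N :: nat assume e: "0 < e"
    show "AE \<omega> in M. \<forall>\<^sub>F k in sequentially.
      \<forall>j<N * 2 ^ k. ?Z (real j / 2 ^ k) \<omega> - e \<le> ?Z (real (Suc j) / 2 ^ k) \<omega>"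
      using nj AE_space
    proof eventually_elim
      case (elim \<omega>)
      let ?f = "\<lambda>t. ?Z t \<omega>"
      obtain d where d: "0 < d" "\<And>s u. 0 \<le> s \<Longrightarrow> s \<le> u \<Longrightarrow> u \<le> real N \<Longrightarrow> u < s + d \<Longrightarrow> ?f s - e \<le> ?f u"
        using cadlag_small_drops[OF cad[OF elim(2)] elim(1) e, of "real N"] by blast
      have "(\<lambda>k. 1 / 2 ^ k :: real) \<longlonglongrightarrow> 0" by real_asymp
      then have "\<forall>\<^sub>F k in sequentially. 1 / 2 ^ k < d" using d(1) by (rule order_tendstoD)
      then show ?case
      proof eventually_elim
        case (elim k)
        show ?case
        proof (intro allI impI)
          fix j assume j: "j < N * 2 ^ k"
          then have "real (Suc j) \<le> real (N * 2 ^ k)" by (simp only: of_nat_le_iff Suc_le_eq)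
          then have "real (Suc j) / 2 ^ k \<le> real N" by (simp add: divide_le_eq)
          moreover have "real (Suc j) / 2 ^ k = real j / 2 ^ k + 1 / 2 ^ k" by (simp add: add_divide_distrib)
          ultimately show "?f (real j / 2 ^ k) - e \<le> ?f (real (Suc j) / 2 ^ k)"
            using elim by (intro d(2)) auto
        qed
      qed
    qed
  qed
qed

text \<open>Conditioning divides an expectation over the event \<open>S\<close> by its probability,
  and the grid estimate carries exactly this probability as a factor, so it cancels. Fatou's lemma
  removes the grid.\<close>

lemma conditioned_functional_bound:
  fixes Z :: "real \<Rightarrow> 'a \<Rightarrow> real"
  assumes sp: "spectrally_positive_levy_process M Z" and drift: "drifts_to_infinity M Z"
  shows "\<exists>l>0. \<forall>n x. 0 < x \<longrightarrow> (\<integral>f. exp (l * truncated_functional n f) \<partial>conditioned_law M Z x) \<le> 2"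
proof -
  define X where "X = (\<lambda>t \<omega>. Z t \<omega> - Z 0 \<omega>)"
  interpret dyadic_levy M X unfolding X_def by (rule dyadic_levyI[OF sp drift])
  have levyZ: "levy_process M Z" using sp by (simp add: spectrally_positive_levy_process_def)
  have cpZ: "cadlag_process M Z" using levyZ by (simp add: levy_process_def)
  have Z0: "AE \<omega> in M. Z 0 \<omega> = 0" using levyZ by (simp add: levy_process_def)
  have cZ: "cadlag (\<lambda>t. Z t \<omega>)" if "\<omega> \<in> space M" for \<omega>
    using cpZ that by (simp add: cadlag_process_def)
  obtain l where l: "0 < l" and bound: "\<And>x k m. 0 < x \<Longrightarrow>
     EE (\<lambda>f. ennreal (exp (l * (\<Sum>j=1..m. exp (- (x + f (real j / 2 ^ k))) / 2 ^ k))) * of_bool (stays x f))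
       \<le> 2 * ennreal (pr (stays x))"
    using exponential_moment_bound by blast
  have "(\<integral>f. exp (l * truncated_functional n f) \<partial>conditioned_law M Z x) \<le> 2" if x: "0 < x" for n x
  proof -
    define S where "S = {\<omega>\<in>space M. (INF t\<in>{0..}. ereal (x + Z t \<omega>)) > 0}"
    have S_eq: "S = {\<omega> \<in> space M. stays x (dyadic_path Z \<omega>)}"
      unfolding S_def using INF_pos_iff_stays[OF cZ, of _ "dyadic_path Z _" x] by auto
    have Zm: "dyadic_path Z \<in> M \<rightarrow>\<^sub>M dyadic_paths"
      using cpZ by (intro measurable_dyadic_path) (simp add: cadlag_process_def)
    have Sm [measurable]: "S \<in> sets M"
      unfolding S_eq using measurable_compose[OF Zm pred_stays[of x]] by (simp add: pred_def)
    \<comment> \<open>The conditioning event is written with \<open>Z\<close> while the estimates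
      concern \<open>X\<close>; the paths agree almost surely, so events and integrands may be
      exchanged.\<close>
    have XZ: "AE \<omega> in M. dyadic_path X \<omega> = dyadic_path Z \<omega>"
      using Z0 by eventually_elim (simp add: X_def dyadic_path_def)
    have pS: "emeasure M S = ennreal (pr (stays x))"
    proof -
      have "emeasure M S = emeasure M {\<omega> \<in> space M. stays x (dyadic_path X \<omega>)}"
        using XZ Sm unfolding S_eq by (intro emeasure_eq_AE event pred_stays) (auto elim: eventually_mono)
      then show ?thesis by (simp add: emeasure_eq_measure pr_def)
    qed
    have S0: "0 < emeasure M S" using stays_pos[OF x] by (simp add: pS)
    let ?U = "uniform_measure M S"
    interpret U: prob_space ?U using S0 by (intro prob_space_uniform_measure) auto
    have cxZ: "cadlag (\<lambda>t. x + Z t \<omega>)" if "\<omega> \<in> space M" for \<omega>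
      by (rule cadlag_add_const[OF cZ[OF that]])
    have pm: "(\<lambda>\<omega>. \<lambda>t\<in>{0..}. x + Z t \<omega>) \<in> M \<rightarrow>\<^sub>M path_space"
      using cpZ cxZ by (intro measurable_process_path) (auto simp: cadlag_process_def)
    then have pmU: "(\<lambda>\<omega>. \<lambda>t\<in>{0..}. x + Z t \<omega>) \<in> ?U \<rightarrow>\<^sub>M path_space" by simp
    define \<Phi> where "\<Phi> = (\<lambda>\<omega>. exp (l * truncated_functional n (\<lambda>t. x + Z t \<omega>)))"
    have \<Phi>eq: "exp (l * truncated_functional n (\<lambda>t\<in>{0..}. x + Z t \<omega>)) = \<Phi> \<omega>" for \<omega>
      unfolding \<Phi>_def by (subst truncated_functional_cong[of "\<lambda>t\<in>{0..}. x + Z t \<omega>" "\<lambda>t. x + Z t \<omega>"]) auto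
    have em: "(\<lambda>f. exp (l * truncated_functional n f)) \<in> borel_measurable path_space"
      using truncated_functional_measurable[of n] by measurable
    have \<Phi>m [measurable]: "\<Phi> \<in> borel_measurable M"
      using measurable_compose[OF pm em] by (simp add: \<Phi>eq)
    have int_eq: "(\<integral>f. exp (l * truncated_functional n f) \<partial>conditioned_law M Z x) = (\<integral>\<omega>. \<Phi> \<omega> \<partial>?U)"
      unfolding conditioned_law_def process_law_def S_def[symmetric]
      by (subst integral_distr[OF pmU em]) (simp add: \<Phi>eq)
    define w where "w = (\<lambda>k \<omega>. exp (l * (\<Sum>j=1..n * 2 ^ k. min (real n) (exp (- (x + Z (real j / 2 ^ k) \<omega>))) / 2 ^ k)))"
    have Zmeas [measurable]: "Z (real j / 2 ^ k) \<in> borel_measurable M" for j k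
      using cpZ by (simp add: cadlag_process_def)
    have wm [measurable]: "w k \<in> borel_measurable M" for k unfolding w_def by measurable
    have w_lim: "(\<lambda>k. w k \<omega>) \<longlonglongrightarrow> \<Phi> \<omega>" if "\<omega> \<in> space M" for \<omega>
      unfolding w_def \<Phi>_def
      by (intro tendsto_intros riemann_sum_tendsto(1)[OF cxZ[OF that]])
    have w_bound: "(\<integral>\<^sup>+\<omega>. ennreal (w k \<omega>) * indicator S \<omega> \<partial>M) \<le> 2 * emeasure M S" for k
    proof -
      have "(\<integral>\<^sup>+\<omega>. ennreal (w k \<omega>) * indicator S \<omega> \<partial>M) \<le>
        (\<integral>\<^sup>+\<omega>. ennreal (exp (l * (\<Sum>j=1..n * 2 ^ k. exp (- (x + dyadic_path X \<omega> (real j / 2 ^ k))) / 2 ^ k)))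
           * of_bool (stays x (dyadic_path X \<omega>)) \<partial>M)"
      proof (rule nn_integral_mono_AE)
        show "AE \<omega> in M. ennreal (w k \<omega>) * indicator S \<omega> \<le>
           ennreal (exp (l * (\<Sum>j=1..n * 2 ^ k. exp (- (x + dyadic_path X \<omega> (real j / 2 ^ k))) / 2 ^ k)))
           * of_bool (stays x (dyadic_path X \<omega>))"
          using XZ
        proof eventually_elim
          case (elim \<omega>)
          \<comment> \<open>Dropping the cap only increases the Riemann sum and produces the sum
            bounded on the grid.\<close>
          have "w k \<omega> \<le> exp (l * (\<Sum>j=1..n * 2 ^ k. exp (- (x + Z (real j / 2 ^ k) \<omega>)) / 2 ^ k))"
            unfolding w_def using l by (auto intro!: mult_left_mono sum_mono divide_right_mono)
          then show ?case unfolding elim by (auto simp: S_eq indicator_def intro!: ennreal_leI)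
        qed
      qed
      also have "\<dots> \<le> 2 * emeasure M S"
        using bound[OF x, of k "n * 2 ^ k"] by (simp only: EE_def pS)
      finally show ?thesis .
    qed
    have "(\<integral>\<^sup>+\<omega>. ennreal (\<Phi> \<omega>) * indicator S \<omega> \<partial>M) \<le> 2 * emeasure M S"
    proof -
      have "(\<integral>\<^sup>+\<omega>. ennreal (\<Phi> \<omega>) * indicator S \<omega> \<partial>M) = (\<integral>\<^sup>+\<omega>. liminf (\<lambda>k. ennreal (w k \<omega>) * indicator S \<omega>) \<partial>M)"
      proof (rule nn_integral_cong)
        fix \<omega> assume "\<omega> \<in> space M"
        then have "(\<lambda>k. ennreal (w k \<omega>) * indicator S \<omega>) \<longlonglongrightarrow> ennreal (\<Phi> \<omega>) * indicator S \<omega>"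
          by (cases "\<omega> \<in> S") (auto intro!: tendsto_ennrealI w_lim)
        then show "ennreal (\<Phi> \<omega>) * indicator S \<omega> = liminf (\<lambda>k. ennreal (w k \<omega>) * indicator S \<omega>)"
          by (rule lim_imp_Liminf[symmetric, rotated]) simp
      qed
      also have "\<dots> \<le> liminf (\<lambda>k. \<integral>\<^sup>+\<omega>. ennreal (w k \<omega>) * indicator S \<omega> \<partial>M)"
        by (rule nn_integral_liminf) measurable
      also have "\<dots> \<le> liminf (\<lambda>k. 2 * emeasure M S)"
        using w_bound by (intro Liminf_mono always_eventually allI)
      also have "\<dots> = 2 * emeasure M S" by (simp add: Liminf_const)
      finally show ?thesis .
    qed
    then have "(\<integral>\<^sup>+\<omega>. ennreal (\<Phi> \<omega>) \<partial>?U) \<le> 2"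
      using S0 by (subst nn_integral_uniform_measure) (auto intro!: divide_le_posI_ennreal simp: mult.commute)
    moreover have "(\<integral>\<omega>. \<Phi> \<omega> \<partial>?U) = enn2real (\<integral>\<^sup>+\<omega>. ennreal (\<Phi> \<omega>) \<partial>?U)"
      by (rule integral_eq_nn_integral) (auto simp: \<Phi>_def[abs_def, symmetric], simp add: \<Phi>_def)
    ultimately show ?thesis
      unfolding int_eq using enn2real_mono[of "\<integral>\<^sup>+\<omega>. ennreal (\<Phi> \<omega>) \<partial>?U" 2] by simp
  qed
  then show ?thesis using l by blast
qed

text \<open>At each fixed time both truncations become inactive for large \<open>n\<close>, and the
  integrands increase with \<open>n\<close>; monotone convergence gives the rest.\<close>

lemma SUP_truncated_functional:
  assumes f: "cadlag f"
  shows "(SUP n. ennreal (truncated_functional n f)) = exp_functional f"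
    and "incseq (\<lambda>n. ennreal (truncated_functional n f))"
proof -
  let ?h = "\<lambda>n t. ennreal (min (real n) (exp (- f t)) * indicator {0..<real n} t)"
  note hm = riemann_sum_tendsto(2)[OF f]
  have eq: "ennreal (truncated_functional n f) = (\<integral>\<^sup>+t. ?h n t \<partial>lborel)" for n
    unfolding truncated_functional_def
  proof (rule nn_integral_eq_integral[symmetric])
    show "integrable lborel (\<lambda>t. min (real n) (exp (- f t)) * indicator {0..<real n} t)"
    proof (rule Bochner_Integration.integrable_bound[OF _ hm])
      show "integrable lborel (\<lambda>t. real n * indicator {0..<real n} t)" by simp
      show "AE t in lborel. norm (min (real n) (exp (- f t)) * indicator {0..<real n} t)
          \<le> norm (real n * indicator {0..<real n} t)"
        by (intro AE_I2) (simp add: indicator_def)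
    qed
  qed simp
  have mono: "incseq ?h"
    by (intro incseq_SucI le_funI ennreal_leI) (auto split: split_indicator simp: min_def)
  show "incseq (\<lambda>n. ennreal (truncated_functional n f))"
    unfolding eq by (intro incseq_SucI nn_integral_mono) (rule incseq_SucD[OF mono, THEN le_funD])
  have "(SUP n. ennreal (truncated_functional n f)) = (SUP n. \<integral>\<^sup>+t. ?h n t \<partial>lborel)" by (simp add: eq)
  also have "\<dots> = (\<integral>\<^sup>+t. (SUP n. ?h n t) \<partial>lborel)"
    by (rule nn_integral_monotone_convergence_SUP[OF mono, symmetric]) (use hm in measurable)
  also have "\<dots> = exp_functional f"
    unfolding exp_functional_def
  proof (rule nn_integral_cong)
    fix t
    show "(SUP n. ?h n t) = ennreal (exp (- f t)) * indicator {0..} t"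
    proof (cases "0 \<le> t")
      case True
      have "(\<lambda>n. ?h n t) \<longlonglongrightarrow> ennreal (exp (- f t))"
      proof (rule tendsto_eventually)
        have "\<forall>\<^sub>F n in sequentially. t < real n" by real_asymp
        moreover have "\<forall>\<^sub>F n in sequentially. exp (- f t) \<le> real n" by real_asymp
        ultimately show "\<forall>\<^sub>F n in sequentially. ?h n t = ennreal (exp (- f t))"
          by eventually_elim (use True in simp)
      qed
      moreover have "incseq (\<lambda>n. ?h n t)"
        by (intro incseq_SucI) (rule incseq_SucD[OF mono, THEN le_funD])
      ultimately have "(SUP n. ?h n t) = ennreal (exp (- f t))"
        by (intro LIMSEQ_unique[OF LIMSEQ_SUP])
      then show ?thesis using True by simp
    qed simp
  qed
  finally show "(SUP n. ennreal (truncated_functional n f)) = exp_functional f" .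
qed

theorem theorem1p13:
  fixes M :: "'a measure" and Z :: "real \<Rightarrow> 'a \<Rightarrow> real"
    and N :: "'b measure" and Y :: "real \<Rightarrow> 'b \<Rightarrow> real"
  assumes "spectrally_positive_levy_process M Z"
    and "unbounded_variation M Z"
    and "drifts_to_infinity M Z"
    and "conditioned_to_stay_positive M Z N Y"
  shows "(AE \<omega> in N. exp_functional (\<lambda>t. Y t \<omega>) < \<infinity>) \<and>
    (\<exists>c>0. integrable N (\<lambda>\<omega>. exp (c * enn2real (exp_functional (\<lambda>t. Y t \<omega>)))))"
proof -
  obtain l where l: "0 < l" and
    cond: "\<And>n x. 0 < x \<Longrightarrow> (\<integral>f. exp (l * truncated_functional n f) \<partial>conditioned_law M Z x) \<le> 2"
    using conditioned_functional_bound[OF assms(1,3)] by blast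
  have cY: "cadlag_process N Y"
    and conv: "converges_in_distribution (conditioned_law M Z) (process_law N Y) (at_right 0)"
    using assms(4) by (simp_all add: conditioned_to_stay_positive_def)
  interpret N: prob_space N using cY by (simp add: cadlag_process_def)
  have cad: "cadlag (\<lambda>t. Y t \<omega>)" if "\<omega> \<in> space N" for \<omega>
    using cY that by (simp add: cadlag_process_def)
  have pm: "(\<lambda>\<omega>. \<lambda>t\<in>{0..}. Y t \<omega>) \<in> N \<rightarrow>\<^sub>M path_space"
    using cY cad by (intro measurable_process_path) (auto simp: cadlag_process_def)
  define I where "I = (\<lambda>n \<omega>. truncated_functional n (\<lambda>t. Y t \<omega>))"
  define J where "J = (\<lambda>\<omega>. exp_functional (\<lambda>t. Y t \<omega>))"
  have Ieq: "truncated_functional n (\<lambda>t\<in>{0..}. Y t \<omega>) = I n \<omega>" for n \<omega>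
    unfolding I_def by (rule truncated_functional_cong) simp
  have I0: "0 \<le> I n \<omega>" for n \<omega> unfolding I_def by (rule truncated_functional_bounds)
  have Ib: "I n \<omega> \<le> real n * real n" for n \<omega> unfolding I_def by (rule truncated_functional_bounds)
  have Im [measurable]: "I n \<in> borel_measurable N" for n
    using measurable_compose[OF pm truncated_functional_measurable[of n]] by (simp add: Ieq)
  have J_SUP: "J \<omega> = (SUP n. ennreal (I n \<omega>))" and I_inc: "incseq (\<lambda>n. ennreal (I n \<omega>))"
    if "\<omega> \<in> space N" for \<omega>
    using SUP_truncated_functional[OF cad[OF that]] by (simp_all add: I_def J_def)
  have Jm [measurable]: "J \<in> borel_measurable N"
    by (subst measurable_cong[OF J_SUP]) measurable
  \<comment> \<open>The truncated functional is bounded and continuous, so weak convergence applies;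
    a bound valid for every starting point x > 0 persists in the limit at 0.\<close>
  have exp_bound: "(\<integral>\<^sup>+\<omega>. ennreal (exp (l * I n \<omega>)) \<partial>N) \<le> 2" for n
  proof -
    let ?\<Phi> = "\<lambda>f. exp (l * truncated_functional n f)"
    have em: "?\<Phi> \<in> borel_measurable path_space"
      using truncated_functional_measurable[of n] by measurable
    have up: "?\<Phi> f \<le> exp (l * (real n * real n))" for f
      using truncated_functional_bounds(2)[of n f] l by simp
    then have "bounded (?\<Phi> ` space path_space)"
      by (intro boundedI[of _ "exp (l * (real n * real n))"]) auto
    moreover have "skorokhod_continuous ?\<Phi>"
      unfolding skorokhod_continuous_def
      by (intro allI impI tendsto_intros truncated_functional_skorokhod) auto
    ultimately have "((\<lambda>x. \<integral>f. ?\<Phi> f \<partial>conditioned_law M Z x) \<longlongrightarrow> (\<integral>f. ?\<Phi> f \<partial>process_law N Y)) (at_right 0)"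
      using conv em unfolding converges_in_distribution_def by blast
    then have "(\<integral>f. ?\<Phi> f \<partial>process_law N Y) \<le> 2"
    proof (rule tendsto_upperbound)
      show "\<forall>\<^sub>F x in at_right 0. (\<integral>f. ?\<Phi> f \<partial>conditioned_law M Z x) \<le> 2"
        using eventually_at_right_less[of 0] by eventually_elim (rule cond)
    qed simp
    also have "(\<integral>f. ?\<Phi> f \<partial>process_law N Y) = (\<integral>\<omega>. exp (l * I n \<omega>) \<partial>N)"
      unfolding process_law_def by (subst integral_distr[OF pm em]) (simp add: Ieq)
    finally have "(\<integral>\<omega>. exp (l * I n \<omega>) \<partial>N) \<le> 2" .
    moreover have "integrable N (\<lambda>\<omega>. exp (l * I n \<omega>))"
      by (rule N.integrable_const_bound[of _ "exp (l * (real n * real n))"])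
        (use Ib l in \<open>auto intro!: AE_I2 mult_left_mono\<close>)
    then have "(\<integral>\<^sup>+\<omega>. ennreal (exp (l * I n \<omega>)) \<partial>N) = ennreal (\<integral>\<omega>. exp (l * I n \<omega>) \<partial>N)"
      by (rule nn_integral_eq_integral) simp
    ultimately show ?thesis using ennreal_leI[of _ 2] by simp
  qed
  \<comment> \<open>From u \<le> exp u the truncated functionals have expectations at most 2/l, and
    monotone convergence carries this over to \<open>J\<close>.\<close>
  have fin: "AE \<omega> in N. J \<omega> \<noteq> \<infinity>"
  proof (rule nn_integral_PInf_AE[OF Jm])
    have "(\<integral>\<^sup>+\<omega>. ennreal (I n \<omega>) \<partial>N) \<le> ennreal (2 / l)" for n
    proof -
      have "(\<integral>\<^sup>+\<omega>. ennreal (I n \<omega>) \<partial>N) \<le> (\<integral>\<^sup>+\<omega>. ennreal (1 / l) * ennreal (exp (l * I n \<omega>)) \<partial>N)"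
      proof (rule nn_integral_mono)
        fix \<omega>
        have "l * I n \<omega> \<le> exp (l * I n \<omega>)" using exp_ge_add_one_self[of "l * I n \<omega>"] by linarith
        then have "I n \<omega> \<le> 1 / l * exp (l * I n \<omega>)" using l by (simp add: field_simps)
        then show "ennreal (I n \<omega>) \<le> ennreal (1 / l) * ennreal (exp (l * I n \<omega>))"
          using l by (simp add: ennreal_mult''[symmetric] ennreal_leI)
      qed
      also have "\<dots> = ennreal (1 / l) * (\<integral>\<^sup>+\<omega>. ennreal (exp (l * I n \<omega>)) \<partial>N)"
        by (rule nn_integral_cmult) measurable
      also have "\<dots> \<le> ennreal (1 / l) * 2" by (intro mult_left_mono exp_bound) simp
      also have "\<dots> = ennreal (2 / l)"
        using l by (subst ennreal_numeral[symmetric]) (simp add: ennreal_mult''[symmetric] del: ennreal_numeral)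
      finally show ?thesis .
    qed
    then have le: "(SUP n. \<integral>\<^sup>+\<omega>. ennreal (I n \<omega>) \<partial>N) \<le> ennreal (2 / l)" by (rule SUP_least)
    have "(\<integral>\<^sup>+\<omega>. J \<omega> \<partial>N) = (\<integral>\<^sup>+\<omega>. (SUP n. ennreal (I n \<omega>)) \<partial>N)"
      by (rule nn_integral_cong) (rule J_SUP)
    also have "\<dots> = (SUP n. \<integral>\<^sup>+\<omega>. ennreal (I n \<omega>) \<partial>N)"
      by (rule nn_integral_monotone_convergence_SUP_AE) (auto intro!: AE_I2 incseq_SucD[OF I_inc])
    also note le
    also have "ennreal (2 / l) < \<infinity>" by simp
    finally show "(\<integral>\<^sup>+\<omega>. J \<omega> \<partial>N) \<noteq> \<infinity>" by (rule less_imp_neq)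
  qed
  have "integrable N (\<lambda>\<omega>. exp (l * enn2real (J \<omega>)))"
  proof (rule integrableI_nonneg)
    have "(\<integral>\<^sup>+\<omega>. ennreal (exp (l * enn2real (J \<omega>))) \<partial>N) \<le> (\<integral>\<^sup>+\<omega>. liminf (\<lambda>n. ennreal (exp (l * I n \<omega>))) \<partial>N)"
    proof (rule nn_integral_mono_AE)
      show "AE \<omega> in N. ennreal (exp (l * enn2real (J \<omega>))) \<le> liminf (\<lambda>n. ennreal (exp (l * I n \<omega>)))"
        \<comment> \<open>\<open>enn2real\<close> sends infinity to 0, so the real values
          \<open>I n\<close> converge to \<open>enn2real (J \<omega>)\<close> only where
          \<open>J\<close> is finite; finiteness therefore has to come before the exponential
          moment.\<close>
        using fin AE_space
      proof eventually_elim
        case (elim \<omega>)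
        have "(\<lambda>n. ennreal (I n \<omega>)) \<longlonglongrightarrow> J \<omega>"
          unfolding J_SUP[OF elim(2)] by (rule LIMSEQ_SUP[OF I_inc[OF elim(2)]])
        then have "(\<lambda>n. enn2real (ennreal (I n \<omega>))) \<longlonglongrightarrow> enn2real (J \<omega>)"
          using elim(1) by (intro tendsto_enn2real) (auto simp: less_top)
        then have "(\<lambda>n. I n \<omega>) \<longlonglongrightarrow> enn2real (J \<omega>)" by (simp add: I0)
        then have "(\<lambda>n. ennreal (exp (l * I n \<omega>))) \<longlonglongrightarrow> ennreal (exp (l * enn2real (J \<omega>)))"
          by (intro tendsto_intros)
        then have "liminf (\<lambda>n. ennreal (exp (l * I n \<omega>))) = ennreal (exp (l * enn2real (J \<omega>)))"
          by (rule lim_imp_Liminf[rotated]) simp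
        then show ?case by (simp only: order_refl)
      qed
    qed
    also have "\<dots> \<le> liminf (\<lambda>n. \<integral>\<^sup>+\<omega>. ennreal (exp (l * I n \<omega>)) \<partial>N)"
      by (rule nn_integral_liminf) measurable
    also have "\<dots> \<le> liminf (\<lambda>n. 2)"
      by (intro Liminf_mono always_eventually allI exp_bound)
    also have "\<dots> < \<infinity>" by (simp add: Liminf_const)
    finally show "(\<integral>\<^sup>+\<omega>. ennreal (exp (l * enn2real (J \<omega>))) \<partial>N) < \<infinity>" .
  qed auto
  moreover have "AE \<omega> in N. J \<omega> < \<infinity>" using fin by eventually_elim (simp add: less_top)
  ultimately show ?thesis using l unfolding J_def by blast
qed

end
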